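(* Let $T>0$, $\lambda\in(0,\frac12]$, $x_0\in(0,1)$, and $H_\lambda=\dfrac{\log 2}{\log 2-\log(1-\lambda)}\in[\tfrac12,1)$. Let $\mathfrak{c}$ be the middle-$\lambda$ Cantor function and let $\mathfrak{c}_n$ ($n\ge 0$) be the iterates started from a bounded function $\mathfrak{c}_0:[0,1]\to\mathbb{R}$, with extensions $\overline{\mathfrak{c}},\overline{\mathfrak{c}}_n:\mathbb{R}\to\mathbb{R}$ (all defined in the context). Suppose that there exists $c_{H_\lambda}>0$ such that $|\overline{\mathfrak{c}}_0(x)-\overline{\mathfrak{c}}_0(y)|\le c_{H_\lambda}|x-y|^{H_\lambda}$ for all $x,y\in\mathbb{R}$ with $|x-y|\le1$. Let $X$ and $X_n$ be solutions, with respect to the same Brownian motion $B$, of $$X(t)=x_0+\int_0^t\overline{\mathfrak{c}}(X(s))\,dB_s,\qquad X_n(t)=x_0+\int_0^t\overline{\mathfrak{c}}_n(X_n(s))\,dB_s .$$ Then there exists $C(T,\lambda)>0$, depending on $T$ and $\lambda$, such that for all $n\in\mathbb{N}$, $$\mathbb{E}\Big(\sup_{0\le t\le T}|X(t)-X_n(t)|\Big)\le C(T,\lambda)\times\begin{cases}n^{-\frac12} & \text{if }\lambda=\tfrac12,\\ 2^{-n\left(1-1/(2H_\lambda)\right)} & \text{if }\lambda\in(0,\tfrac12).\end{cases}$$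
   Context: $B$ is a one-dimensional Brownian motion on a filtered probability space, and $\mathbb{N}=\{1,2,\dots\}$. For $\lambda\in(0,1)$ and a bounded function $\mathfrak{c}_0:[0,1]\to\mathbb{R}$, define for $n\ge0$ $$\mathfrak{c}_{n+1}(x)=\begin{cases}\frac12\mathfrak{c}_n\big(\frac{2}{1-\lambda}x\big) & 0\le x<\frac{1-\lambda}{2},\\ \frac12 & \frac{1-\lambda}{2}\le x<\frac{1+\lambda}{2},\\ \frac12+\frac12\mathfrak{c}_n\big(\frac{2}{1-\lambda}x-\frac{1+\lambda}{1-\lambda}\big) & \frac{1+\lambda}{2}\le x\le1.\end{cases}$$ The middle-$\lambda$ Cantor function $\mathfrak{c}:[0,1]\to\mathbb{R}$ is the unique bounded function satisfying the same relation with both $\mathfrak{c}_n$ and $\mathfrak{c}_{n+1}$ replaced by $\mathfrak{c}$; it is the uniform limit of $\mathfrak{c}_n$. A function $g:[0,1]\to\mathbb{R}$ is extended to $\overline g:\mathbb{R}\to\mathbb{R}$ by $\overline g(x)=0$ for $x<0$, $\overline g(x)=g(x)$ for $0\le x\le1$, $\overline g(x)=1$ for $x>1$. The function $\mathfrak{c}_0$ is fixed, so $C(T,\lambda)$ may also depend on it (e.g. through $c_{H_\lambda}$), but not on $n$. *)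

theory Defs
  imports "HOL-Probability.Probability"
begin

section \<open>Middle-\<open>\<lambda>\<close> Cantor functions\<close>

text \<open>
  Functions on \<open>[0,1]\<close> are represented by functions on \<^typ>\<open>real\<close> whose values outside
  \<open>{0..1}\<close> are irrelevant: for \<open>x\<close> in \<open>{0..1}\<close> the value \<open>cantor_step lam g x\<close> depends only on
  the values of \<open>g\<close> on \<open>{0..1}\<close>.
\<close>

definition cantor_step :: "real \<Rightarrow> (real \<Rightarrow> real) \<Rightarrow> real \<Rightarrow> real" where
  "cantor_step lam g x =
    (if x < (1 - lam) / 2 then g (2 / (1 - lam) * x) / 2
     else if x < (1 + lam) / 2 then 1 / 2
     else 1 / 2 + g (2 / (1 - lam) * x - (1 + lam) / (1 - lam)) / 2)"

primrec cantor_iter :: "real \<Rightarrow> (real \<Rightarrow> real) \<Rightarrow> nat \<Rightarrow> real \<Rightarrow> real" where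
  "cantor_iter lam c0 0 = c0"
| "cantor_iter lam c0 (Suc n) = cantor_step lam (cantor_iter lam c0 n)"

definition is_cantor_fun :: "real \<Rightarrow> (real \<Rightarrow> real) \<Rightarrow> bool" where
  "is_cantor_fun lam c \<longleftrightarrow>
    bounded (c ` {0..1}) \<and> (\<forall>x\<in>{0..1}. c x = cantor_step lam c x)"

text \<open>Restricting to \<^const>\<open>extensional\<close> functions makes the values outside \<open>{0..1}\<close> unique, too.\<close>

definition cantor_fun :: "real \<Rightarrow> real \<Rightarrow> real" where
  "cantor_fun lam = (THE c. c \<in> extensional {0..1} \<and> is_cantor_fun lam c)"

definition ext01 :: "(real \<Rightarrow> real) \<Rightarrow> real \<Rightarrow> real" where
  "ext01 g x = (if x < 0 then 0 else if x \<le> 1 then g x else 1)"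

definition hoelder_exponent :: "real \<Rightarrow> real" where
  "hoelder_exponent lam = ln 2 / (ln 2 - ln (1 - lam))"

lemma cantor_step_diff:
  assumes lam: "0 < lam" "lam < 1" and x: "x \<in> {0..1}"
    and d: "\<And>y. y \<in> {0..1} \<Longrightarrow> \<bar>f y - g y\<bar> \<le> d"
  shows "\<bar>cantor_step lam f x - cantor_step lam g x\<bar> \<le> d / 2"
proof -
  have d0: "0 \<le> d"
    using d[of 0] by auto
  consider "x < (1 - lam) / 2" | "\<not> x < (1 - lam) / 2" "x < (1 + lam) / 2" | "\<not> x < (1 + lam) / 2"
    by blast
  then show ?thesis
  proof cases
    case 1
    then have "2 / (1 - lam) * x \<in> {0..1}"
      using lam x by (auto simp: field_simps)
    from d[OF this] show ?thesis
      using 1 by (simp add: cantor_step_def abs_if split: if_splits)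
  next
    case 2
    then show ?thesis using d0 by (simp add: cantor_step_def)
  next
    case 3
    have "2 / (1 - lam) * x - (1 + lam) / (1 - lam) = (2 * x - (1 + lam)) / (1 - lam)"
      by (simp add: diff_divide_distrib)
    moreover have "\<dots> \<in> {0..1}"
      using lam x 3 by (auto simp: field_simps)
    ultimately have "2 / (1 - lam) * x - (1 + lam) / (1 - lam) \<in> {0..1}" by simp
    from d[OF this] show ?thesis
      using 3 lam by (simp add: cantor_step_def abs_if split: if_splits)
  qed
qed

lemma is_cantor_fun_unique:
  assumes lam: "0 < lam" "lam < 1" and c: "is_cantor_fun lam c" "is_cantor_fun lam c'"
    and x: "x \<in> {0..1}"
  shows "c x = c' x"
proof -
  obtain a b where a: "\<And>y. y \<in> {0..1} \<Longrightarrow> \<bar>c y\<bar> \<le> a" and b: "\<And>y. y \<in> {0..1} \<Longrightarrow> \<bar>c' y\<bar> \<le> b"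
    using c unfolding is_cantor_fun_def bounded_iff by (metis imageI real_norm_def)
  have *: "\<forall>y\<in>{0..1}. \<bar>c y - c' y\<bar> \<le> (a + b) * (1 / 2) ^ n" for n
  proof (induction n)
    case 0
    show ?case
    proof
      fix y :: real assume "y \<in> {0..1}"
      then show "\<bar>c y - c' y\<bar> \<le> (a + b) * (1 / 2) ^ 0"
        using a[of y] b[of y] by (auto simp: abs_if split: if_splits)
    qed
  next
    case (Suc n)
    show ?case
    proof
      fix y :: real assume y: "y \<in> {0..1}"
      have "\<bar>cantor_step lam c y - cantor_step lam c' y\<bar> \<le> (a + b) * (1 / 2) ^ n / 2"
        using Suc y lam by (intro cantor_step_diff) auto
      then show "\<bar>c y - c' y\<bar> \<le> (a + b) * (1 / 2) ^ Suc n"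
        using c y by (simp add: is_cantor_fun_def)
    qed
  qed
  have "(\<lambda>n. (a + b) * (1 / 2) ^ n) \<longlonglongrightarrow> (a + b) * 0"
    by (intro tendsto_intros LIMSEQ_power_zero) simp
  then have "\<bar>c x - c' x\<bar> \<le> (a + b) * 0"
    by (rule LIMSEQ_le_const) (use * x in blast)
  then show ?thesis by simp
qed

lemma is_cantor_fun_exists:
  assumes lam: "0 < lam" "lam < 1"
  shows "\<exists>c. is_cantor_fun lam c"
proof -
  define u where "u = cantor_iter lam (\<lambda>_. 0)"
  have u_Suc: "u (Suc n) = cantor_step lam (u n)" for n
    by (simp add: u_def)
  have bnd: "\<forall>y. 0 \<le> u n y \<and> u n y \<le> 1" for n
  proof (induction n)
    case 0
    show ?case by (simp add: u_def)
  next
    case (Suc n)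
    have *: "u n z \<le> 2" "1 / 2 + u n z / 2 \<le> 1" "0 \<le> 1 / 2 + u n z / 2" for z
      using Suc[rule_format, of z] by linarith+
    show ?case using Suc * by (simp add: u_Suc cantor_step_def)
  qed
  have diff: "\<forall>y\<in>{0..1}. \<bar>u (n + k) y - u n y\<bar> \<le> (1 / 2) ^ n" for n k
  proof (induction n)
    case 0
    then show ?case using bnd[of k] bnd[of 0] by (auto simp: u_def)
  next
    case (Suc n)
    show ?case
    proof
      fix y :: real assume y: "y \<in> {0..1}"
      have "\<bar>cantor_step lam (u (n + k)) y - cantor_step lam (u n) y\<bar> \<le> (1 / 2) ^ n / 2"
        using Suc y lam by (intro cantor_step_diff) auto
      then show "\<bar>u (Suc n + k) y - u (Suc n) y\<bar> \<le> (1 / 2) ^ Suc n"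
        by (simp add: u_Suc)
    qed
  qed
  have conv: "(\<lambda>n. u n y) \<longlonglongrightarrow> lim (\<lambda>n. u n y)" if y: "y \<in> {0..1}" for y
  proof -
    have "Cauchy (\<lambda>n. u n y)"
    proof (rule metric_CauchyI)
      fix e :: real assume "e > 0"
      then obtain N where N: "(1 / 2) ^ N < e / 2"
        using real_arch_pow_inv[of "e / 2" "1 / 2"] by auto
      have "\<bar>u m y - u N y\<bar> < e / 2" if "m \<ge> N" for m
        using diff[of N "m - N"] y N that by (fastforce intro: le_less_trans)
      then have "dist (u m y) (u n y) < e" if "m \<ge> N" "n \<ge> N" for m n
        using that by (metis dist_real_def dist_triangle_half_l)
      then show "\<exists>M. \<forall>m\<ge>M. \<forall>n\<ge>M. dist (u m y) (u n y) < e" by blast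
    qed
    then show ?thesis
      by (simp add: Cauchy_convergent_iff convergent_LIMSEQ_iff)
  qed
  define c where "c = (\<lambda>y. lim (\<lambda>n. u n y))"
  have close: "\<bar>u n y - c y\<bar> \<le> (1 / 2) ^ n" if y: "y \<in> {0..1}" for n y
  proof -
    have "(\<lambda>k. \<bar>u (n + k) y - u n y\<bar>) \<longlonglongrightarrow> \<bar>c y - u n y\<bar>"
      unfolding c_def using LIMSEQ_ignore_initial_segment[OF conv[OF y], of n]
      by (intro tendsto_intros) (simp add: add.commute)
    then have "\<bar>c y - u n y\<bar> \<le> (1 / 2) ^ n"
      by (rule LIMSEQ_le_const2) (use diff y in blast)
    then show ?thesis by (simp add: abs_minus_commute)
  qed
  have "\<bar>c y\<bar> \<le> 1" if "y \<in> {0..1}" for y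
    using close[OF that, of 0] by (simp add: u_def)
  then have "bounded (c ` {0..1})"
    unfolding bounded_iff by (intro exI[of _ 1]) auto
  moreover have "c y = cantor_step lam c y" if y: "y \<in> {0..1}" for y
  proof -
    have "\<bar>u (Suc n) y - cantor_step lam c y\<bar> \<le> (1 / 2) ^ n / 2" for n
      unfolding u_Suc using close y lam by (intro cantor_step_diff) auto
    then have "\<forall>\<^sub>F n in sequentially. norm (u (Suc n) y - cantor_step lam c y) \<le> (1 / 2) ^ n / 2"
      by simp
    moreover have "(\<lambda>n. (1 / 2) ^ n / 2 :: real) \<longlonglongrightarrow> 0"
      using tendsto_divide[OF LIMSEQ_power_zero[of "1/2::real"] tendsto_const[of "2::real"]] by simp
    ultimately have "(\<lambda>n. u (Suc n) y - cantor_step lam c y) \<longlonglongrightarrow> 0"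
      by (rule Lim_null_comparison)
    then have "(\<lambda>n. u (Suc n) y) \<longlonglongrightarrow> cantor_step lam c y"
      by (simp add: LIM_zero_iff)
    moreover have "(\<lambda>n. u (Suc n) y) \<longlonglongrightarrow> c y"
      unfolding c_def using conv[OF y] by (rule LIMSEQ_Suc)
    ultimately show ?thesis using LIMSEQ_unique by blast
  qed
  ultimately show ?thesis
    unfolding is_cantor_fun_def by blast
qed

text \<open>The definite description in \<^const>\<open>cantor_fun\<close> is proper.\<close>

lemma cantor_fun_props:
  assumes lam: "0 < lam" "lam < 1"
  shows "cantor_fun lam \<in> extensional {0..1}" and "is_cantor_fun lam (cantor_fun lam)"
proof -
  obtain c where c: "is_cantor_fun lam c"
    using is_cantor_fun_exists[OF lam] by blast
  have 1: "2 / (1 - lam) * x \<in> {0..1}" if "x \<in> {0..1}" "x < (1 - lam) / 2" for x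
    using lam that by (auto simp: field_simps)
  have 2: "2 / (1 - lam) * x - (1 + lam) / (1 - lam) \<in> {0..1}"
    if "x \<in> {0..1}" "\<not> x < (1 + lam) / 2" for x
  proof -
    have "2 / (1 - lam) * x - (1 + lam) / (1 - lam) = (2 * x - (1 + lam)) / (1 - lam)"
      by (simp add: diff_divide_distrib)
    moreover have "\<dots> \<in> {0..1}"
      using lam that by (auto simp: field_simps)
    ultimately show ?thesis by simp
  qed
  have step: "cantor_step lam (restrict c {0..1}) x = cantor_step lam c x" if "x \<in> {0..1}" for x
    using 1[OF that] 2[OF that] by (simp add: cantor_step_def restrict_def)
  have "is_cantor_fun lam (restrict c {0..1})"
    unfolding is_cantor_fun_def
  proof (intro conjI ballI)
    show "bounded (restrict c {0..1} ` {0..1})"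
      using c by (simp only: is_cantor_fun_def image_restrict_eq)
    show "restrict c {0..1} x = cantor_step lam (restrict c {0..1}) x" if "x \<in> {0..1}" for x
      using c that unfolding is_cantor_fun_def step[OF that] by (metis restrict_apply')
  qed
  then have "\<exists>!c. c \<in> extensional {0..1} \<and> is_cantor_fun lam c"
    by (intro ex1I[of _ "restrict c {0..1}"] conjI restrict_extensional)
      (auto intro: extensionalityI[of _ "{0..1}"] is_cantor_fun_unique[OF lam] simp del: restrict_apply)
  from theI'[OF this]
  show "cantor_fun lam \<in> extensional {0..1}" and "is_cantor_fun lam (cantor_fun lam)"
    unfolding cantor_fun_def by auto
qed

section \<open>Brownian motion and the Ito integral\<close>

text \<open>
  The time parameter of a process is a \<^typ>\<open>real\<close>, and only times \<open>t \<ge> 0\<close> matter; a filtration on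
  \<open>[0, \<infinity>)\<close> is understood to be continued by \<open>F t = F 0\<close> for \<open>t < 0\<close>. The usual conditions are not
  assumed.
\<close>

locale filtered_prob_space = prob_space M + filtration "space M" F
  for M :: "'a measure" and F :: "real \<Rightarrow> 'a measure" +
  assumes subalg: "\<And>t. subalgebra M (F t)"

definition brownian_motion ::
    "'a measure \<Rightarrow> (real \<Rightarrow> 'a measure) \<Rightarrow> (real \<Rightarrow> 'a \<Rightarrow> real) \<Rightarrow> bool" where
  "brownian_motion M F B \<longleftrightarrow>
    (\<forall>t\<ge>0. B t \<in> borel_measurable (F t)) \<and>
    (AE \<omega> in M. B 0 \<omega> = 0) \<and>
    (AE \<omega> in M. continuous_on {0..} (\<lambda>t. B t \<omega>)) \<and>
    (\<forall>s t. 0 \<le> s \<and> s < t \<longrightarrow>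
      distributed M lborel (\<lambda>\<omega>. B t \<omega> - B s \<omega>) (normal_density 0 (sqrt (t - s))) \<and>
      prob_space.indep_set M (sets (F s))
        (sets (vimage_algebra (space M) (\<lambda>\<omega>. B t \<omega> - B s \<omega>) borel)))"

text \<open>
  A simple process is \<open>\<Sum>i<m. \<xi> i * 1_(\<tau> i, \<tau> (i+1)]\<close> with deterministic times and bounded
  \<open>F (\<tau> i)\<close>-measurable coefficients \<open>\<xi> i\<close>.
\<close>

definition simple_integrand ::
    "'a measure \<Rightarrow> (real \<Rightarrow> 'a measure) \<Rightarrow> nat \<Rightarrow> (nat \<Rightarrow> real) \<Rightarrow> (nat \<Rightarrow> 'a \<Rightarrow> real) \<Rightarrow> bool" where
  "simple_integrand M F m \<tau> \<xi> \<longleftrightarrow>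
    0 \<le> \<tau> 0 \<and> (\<forall>i<m. \<tau> i \<le> \<tau> (Suc i)) \<and>
    (\<forall>i<m. \<xi> i \<in> borel_measurable (F (\<tau> i)) \<and> bounded (\<xi> i ` space M))"

definition step_process ::
    "nat \<Rightarrow> (nat \<Rightarrow> real) \<Rightarrow> (nat \<Rightarrow> 'a \<Rightarrow> real) \<Rightarrow> real \<Rightarrow> 'a \<Rightarrow> real" where
  "step_process m \<tau> \<xi> s \<omega> = (\<Sum>i<m. \<xi> i \<omega> * indicator {\<tau> i<..\<tau> (Suc i)} s)"

definition step_integral ::
    "(real \<Rightarrow> 'a \<Rightarrow> real) \<Rightarrow> nat \<Rightarrow> (nat \<Rightarrow> real) \<Rightarrow> (nat \<Rightarrow> 'a \<Rightarrow> real) \<Rightarrow> real \<Rightarrow> 'a \<Rightarrow> real" where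
  "step_integral B m \<tau> \<xi> t \<omega> =
    (\<Sum>i<m. \<xi> i \<omega> * (B (min (\<tau> (Suc i)) t) \<omega> - B (min (\<tau> i) t) \<omega>))"

definition progressive_on ::
    "(real \<Rightarrow> 'a measure) \<Rightarrow> real \<Rightarrow> (real \<Rightarrow> 'a \<Rightarrow> real) \<Rightarrow> bool" where
  "progressive_on F t H \<longleftrightarrow>
    (\<forall>u\<in>{0..t}. (\<lambda>(s, \<omega>). H s \<omega>) \<in> borel_measurable (restrict_space borel {0..u} \<Otimes>\<^sub>M F u))"

text \<open>
  \<open>has_ito_integral M F B H t J\<close>: the random variable \<open>J\<close> is (a version of) the Ito integral of
  \<open>H\<close> with respect to \<open>B\<close> over \<open>[0, t]\<close>. Here \<open>H\<close> is progressively measurable with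
  \<open>\<integral>\<^sub>0\<^sup>t H\<^sup>2 ds < \<infinity>\<close> almost surely, and \<open>J\<close> is the limit in probability of the elementary integrals
  of simple processes \<open>H\<^sub>k\<close> for which \<open>\<integral>\<^sub>0\<^sup>t (H - H\<^sub>k)\<^sup>2 ds\<close> tends to \<open>0\<close> in probability. Such \<open>H\<^sub>k\<close>
  always exist, and \<open>J\<close> is almost surely independent of their choice.
\<close>

definition has_ito_integral ::
    "'a measure \<Rightarrow> (real \<Rightarrow> 'a measure) \<Rightarrow> (real \<Rightarrow> 'a \<Rightarrow> real) \<Rightarrow>
     (real \<Rightarrow> 'a \<Rightarrow> real) \<Rightarrow> real \<Rightarrow> ('a \<Rightarrow> real) \<Rightarrow> bool" where
  "has_ito_integral M F B H t J \<longleftrightarrow>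
    progressive_on F t H \<and>
    (AE \<omega> in M. (\<integral>\<^sup>+s\<in>{0..t}. ennreal ((H s \<omega>)\<^sup>2) \<partial>lborel) < \<infinity>) \<and>
    J \<in> borel_measurable M \<and>
    (\<exists>m \<tau> \<xi>.
      (\<forall>k. simple_integrand M F (m k) (\<tau> k) (\<xi> k)) \<and>
      (\<forall>\<epsilon>>0. (\<lambda>k. measure M {\<omega> \<in> space M.
         ennreal \<epsilon> < (\<integral>\<^sup>+s\<in>{0..t}. ennreal ((H s \<omega> - step_process (m k) (\<tau> k) (\<xi> k) s \<omega>)\<^sup>2) \<partial>lborel)})
         \<longlonglongrightarrow> 0) \<and>
      (\<forall>\<epsilon>>0. (\<lambda>k. measure M {\<omega> \<in> space M.
         \<epsilon> < \<bar>step_integral B (m k) (\<tau> k) (\<xi> k) t \<omega> - J \<omega>\<bar>}) \<longlonglongrightarrow> 0))"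

text \<open>
  Solutions on \<open>[0, T]\<close> of \<open>X t = x0 + \<integral>\<^sub>0\<^sup>t \<sigma> (X s) dB s\<close>. As \<open>X\<close> has continuous paths, the equation
  for each \<open>t\<close> almost surely is the same as the equation almost surely for all \<open>t\<close>, the right-hand
  side being the continuous version of the integral.
\<close>

definition sde_solution ::
    "'a measure \<Rightarrow> (real \<Rightarrow> 'a measure) \<Rightarrow> (real \<Rightarrow> 'a \<Rightarrow> real) \<Rightarrow> real \<Rightarrow>
     (real \<Rightarrow> real) \<Rightarrow> real \<Rightarrow> (real \<Rightarrow> 'a \<Rightarrow> real) \<Rightarrow> bool" where
  "sde_solution M F B T \<sigma> x0 X \<longleftrightarrow>
    (\<forall>t\<in>{0..T}. X t \<in> borel_measurable (F t)) \<and>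
    (AE \<omega> in M. continuous_on {0..T} (\<lambda>t. X t \<omega>)) \<and>
    (\<forall>t\<in>{0..T}. has_ito_integral M F B (\<lambda>s \<omega>. \<sigma> (X s \<omega>)) t (\<lambda>\<omega>. X t \<omega> - x0))"

end

theory Submission
  imports Defs
begin

text \<open>
  Let \<open>Y = X - X\<^sub>n\<close> and \<open>h = c(X) - c\<^sub>n(X\<^sub>n)\<close>, so that \<open>Y\<close> is the Ito integral of the bounded process
  \<open>h\<close>. Since \<open>c\<close> is Hoelder continuous of order \<open>H\<close> and \<open>\<bar>c - c\<^sub>n\<bar> \<le> \<epsilon>\<close> with \<open>\<epsilon> = K 2\<^bsup>-n\<^esup>\<close>, we have
  \<open>h\<^sup>2 \<le> 2 \<epsilon>\<^sup>2 + 2 k \<bar>Y\<bar>\<^bsup>2H\<^esup>\<close>. If \<open>\<phi>\<close> is a smooth approximation of the absolute value and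
  \<open>\<phi>''(Y) h\<^sup>2 \<le> A\<close>, then Ito's formula gives \<open>E \<phi>(Y\<^sub>t) \<le> \<phi>(0) + A t / 2\<close>. For \<open>H > 1/2\<close> the choice
  \<open>\<phi>(x) = sqrt (\<delta>\<^sup>2 + x\<^sup>2)\<close> with \<open>\<delta> = 2\<^bsup>-n/H\<^esup>\<close> bounds \<open>E \<bar>Y\<^sub>t\<bar>\<close> by a multiple of \<open>2\<^bsup>-n(2 - 1/H)\<^esup>\<close>; for
  \<open>H = 1/2\<close> a function of Yamada--Watanabe type with \<open>\<delta> = 4\<^bsup>-n\<^esup>\<close> bounds it by a multiple of \<open>1/n\<close>.
  By Doob's inequality and the isometry, \<open>E sup Y\<^sup>2 \<le> 4 E \<integral> h\<^sup>2\<close> is of the same order, and the rates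
  are the square roots of these bounds.

  All that is needed from stochastic calculus is that an increment of \<open>Y\<close> is orthogonal to the past,
  that its conditional second moment is that of \<open>\<integral> h\<^sup>2\<close>, and that its fourth moment is
  \<open>O((t - s)\<^sup>2)\<close>. These facts hold for simple processes by independence of the Brownian increments and
  survive the passage to the limit in probability; the fourth moments provide the uniform
  integrability.
\<close>

section \<open>Regularity of the Cantor function\<close>

text \<open>The integral is given only as a limit in probability, with a separate approximating
  sequence for each \<open>t\<close>, so increments have to be rebuilt before any martingale
  argument can start. Conditional expectations are avoided throughout: a weight \<open>Z\<close>
  that is known at the left end of the interval takes their place. The constant has to be uniform in
  \<open>n\<close>, although the bound \<open>1 + e\<close> on the integrand and the Lipschitz
  constants of the second derivatives of the test functions vary with \<open>n\<close>, the latter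
  blowing up as \<open>d\<close> shrinks. Both enter solely through Taylor remainders, which vanish
  with the mesh while \<open>n\<close> is fixed. The scale is a balance: the generator bound is
  \<open>e^2 / d + k * d^(2H-1)\<close>, and its terms are of the same order when
  \<open>d^(2H)\<close> is of order \<open>e^2\<close>. At \<open>H = 1/2\<close> the second term no
  longer decays; there the gain comes from dividing the test function by \<open>ln (1 / d)\<close>,
  which is of order \<open>n\<close>.\<close>

lemma cantor_iter_close:
  assumes lam: "0 < lam" "lam < 1" and bdd: "bounded (c0 ` {0..1})"
  obtains K where "K \<ge> 1" and
    "\<And>n x. x \<in> {0..1} \<Longrightarrow> \<bar>cantor_fun lam x - cantor_iter lam c0 n x\<bar> \<le> K * (1 / 2) ^ n"
proof -
  have c: "is_cantor_fun lam (cantor_fun lam)"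
    using cantor_fun_props[OF lam] by blast
  then obtain a b where a: "\<And>y. y \<in> {0..1} \<Longrightarrow> \<bar>cantor_fun lam y\<bar> \<le> a"
    and b: "\<And>y. y \<in> {0..1} \<Longrightarrow> \<bar>c0 y\<bar> \<le> b"
    using bdd unfolding is_cantor_fun_def bounded_iff by (metis imageI real_norm_def)
  define K where "K = max 1 (a + b)"
  have *: "\<forall>x\<in>{0..1}. \<bar>cantor_fun lam x - cantor_iter lam c0 n x\<bar> \<le> K * (1 / 2) ^ n" for n
  proof (induction n)
    case 0
    show ?case
    proof
      fix x :: real assume "x \<in> {0..1}"
      from a[OF this] b[OF this]
      show "\<bar>cantor_fun lam x - cantor_iter lam c0 0 x\<bar> \<le> K * (1 / 2) ^ 0"
        by (simp add: K_def)
    qed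
  next
    case (Suc n)
    show ?case
    proof
      fix x :: real assume x: "x \<in> {0..1}"
      have "\<bar>cantor_step lam (cantor_fun lam) x - cantor_step lam (cantor_iter lam c0 n) x\<bar>
          \<le> K * (1 / 2) ^ n / 2"
        using Suc x lam by (intro cantor_step_diff) auto
      then show "\<bar>cantor_fun lam x - cantor_iter lam c0 (Suc n) x\<bar> \<le> K * (1 / 2) ^ Suc n"
        using c x by (simp add: is_cantor_fun_def)
    qed
  qed
  show thesis
    by (rule that[of K]) (use * in \<open>auto simp: K_def\<close>)
qed

text \<open>\<open>lam <= 1 / 2\<close> amounts to \<open>ln (1 - lam) >= - ln 2\<close>, which
  makes the denominator at most \<open>2 * ln 2\<close>; equality gives the critical exponent
  \<open>1 / 2\<close>.\<close>

lemma hoelder_exponent_bounds: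
  assumes "0 < lam" "lam \<le> 1 / 2"
  shows "1 / 2 \<le> hoelder_exponent lam" and "hoelder_exponent lam < 1"
proof -
  have l: "ln (1 - lam) < 0"
    using assms by simp
  have "ln (1 - lam) \<ge> ln (1 / 2)"
    using assms by (subst ln_le_cancel_iff) auto
  then have "- ln 2 \<le> ln (1 - lam)"
    by (simp add: ln_div)
  then show "1 / 2 \<le> hoelder_exponent lam" and "hoelder_exponent lam < 1"
    using l by (auto simp: hoelder_exponent_def field_simps)
qed

text \<open>The exponent is chosen for this scaling: shrinking a distance by the contraction ratio
  \<open>(1 - lam) / 2\<close> divides its power by \<open>2\<close>, just as
  \<open>cantor_step\<close> halves increments.\<close>

lemma half_powr_hoelder_exponent:
  assumes "0 < lam" "lam < 1"
  shows "((1 - lam) / 2) powr hoelder_exponent lam = 1 / 2"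
proof -
  have "ln (1 - lam) < ln 2"
    using assms by (subst ln_less_cancel_iff) auto
  then have "hoelder_exponent lam * ln ((1 - lam) / 2) = - ln 2"
    using assms by (simp add: hoelder_exponent_def ln_div field_simps)
  then show ?thesis
    using assms by (simp add: powr_def exp_minus)
qed

text \<open>Points on both sides of the gap are at distance at least \<open>lam\<close>, so there the bound \<open>1\<close> on
  the increment suffices; this is what makes the constant below survive \<^const>\<open>cantor_step\<close>.\<close>

lemma cantor_step_hoelder:
  fixes lam :: real
  defines "H \<equiv> hoelder_exponent lam"
  defines "K \<equiv> lam powr - H"
  assumes lam: "0 < lam" "lam \<le> 1 / 2"
    and g01: "\<And>x. x \<in> {0..1} \<Longrightarrow> 0 \<le> g x \<and> g x \<le> 1" "g 0 = 0" "g 1 = 1"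
    and g: "\<And>x y. x \<in> {0..1} \<Longrightarrow> y \<in> {0..1} \<Longrightarrow> \<bar>g x - g y\<bar> \<le> K * \<bar>x - y\<bar> powr H"
    and xy: "0 \<le> x" "x \<le> y" "y \<le> 1"
  shows "\<bar>cantor_step lam g x - cantor_step lam g y\<bar> \<le> K * \<bar>x - y\<bar> powr H"
proof -
  have H: "1 / 2 \<le> H" "H < 1"
    using hoelder_exponent_bounds[OF lam] by (auto simp: H_def)
  have K: "K \<ge> 0" by (simp add: K_def)
  define r where "r = (1 - lam) / 2"
  have r: "r > 0" "lam = 1 - 2 * r" using lam by (simp_all add: r_def diff_divide_distrib)
  have rH: "r powr H = 1 / 2"
    using half_powr_hoelder_exponent[of lam] lam by (simp add: r_def H_def)
  \<comment> \<open>For two points in the same scaled copy the halving of the increment is matched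
    by \<open>r powr H = 1 / 2\<close>, so \<open>K\<close> is reproduced. Allowing any
    \<open>d\<close> above the distance lets a point of the gap be replaced by an endpoint of the
    gap.\<close>
  have scale: "\<bar>g u / 2 - g v / 2\<bar> \<le> K * d powr H"
    if "u \<in> {0..1}" "v \<in> {0..1}" "\<bar>r * u - r * v\<bar> \<le> d" for u v d
  proof -
    have "\<bar>g u / 2 - g v / 2\<bar> \<le> K * (r powr H * \<bar>u - v\<bar> powr H)"
      using g[OF that(1,2)] by (simp add: rH flip: diff_divide_distrib)
    also have "r powr H * \<bar>u - v\<bar> powr H = (r * \<bar>u - v\<bar>) powr H"
      using r by (simp add: powr_mult)
    also have "r * \<bar>u - v\<bar> = \<bar>r * u - r * v\<bar>"
      using r by (simp add: abs_mult flip: right_diff_distrib)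
    also have "K * \<bar>r * u - r * v\<bar> powr H \<le> K * d powr H"
      using that r H K by (intro mult_left_mono powr_mono2) auto
    finally show ?thesis .
  qed
  have L: "z / r \<in> {0..1}" "r * (z / r) = z" if "0 \<le> z" "z \<le> r" for z
    using that r by auto
  have R: "(z - (1 - r)) / r \<in> {0..1}" "r * ((z - (1 - r)) / r) = z - (1 - r)"
    if "1 - r \<le> z" "z \<le> 1" for z
    using that r by auto
  have step: "cantor_step lam g z = (if z < r then g (z / r) / 2 else if z < 1 - r then 1 / 2
      else 1 / 2 + g ((z - (1 - r)) / r) / 2)" for z
  proof -
    have "(1 + lam) / 2 = 1 - r" "(1 - lam) / 2 = r" "2 / (1 - lam) * z = z / r"
      "2 / (1 - lam) * z - (1 + lam) / (1 - lam) = (z - (1 - r)) / r"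
      using r(1) by (simp_all add: r(2) diff_divide_distrib right_diff_distrib)
    then show ?thesis unfolding cantor_step_def by simp
  qed
  have r2: "r < 1 - r" using r lam by simp
  \<comment> \<open>When exactly one point lies in the gap, it is moved to the endpoint facing the
    other point: the value \<open>1 / 2\<close> is \<open>g 1 / 2\<close> seen from the left copy
    and \<open>1 / 2 + g 0 / 2\<close> seen from the right copy.\<close>
  consider "y < r" | "x < r" "r \<le> y" "y < 1 - r" | "x < r" "1 - r \<le> y" | "r \<le> x" "y < 1 - r"
    | "r \<le> x" "x < 1 - r" "1 - r \<le> y" | "1 - r \<le> x"
    by linarith
  then show ?thesis
  proof cases
    case 1
    have "\<bar>g (x / r) / 2 - g (y / r) / 2\<bar> \<le> K * \<bar>x - y\<bar> powr H"
      using 1 xy r by (intro scale) (simp_all add: L R)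
    then show ?thesis using 1 xy by (simp add: step)
  next
    case 2
    have "\<bar>g (x / r) / 2 - g 1 / 2\<bar> \<le> K * \<bar>x - y\<bar> powr H"
      using 2 xy r by (intro scale) (simp_all add: L R)
    then show ?thesis using 2 xy g01 r2 by (simp add: step)
  next
    case 3
    have d: "lam \<le> \<bar>x - y\<bar>" using 3 r by linarith
    have "1 = K * lam powr H"
      using lam by (simp add: K_def flip: powr_add)
    also have "\<dots> \<le> K * \<bar>x - y\<bar> powr H"
      using d lam H K by (intro mult_left_mono powr_mono2) auto
    finally have "1 \<le> K * \<bar>x - y\<bar> powr H" .
    moreover have "x / r \<in> {0..1}" "(y - (1 - r)) / r \<in> {0..1}"
      using L[of x] R[of y] 3 xy by auto
    then have "0 \<le> g (x / r)" "g (x / r) \<le> 1" "0 \<le> g ((y - (1 - r)) / r)" "g ((y - (1 - r)) / r) \<le> 1"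
      using g01(1) by blast+
    ultimately show ?thesis
      using 3 xy r2 by (simp add: step)
  next
    case 4
    then show ?thesis using xy K by (simp add: step)
  next
    case 5
    have "\<bar>g 0 / 2 - g ((y - (1 - r)) / r) / 2\<bar> \<le> K * \<bar>x - y\<bar> powr H"
      using 5 xy r by (intro scale) (simp_all add: L R)
    then show ?thesis using 5 xy g01 r2 by (simp add: step)
  next
    case 6
    have "\<bar>g ((x - (1 - r)) / r) / 2 - g ((y - (1 - r)) / r) / 2\<bar> \<le> K * \<bar>x - y\<bar> powr H"
      using 6 xy r by (intro scale) (simp_all add: L R)
    then show ?thesis using 6 xy r2 by (simp add: step)
  qed
qed

text \<open>The iteration starts from the identity because it satisfies the whole invariant: values
  in \<open>{0..1}\<close>, fixed endpoints, and the Hoelder bound, as \<open>K >= 1\<close> and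
  distances are at most \<open>1\<close>. \<open>cantor_step\<close> keeps all of this with the same
  \<open>K\<close>.\<close>

lemma cantor_iter_id_hoelder:
  fixes lam :: real and n :: nat
  defines "H \<equiv> hoelder_exponent lam"
  defines "K \<equiv> lam powr - H"
  defines "g \<equiv> cantor_iter lam (\<lambda>x. x) n"
  assumes lam: "0 < lam" "lam \<le> 1 / 2"
  shows "(\<forall>x\<in>{0..1}. 0 \<le> g x \<and> g x \<le> 1) \<and> g 0 = 0 \<and> g 1 = 1 \<and>
    (\<forall>x\<in>{0..1}. \<forall>y\<in>{0..1}. \<bar>g x - g y\<bar> \<le> K * \<bar>x - y\<bar> powr H)"
  unfolding g_def
proof (induction n)
  case 0
  have H: "1 / 2 \<le> H" "H < 1"
    using hoelder_exponent_bounds[OF lam] by (auto simp: H_def)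
  have K: "1 \<le> K"
    using lam H powr_mono2[of H lam 1] by (simp add: K_def powr_minus one_le_inverse_iff)
  have "d \<le> K * d powr H" if "0 \<le> d" "d \<le> 1" for d
  proof -
    have "d powr 1 \<le> d powr H"
      using that H by (intro powr_mono') auto
    also have "\<dots> \<le> K * d powr H"
      using mult_right_mono[OF K, of "d powr H"] by simp
    finally show ?thesis using that by simp
  qed
  then show ?case by auto
next
  case (Suc n)
  let ?g = "cantor_iter lam (\<lambda>x. x) n"
  have IH: "\<And>x. x \<in> {0..1} \<Longrightarrow> 0 \<le> ?g x \<and> ?g x \<le> 1" "?g 0 = 0" "?g 1 = 1"
    "\<And>x y. x \<in> {0..1} \<Longrightarrow> y \<in> {0..1} \<Longrightarrow> \<bar>?g x - ?g y\<bar> \<le> K * \<bar>x - y\<bar> powr H"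
    using Suc by auto
  have "0 \<le> cantor_step lam ?g x \<and> cantor_step lam ?g x \<le> 1" if x: "x \<in> {0..1}" for x
  proof -
    have 1: "2 / (1 - lam) * x \<in> {0..1}" if "x < (1 - lam) / 2"
      using lam that x by (auto simp: field_simps)
    have 2: "2 / (1 - lam) * x - (1 + lam) / (1 - lam) \<in> {0..1}" if "\<not> x < (1 + lam) / 2"
    proof -
      have "2 / (1 - lam) * x - (1 + lam) / (1 - lam) = (2 * x - (1 + lam)) / (1 - lam)"
        by (simp add: diff_divide_distrib)
      moreover have "\<dots> \<in> {0..1}"
        using lam that x by (auto simp: field_simps)
      ultimately show ?thesis by simp
    qed
    show ?thesis
      using IH(1)[OF 1] IH(1)[OF 2] by (simp add: cantor_step_def) linarith
  qed
  moreover have "cantor_step lam ?g 0 = 0"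
    using lam IH by (simp add: cantor_step_def)
  moreover have "cantor_step lam ?g 1 = 1"
  proof -
    have "2 / (1 - lam) - (1 + lam) / (1 - lam) = 1"
      using lam by (simp flip: diff_divide_distrib)
    then show ?thesis using lam IH by (simp add: cantor_step_def)
  qed
  moreover have "\<bar>cantor_step lam ?g x - cantor_step lam ?g y\<bar> \<le> K * \<bar>x - y\<bar> powr H"
    if "x \<in> {0..1}" "y \<in> {0..1}" for x y
  proof (cases "x \<le> y")
    case True
    show ?thesis
      by (rule cantor_step_hoelder[OF lam, folded H_def, folded K_def, OF IH])
        (use that True in auto)
  next
    case False
    have "\<bar>cantor_step lam ?g y - cantor_step lam ?g x\<bar> \<le> K * \<bar>y - x\<bar> powr H"
      by (rule cantor_step_hoelder[OF lam, folded H_def, folded K_def, OF IH])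
        (use that False in auto)
    then show ?thesis by (simp add: abs_minus_commute)
  qed
  ultimately show ?case by simp
qed

text \<open>All four properties are closed under pointwise limits, and the iterates of the identity
  converge to \<open>cantor_fun\<close> like \<open>(1 / 2) ^ n\<close>.\<close>

lemma cantor_fun_hoelder:
  fixes lam :: real
  defines "H \<equiv> hoelder_exponent lam"
  defines "K \<equiv> lam powr - H"
  defines "c \<equiv> cantor_fun lam"
  assumes lam: "0 < lam" "lam \<le> 1 / 2"
  shows "\<And>x. x \<in> {0..1} \<Longrightarrow> 0 \<le> c x \<and> c x \<le> 1" and "c 0 = 0" and "c 1 = 1"
    and "\<And>x y. x \<in> {0..1} \<Longrightarrow> y \<in> {0..1} \<Longrightarrow> \<bar>c x - c y\<bar> \<le> K * \<bar>x - y\<bar> powr H"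
proof -
  let ?g = "cantor_iter lam (\<lambda>x. x)"
  have *: "(\<forall>x\<in>{0..1}. 0 \<le> ?g n x \<and> ?g n x \<le> 1) \<and> ?g n 0 = 0 \<and> ?g n 1 = 1 \<and>
    (\<forall>x\<in>{0..1}. \<forall>y\<in>{0..1}. \<bar>?g n x - ?g n y\<bar> \<le> K * \<bar>x - y\<bar> powr H)" for n
    unfolding K_def H_def using cantor_iter_id_hoelder[OF lam] by blast
  have lam1: "lam < 1" using lam by simp
  have "bounded ((\<lambda>x::real. x) ` {0..1})" by simp
  then obtain D where D: "\<And>n x. x \<in> {0..1} \<Longrightarrow> \<bar>c x - ?g n x\<bar> \<le> D * (1 / 2) ^ n"
    unfolding c_def using cantor_iter_close[OF lam(1) lam1] by metis
  have lim: "(\<lambda>n. ?g n x) \<longlonglongrightarrow> c x" if "x \<in> {0..1}" for x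
  proof -
    have D0: "(\<lambda>n. D * (1 / 2) ^ n) \<longlonglongrightarrow> 0"
      by (intro tendsto_mult_right_zero LIMSEQ_power_zero) simp
    have "\<forall>\<^sub>F n in sequentially. norm (?g n x - c x) \<le> D * (1 / 2) ^ n"
    proof (intro always_eventually allI)
      show "norm (?g n x - c x) \<le> D * (1 / 2) ^ n" for n
        using D[OF that, of n] by (metis abs_minus_commute real_norm_def)
    qed
    from Lim_null_comparison[OF this D0] have "(\<lambda>n. ?g n x - c x) \<longlonglongrightarrow> 0" .
    then show ?thesis by (simp add: LIM_zero_iff)
  qed
  show "0 \<le> c x \<and> c x \<le> 1" if "x \<in> {0..1}" for x
    using LIMSEQ_le_const[OF lim[OF that], of 0] LIMSEQ_le_const2[OF lim[OF that], of 1] * that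
    by blast
  show "c 0 = 0"
    using lim[of 0] by (simp add: * LIMSEQ_const_iff)
  show "c 1 = 1"
    using lim[of 1] by (simp add: * LIMSEQ_const_iff)
  show "\<bar>c x - c y\<bar> \<le> K * \<bar>x - y\<bar> powr H" if "x \<in> {0..1}" "y \<in> {0..1}" for x y
    using LIMSEQ_le_const2[OF tendsto_rabs[OF tendsto_diff[OF lim[OF that(1)] lim[OF that(2)]]]] * that
    by blast
qed

text \<open>With endpoint values \<open>0\<close> and \<open>1\<close>, extension is composition
  with the projection onto \<open>{0..1}\<close>; as the projection is 1-Lipschitz, bounds on the
  unit interval carry over to the line.\<close>

lemma ext01_eq_clamp:
  assumes "g 0 = 0" "g 1 = 1"
  shows "ext01 g x = g (max 0 (min 1 x))"
  using assms by (auto simp: ext01_def max_def min_def)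

lemma ext01_cantor_fun_hoelder:
  fixes lam :: real
  assumes lam: "0 < lam" "lam \<le> 1 / 2"
  defines "K \<equiv> lam powr - hoelder_exponent lam"
  shows "0 \<le> ext01 (cantor_fun lam) x" "ext01 (cantor_fun lam) x \<le> 1"
    and "\<bar>ext01 (cantor_fun lam) x - ext01 (cantor_fun lam) y\<bar> \<le> K * \<bar>x - y\<bar> powr hoelder_exponent lam"
proof -
  note c = cantor_fun_hoelder[OF lam]
  have K: "K \<ge> 0" by (simp add: K_def)
  have H: "1 / 2 \<le> hoelder_exponent lam"
    using hoelder_exponent_bounds[OF lam] by auto
  let ?p = "\<lambda>x::real. max 0 (min 1 x)"
  have e: "ext01 (cantor_fun lam) x = cantor_fun lam (?p x)" for x
    using c by (intro ext01_eq_clamp) auto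
  show "0 \<le> ext01 (cantor_fun lam) x" "ext01 (cantor_fun lam) x \<le> 1"
    using c(1)[of "?p x"] by (auto simp: e)
  have "\<bar>ext01 (cantor_fun lam) x - ext01 (cantor_fun lam) y\<bar> \<le> K * \<bar>?p x - ?p y\<bar> powr hoelder_exponent lam"
    unfolding e K_def by (intro c) auto
  also have "\<dots> \<le> K * \<bar>x - y\<bar> powr hoelder_exponent lam"
    using H K by (intro mult_left_mono powr_mono2) auto
  finally show "\<bar>ext01 (cantor_fun lam) x - ext01 (cantor_fun lam) y\<bar> \<le> K * \<bar>x - y\<bar> powr hoelder_exponent lam" .
qed

lemma ext01_cantor_iter_close:
  assumes lam: "0 < lam" "lam < 1" and bdd: "bounded (c0 ` {0..1})"
  obtains K where "K \<ge> 1" and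
    "\<And>n x. \<bar>ext01 (cantor_fun lam) x - ext01 (cantor_iter lam c0 n) x\<bar> \<le> K * (1 / 2) ^ n"
proof -
  obtain K where "K \<ge> 1" and
    *: "\<And>n x. x \<in> {0..1} \<Longrightarrow> \<bar>cantor_fun lam x - cantor_iter lam c0 n x\<bar> \<le> K * (1 / 2) ^ n"
    using cantor_iter_close[OF assms] by metis
  moreover have "0 \<le> K * (1 / 2) ^ n" for n :: nat
    using \<open>K \<ge> 1\<close> by simp
  ultimately show thesis
    by (intro that[of K]) (auto simp: ext01_def)
qed

section \<open>Integrals of simple processes\<close>

locale brownian_setting = filtered_prob_space M F
  for M :: "'a measure" and F :: "real \<Rightarrow> 'a measure" +
  fixes B :: "real \<Rightarrow> 'a \<Rightarrow> real"
  assumes bm: "brownian_motion M F B"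
begin

lemma measurable_F_M: "f \<in> borel_measurable (F t) \<Longrightarrow> f \<in> borel_measurable M"
  by (rule measurable_from_subalg[OF subalg])

lemma measurable_F_mono: "s \<le> t \<Longrightarrow> f \<in> borel_measurable (F s) \<Longrightarrow> f \<in> borel_measurable (F t)"
  by (rule measurable_from_subalg[of "F t" "F s"]) (use sets_F_mono[of s t] space_F in \<open>simp_all add: subalgebra_def\<close>)

lemma B_measurable [measurable]: "0 \<le> t \<Longrightarrow> B t \<in> borel_measurable (F t)"
  using bm by (simp add: brownian_motion_def)

lemma B_measurable_M: "0 \<le> t \<Longrightarrow> B t \<in> borel_measurable M"
  by (rule measurable_F_M[OF B_measurable])

text \<open>\<open>brownian_motion\<close> states independence of sigma-algebras; an
  \<open>F s\<close>-measurable \<open>U\<close> generates a sub-sigma-algebra of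
  \<open>F s\<close>, so independence is inherited by random variables.\<close>

lemma indep_increment:
  assumes st: "0 \<le> s" "s < t" and U: "U \<in> borel_measurable (F s)"
  shows "indep_var borel U borel (\<lambda>\<omega>. B t \<omega> - B s \<omega>)"
proof -
  have ind: "indep_set (sets (F s))
      (sets (vimage_algebra (space M) (\<lambda>\<omega>. B t \<omega> - B s \<omega>) borel))"
    using bm st by (simp add: brownian_motion_def)
  have "{U -` A \<inter> space M |A. A \<in> sets borel} \<subseteq> sets (F s)"
    using measurable_sets[OF U] by (auto simp: space_F)
  then have "sigma_sets (space M) {U -` A \<inter> space M |A. A \<in> sets borel} \<subseteq> sets (F s)"
    using sets.sigma_sets_subset[of _ "F s"] by (simp add: space_F)
  then have "indep_set (sigma_sets (space M) {U -` A \<inter> space M |A. A \<in> sets borel})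
     (sigma_sets (space M) {(\<lambda>\<omega>. B t \<omega> - B s \<omega>) -` A \<inter> space M |A. A \<in> sets borel})"
    using ind unfolding sets_vimage_algebra indep_set_def
    by (rule_tac indep_sets_mono_sets) (auto split: bool.split)
  moreover have "(\<lambda>\<omega>. B t \<omega> - B s \<omega>) \<in> borel_measurable M"
    using st by (intro borel_measurable_diff B_measurable_M) auto
  ultimately show ?thesis
    using measurable_F_M[OF U] by (simp add: indep_var_eq)
qed

lemma increment_moment:
  assumes st: "0 \<le> s" "s < t"
  shows "integrable M (\<lambda>\<omega>. (B t \<omega> - B s \<omega>) ^ k)"
    and "expectation (\<lambda>\<omega>. (B t \<omega> - B s \<omega>) ^ k) =
      integral\<^sup>L lborel (\<lambda>x. normal_density 0 (sqrt (t - s)) x * (x - 0) ^ k)"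
proof -
  have d: "distributed M lborel (\<lambda>\<omega>. B t \<omega> - B s \<omega>) (normal_density 0 (sqrt (t - s)))"
    using bm st by (simp add: brownian_motion_def)
  have s: "0 < sqrt (t - s)" using st by simp
  show "integrable M (\<lambda>\<omega>. (B t \<omega> - B s \<omega>) ^ k)"
    using distributed_integrable[OF d, of "\<lambda>x. x ^ k"] integrable_normal_moment[OF s, of 0 k] by simp
  show "expectation (\<lambda>\<omega>. (B t \<omega> - B s \<omega>) ^ k) =
      integral\<^sup>L lborel (\<lambda>x. normal_density 0 (sqrt (t - s)) x * (x - 0) ^ k)"
    using distributed_integral[OF d, of "\<lambda>x. x ^ k"] by simp
qed

text \<open>Independence turns each expectation into \<open>expectation U\<close> times a centred
  Gaussian moment. The case \<open>s = t\<close> is treated apart, since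
  \<open>brownian_motion\<close> gives a density for \<open>s < t\<close> only.\<close>

lemma increment_indep_moment:
  assumes st: "0 \<le> s" "s \<le> t" and U: "U \<in> borel_measurable (F s)" "integrable M U"
  defines "D \<equiv> \<lambda>\<omega>. B t \<omega> - B s \<omega>"
  shows "k \<noteq> 0 \<Longrightarrow> integrable M (\<lambda>\<omega>. U \<omega> * D \<omega> ^ k)"
    and "expectation (\<lambda>\<omega>. U \<omega> * D \<omega>) = 0"
    and "expectation (\<lambda>\<omega>. U \<omega> * D \<omega> ^ 2) = expectation U * (t - s)"
    and "expectation (\<lambda>\<omega>. U \<omega> * D \<omega> ^ 3) = 0"
    and "expectation (\<lambda>\<omega>. U \<omega> * D \<omega> ^ 4) = expectation U * (3 * (t - s)\<^sup>2)"
proof -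
  have *: "integrable M (\<lambda>\<omega>. U \<omega> * D \<omega> ^ k)"
    "expectation (\<lambda>\<omega>. U \<omega> * D \<omega> ^ k) = expectation U *
      integral\<^sup>L lborel (\<lambda>x. normal_density 0 (sqrt (t - s)) x * (x - 0) ^ k)" if "s < t" for k
  proof -
    have i: "indep_var borel U borel (\<lambda>\<omega>. D \<omega> ^ k)"
      using indep_var_compose[OF indep_increment[OF st(1) that U(1)], of "\<lambda>x. x" borel "\<lambda>x. x ^ k" borel]
      by (simp add: comp_def D_def)
    have m: "integrable M (\<lambda>\<omega>. D \<omega> ^ k)"
      unfolding D_def by (rule increment_moment[OF st(1) that])
    show "integrable M (\<lambda>\<omega>. U \<omega> * D \<omega> ^ k)"
      by (rule indep_var_integrable[OF i U(2) m])
    show "expectation (\<lambda>\<omega>. U \<omega> * D \<omega> ^ k) = expectation U *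
      integral\<^sup>L lborel (\<lambda>x. normal_density 0 (sqrt (t - s)) x * (x - 0) ^ k)"
      using indep_var_lebesgue_integral[OF i U(2) m] increment_moment(2)[OF st(1) that, of k]
      by (simp add: D_def)
  qed
  have z: "D \<omega> = 0" if "s = t" for \<omega> using that by (simp add: D_def)
  show "integrable M (\<lambda>\<omega>. U \<omega> * D \<omega> ^ k)" if "k \<noteq> 0"
    using *(1)[of k] z st that by (cases "s = t") auto
  show "expectation (\<lambda>\<omega>. U \<omega> * D \<omega>) = 0"
    using *(2)[of 1] z st integral_normal_moment_odd[of "sqrt (t - s)" 0 0] by (cases "s = t") auto
  show "expectation (\<lambda>\<omega>. U \<omega> * D \<omega> ^ 3) = 0"
    using *(2)[of 3] z st integral_normal_moment_odd[of "sqrt (t - s)" 0 1]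
    by (cases "s = t") (auto simp: eval_nat_numeral)
  show "expectation (\<lambda>\<omega>. U \<omega> * D \<omega> ^ 2) = expectation U * (t - s)"
    using *(2)[of 2] z st integral_normal_moment_even[of "sqrt (t - s)" 0 1]
    by (cases "s = t") (auto)
  show "expectation (\<lambda>\<omega>. U \<omega> * D \<omega> ^ 4) = expectation U * (3 * (t - s)\<^sup>2)"
    using *(2)[of 4] z st integral_normal_moment_even[of "sqrt (t - s)" 0 2]
    by (cases "s = t") (auto simp: fact_numeral field_simps)
qed

end

lemma integrable_bounded_mult:
  fixes f g :: "'a \<Rightarrow> real"
  assumes "integrable N f" "g \<in> borel_measurable N" "\<And>x. x \<in> space N \<Longrightarrow> \<bar>g x\<bar> \<le> c"
  shows "integrable N (\<lambda>x. g x * f x)"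
proof (rule Bochner_Integration.integrable_bound[of N "\<lambda>x. c * f x"])
  show "integrable N (\<lambda>x. c * f x)" using assms by simp
  show "(\<lambda>x. g x * f x) \<in> borel_measurable N"
    using assms by (intro borel_measurable_times) auto
  show "AE x in N. norm (g x * f x) \<le> norm (c * f x)"
  proof (rule AE_I2)
    fix x assume "x \<in> space N"
    then have "\<bar>g x\<bar> \<le> \<bar>c\<bar>" using assms(3)[of x] by simp
    then show "norm (g x * f x) \<le> norm (c * f x)"
      by (simp add: abs_mult mult_right_mono)
  qed
qed

lemma (in finite_measure) integrable_power_le_4:
  fixes f :: "'a \<Rightarrow> real"
  assumes f: "f \<in> borel_measurable M" "integrable M (\<lambda>x. f x ^ 4)" and k: "k \<le> 4"
  shows "integrable M (\<lambda>x. f x ^ k)"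
proof (rule Bochner_Integration.integrable_bound[of M "\<lambda>x. 1 + f x ^ 4"])
  show "integrable M (\<lambda>x. 1 + f x ^ 4)" using f by simp
  show "(\<lambda>x. f x ^ k) \<in> borel_measurable M" using f by simp
  have "\<bar>y\<bar> ^ k \<le> 1 + y ^ 4" for y :: real
  proof (cases "\<bar>y\<bar> \<le> 1")
    case True
    then have "\<bar>y\<bar> ^ k \<le> 1" by (simp add: power_le_one)
    then show ?thesis by (smt (verit) zero_le_power_eq_numeral even_numeral)
  next
    case False
    then have "\<bar>y\<bar> ^ k \<le> \<bar>y\<bar> ^ 4" using k by (intro power_increasing) auto
    then show ?thesis by simp
  qed
  then show "AE x in M. norm (f x ^ k) \<le> norm (1 + f x ^ 4)"
    by (auto simp: power_abs abs_of_nonneg)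
qed

lemma simple_integrand_mono:
  assumes "simple_integrand M F m \<tau> \<xi>" "i \<le> j" "j \<le> m"
  shows "\<tau> i \<le> \<tau> j"
  using assms(2,3)
proof (induction j rule: dec_induct)
  case (step n)
  then have "\<tau> n \<le> \<tau> (Suc n)"
    using assms(1) by (simp add: simple_integrand_def)
  then show ?case using step by simp
qed simp

lemma simple_integrand_nonneg:
  assumes "simple_integrand M F m \<tau> \<xi>" "i \<le> m"
  shows "0 \<le> \<tau> i"
  using simple_integrand_mono[OF assms(1), of 0 i] assms by (simp add: simple_integrand_def)

lemma simple_integrand_bound:
  assumes "simple_integrand M F m \<tau> \<xi>"
  obtains K where "K \<ge> 0" "\<And>i \<omega>. i < m \<Longrightarrow> \<omega> \<in> space M \<Longrightarrow> \<bar>\<xi> i \<omega>\<bar> \<le> K"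
proof -
  have "bounded (\<Union>i\<in>{..<m}. \<xi> i ` space M)"
    using assms by (intro bounded_UN) (auto simp: simple_integrand_def)
  then obtain K where "\<forall>x\<in>(\<Union>i\<in>{..<m}. \<xi> i ` space M). \<bar>x\<bar> \<le> K"
    unfolding bounded_iff by auto
  then show thesis
    by (intro that[of "max 0 K"]) (auto simp: le_max_iff_disj)
qed

section \<open>Moments and tails of elementary integrals\<close>

context brownian_setting
begin

text \<open>The elementary integral over the whole range of the times, without the cut-off
  \<open>min\<close> of \<open>step_integral\<close>; increments over an interval are brought to
  this form by \<open>simple_integrand_clamp\<close>.\<close>

definition incr_sum :: "(nat \<Rightarrow> real) \<Rightarrow> (nat \<Rightarrow> 'a \<Rightarrow> real) \<Rightarrow> nat \<Rightarrow> 'a \<Rightarrow> real" where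
  "incr_sum \<tau> \<xi> n \<omega> = (\<Sum>i<n. \<xi> i \<omega> * (B (\<tau> (Suc i)) \<omega> - B (\<tau> i) \<omega>))"

lemma incr_sum_0 [simp]: "incr_sum \<tau> \<xi> 0 \<omega> = 0"
  and incr_sum_Suc: "incr_sum \<tau> \<xi> (Suc n) \<omega> =
    incr_sum \<tau> \<xi> n \<omega> + \<xi> n \<omega> * (B (\<tau> (Suc n)) \<omega> - B (\<tau> n) \<omega>)"
  by (simp_all add: incr_sum_def)

lemma incr_sum_measurable:
  assumes s: "simple_integrand M F m \<tau> \<xi>" and n: "n \<le> m"
  shows "incr_sum \<tau> \<xi> n \<in> borel_measurable (F (\<tau> n))"
proof -
  have "(\<lambda>\<omega>. \<xi> i \<omega> * (B (\<tau> (Suc i)) \<omega> - B (\<tau> i) \<omega>)) \<in> borel_measurable (F (\<tau> n))" if i: "i < n" for i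
  proof (intro borel_measurable_times borel_measurable_diff)
    have "\<tau> i \<le> \<tau> n" "\<tau> (Suc i) \<le> \<tau> n" "0 \<le> \<tau> i" "0 \<le> \<tau> (Suc i)"
      using i n simple_integrand_mono[OF s] simple_integrand_nonneg[OF s] by auto
    then show "B (\<tau> (Suc i)) \<in> borel_measurable (F (\<tau> n))" "B (\<tau> i) \<in> borel_measurable (F (\<tau> n))"
      "\<xi> i \<in> borel_measurable (F (\<tau> n))"
      using i n s by (auto simp: simple_integrand_def intro: measurable_F_mono B_measurable)
  qed
  then show ?thesis
    unfolding incr_sum_def[abs_def] by (intro borel_measurable_sum) auto
qed

text \<open>Induction over the last increment \<open>D\<close>: odd powers of \<open>D\<close>
  average out, and the term with \<open>S^2 * D^2\<close> needs the second moment of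
  \<open>S\<close>, so both bounds are proved together. The coefficient \<open>3\<close> is the
  Gaussian fourth moment.\<close>

lemma incr_sum_moments:
  assumes s: "simple_integrand M F m \<tau> \<xi>" and n: "n \<le> m"
    and K: "\<And>i \<omega>. i < m \<Longrightarrow> \<omega> \<in> space M \<Longrightarrow> \<bar>\<xi> i \<omega>\<bar> \<le> K"
  shows "integrable M (\<lambda>\<omega>. incr_sum \<tau> \<xi> n \<omega> ^ 4) \<and>
    expectation (\<lambda>\<omega>. incr_sum \<tau> \<xi> n \<omega> ^ 2) \<le> K\<^sup>2 * (\<tau> n - \<tau> 0) \<and>
    expectation (\<lambda>\<omega>. incr_sum \<tau> \<xi> n \<omega> ^ 4) \<le> 3 * K ^ 4 * (\<tau> n - \<tau> 0)\<^sup>2"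
  using n
proof (induction n)
  case 0
  then show ?case by simp
next
  case (Suc n)
  define S where "S = incr_sum \<tau> \<xi> n"
  define D where "D = (\<lambda>\<omega>. B (\<tau> (Suc n)) \<omega> - B (\<tau> n) \<omega>)"
  define d where "d = \<tau> (Suc n) - \<tau> n"
  have n: "n < m" using Suc.prems by simp
  have t: "0 \<le> \<tau> n" "\<tau> n \<le> \<tau> (Suc n)" "\<tau> 0 \<le> \<tau> n"
    using n simple_integrand_mono[OF s, of n "Suc n"] simple_integrand_mono[OF s, of 0 n]
      simple_integrand_nonneg[OF s, of n] by auto
  have S: "integrable M (\<lambda>\<omega>. S \<omega> ^ 4)" "expectation (\<lambda>\<omega>. S \<omega> ^ 2) \<le> K\<^sup>2 * (\<tau> n - \<tau> 0)"
    "expectation (\<lambda>\<omega>. S \<omega> ^ 4) \<le> 3 * K ^ 4 * (\<tau> n - \<tau> 0)\<^sup>2"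
    using Suc.IH n by (auto simp: S_def)
  have mS [measurable]: "S \<in> borel_measurable (F (\<tau> n))"
    unfolding S_def using n by (intro incr_sum_measurable[OF s]) auto
  have mx [measurable]: "\<xi> n \<in> borel_measurable (F (\<tau> n))"
    using s n by (simp add: simple_integrand_def)
  have K4: "\<bar>\<xi> n \<omega> ^ k\<bar> \<le> K ^ k" if "\<omega> \<in> space M" for \<omega> k
    using K[OF n that] by (simp add: power_abs power_mono)
  have mU: "(\<lambda>\<omega>. \<xi> n \<omega> ^ k * S \<omega> ^ l) \<in> borel_measurable (F (\<tau> n))" for k l
    by measurable
  have iU: "integrable M (\<lambda>\<omega>. \<xi> n \<omega> ^ k * S \<omega> ^ l)" if "l \<le> 4" for k l
    by (rule integrable_bounded_mult[OF integrable_power_le_4[OF measurable_F_M[OF mS] S(1) that]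
        borel_measurable_power[OF measurable_F_M[OF mx]] K4])
  have U: "j \<noteq> 0 \<Longrightarrow> l \<le> 4 \<Longrightarrow> integrable M (\<lambda>\<omega>. (\<xi> n \<omega> ^ k * S \<omega> ^ l) * D \<omega> ^ j)"
    "l \<le> 4 \<Longrightarrow> expectation (\<lambda>\<omega>. (\<xi> n \<omega> ^ k * S \<omega> ^ l) * D \<omega> ^ 1) = 0"
    "l \<le> 4 \<Longrightarrow> expectation (\<lambda>\<omega>. (\<xi> n \<omega> ^ k * S \<omega> ^ l) * D \<omega> ^ 2) = expectation (\<lambda>\<omega>. \<xi> n \<omega> ^ k * S \<omega> ^ l) * d"
    "l \<le> 4 \<Longrightarrow> expectation (\<lambda>\<omega>. (\<xi> n \<omega> ^ k * S \<omega> ^ l) * D \<omega> ^ 3) = 0"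
    "l \<le> 4 \<Longrightarrow> expectation (\<lambda>\<omega>. (\<xi> n \<omega> ^ k * S \<omega> ^ l) * D \<omega> ^ 4) = expectation (\<lambda>\<omega>. \<xi> n \<omega> ^ k * S \<omega> ^ l) * (3 * d\<^sup>2)"
    for j k l
    unfolding D_def d_def power_one_right using increment_indep_moment[OF t(1,2) mU iU] by auto
  have eq: "incr_sum \<tau> \<xi> (Suc n) \<omega> = S \<omega> + \<xi> n \<omega> * D \<omega>" for \<omega>
    by (simp add: incr_sum_Suc S_def D_def)
  \<comment> \<open>Each term is written as an \<open>F (\<tau> n)\<close>-measurable factor
    \<open>\<xi> n ^ k * S ^ l\<close> times a power of \<open>D\<close>, trivial exponents
    included, so that the facts \<open>U\<close> match literally.\<close>
  have eq4: "incr_sum \<tau> \<xi> (Suc n) \<omega> ^ 4 = S \<omega> ^ 4 + 4 * ((\<xi> n \<omega> ^ 1 * S \<omega> ^ 3) * D \<omega> ^ 1)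
     + 6 * ((\<xi> n \<omega> ^ 2 * S \<omega> ^ 2) * D \<omega> ^ 2) + 4 * ((\<xi> n \<omega> ^ 3 * S \<omega> ^ 1) * D \<omega> ^ 3)
     + (\<xi> n \<omega> ^ 4 * S \<omega> ^ 0) * D \<omega> ^ 4" for \<omega>
    unfolding eq by (simp add: power4_eq_xxxx power2_eq_square power3_eq_cube algebra_simps)
  have eq2: "incr_sum \<tau> \<xi> (Suc n) \<omega> ^ 2 = S \<omega> ^ 2 + 2 * ((\<xi> n \<omega> ^ 1 * S \<omega> ^ 1) * D \<omega> ^ 1)
     + (\<xi> n \<omega> ^ 2 * S \<omega> ^ 0) * D \<omega> ^ 2" for \<omega>
    unfolding eq by (simp add: power2_eq_square algebra_simps)
  have xK: "expectation (\<lambda>\<omega>. \<xi> n \<omega> ^ k * S \<omega> ^ l) \<le> K ^ k * expectation (\<lambda>\<omega>. S \<omega> ^ l)"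
    if "even l" "l \<le> 4" for k l
  proof -
    have "expectation (\<lambda>\<omega>. \<xi> n \<omega> ^ k * S \<omega> ^ l) \<le> expectation (\<lambda>\<omega>. K ^ k * S \<omega> ^ l)"
    proof (rule integral_mono[OF iU[OF that(2)]])
      show "integrable M (\<lambda>\<omega>. K ^ k * S \<omega> ^ l)"
        using integrable_power_le_4[OF measurable_F_M[OF mS] S(1) that(2)] by simp
      show "\<xi> n \<omega> ^ k * S \<omega> ^ l \<le> K ^ k * S \<omega> ^ l" if "\<omega> \<in> space M" for \<omega>
        using K4[OF that, of k] \<open>even l\<close> by (intro mult_right_mono) (auto simp: zero_le_even_power)
    qed
    then show ?thesis by simp
  qed
  have I4: "integrable M (\<lambda>\<omega>. incr_sum \<tau> \<xi> (Suc n) \<omega> ^ 4)"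
    unfolding eq4
    by (intro Bochner_Integration.integrable_add integrable_mult_right U(1) S(1)) simp_all
  have "expectation (\<lambda>\<omega>. incr_sum \<tau> \<xi> (Suc n) \<omega> ^ 4) = expectation (\<lambda>\<omega>. S \<omega> ^ 4)
     + 6 * (expectation (\<lambda>\<omega>. \<xi> n \<omega> ^ 2 * S \<omega> ^ 2) * d) + expectation (\<lambda>\<omega>. \<xi> n \<omega> ^ 4 * S \<omega> ^ 0) * (3 * d\<^sup>2)"
    unfolding eq4 using S(1) U(1)[of 1 3 1] U(1)[of 2 2 2] U(1)[of 3 1 3] U(1)[of 4 0 4]
      U(2)[of 3 1] U(3)[of 2 2] U(4)[of 1 3] U(5)[of 0 4] by simp
  \<comment> \<open>With \<open>a = \<tau> n - \<tau> 0\<close> this bound is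
    \<open>3 * K^4 * (a^2 + 2 * a * d + d^2)\<close>, where the bracket is a perfect square.\<close>
  also have "\<dots> \<le> 3 * K ^ 4 * (\<tau> n - \<tau> 0)\<^sup>2 + 6 * (K ^ 2 * (K ^ 2 * (\<tau> n - \<tau> 0)) * d) + (K ^ 4 * 1) * (3 * d\<^sup>2)"
    using S(2,3) t xK[of 2 2] xK[of 0 4] order_trans[OF xK[of 2 2] mult_left_mono[OF S(2)]]
    by (intro add_mono mult_left_mono mult_right_mono) (auto simp: d_def prob_space)
  also have "\<dots> = 3 * K ^ 4 * (\<tau> (Suc n) - \<tau> 0)\<^sup>2"
    by (simp add: d_def power4_eq_xxxx power2_eq_square algebra_simps)
  finally have 4: "expectation (\<lambda>\<omega>. incr_sum \<tau> \<xi> (Suc n) \<omega> ^ 4) \<le> 3 * K ^ 4 * (\<tau> (Suc n) - \<tau> 0)\<^sup>2" .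
  have "expectation (\<lambda>\<omega>. incr_sum \<tau> \<xi> (Suc n) \<omega> ^ 2) = expectation (\<lambda>\<omega>. S \<omega> ^ 2)
     + expectation (\<lambda>\<omega>. \<xi> n \<omega> ^ 2 * S \<omega> ^ 0) * d"
    unfolding eq2 using integrable_power_le_4[OF measurable_F_M[OF mS] S(1), of 2]
      U(1)[of 1 1 1] U(1)[of 2 0 2] U(2)[of 1 1] U(3)[of 0 2] by simp
  also have "\<dots> \<le> K\<^sup>2 * (\<tau> n - \<tau> 0) + (K ^ 2 * 1) * d"
    using S(2) t xK[of 0 2] by (intro add_mono mult_right_mono) (auto simp: d_def prob_space)
  also have "\<dots> = K\<^sup>2 * (\<tau> (Suc n) - \<tau> 0)"
    by (simp add: d_def algebra_simps)
  finally show ?case using I4 4 by blast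
qed

lemma coefficient_power_integrable:
  assumes s: "simple_integrand M F m \<tau> \<xi>" and i: "i < m"
  shows "integrable M (\<lambda>\<omega>. \<xi> i \<omega> ^ k)"
proof -
  obtain K where K: "\<And>i \<omega>. i < m \<Longrightarrow> \<omega> \<in> space M \<Longrightarrow> \<bar>\<xi> i \<omega>\<bar> \<le> K"
    using simple_integrand_bound[OF s] by metis
  have "\<xi> i \<in> borel_measurable M"
    using s i measurable_F_M by (auto simp: simple_integrand_def)
  then show ?thesis
    using K[OF i] by (intro integrable_const_bound[of _ "K ^ k"]) (auto simp: power_abs power_mono)
qed

text \<open>\<open>Z\<close> is known at the first time and can be absorbed into the coefficients;
  each summand is then centred.\<close>

lemma incr_sum_mean_zero:
  assumes s: "simple_integrand M F m \<tau> \<xi>" and n: "n \<le> m"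
    and Z: "Z \<in> borel_measurable (F (\<tau> 0))" "integrable M Z"
  shows "integrable M (\<lambda>\<omega>. Z \<omega> * incr_sum \<tau> \<xi> n \<omega>)"
    and "expectation (\<lambda>\<omega>. Z \<omega> * incr_sum \<tau> \<xi> n \<omega>) = 0"
proof -
  obtain K where K: "\<And>i \<omega>. i < m \<Longrightarrow> \<omega> \<in> space M \<Longrightarrow> \<bar>\<xi> i \<omega>\<bar> \<le> K"
    using simple_integrand_bound[OF s] by metis
  have *: "integrable M (\<lambda>\<omega>. (\<xi> i \<omega> * Z \<omega>) * (B (\<tau> (Suc i)) \<omega> - B (\<tau> i) \<omega>))
     \<and> expectation (\<lambda>\<omega>. (\<xi> i \<omega> * Z \<omega>) * (B (\<tau> (Suc i)) \<omega> - B (\<tau> i) \<omega>)) = 0" if "i < n" for i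
  proof -
    have i: "i < m" using that n by simp
    have t: "0 \<le> \<tau> i" "\<tau> i \<le> \<tau> (Suc i)" "\<tau> 0 \<le> \<tau> i"
      using i simple_integrand_mono[OF s, of i "Suc i"] simple_integrand_mono[OF s, of 0 i]
        simple_integrand_nonneg[OF s, of i] by auto
    have mx: "\<xi> i \<in> borel_measurable (F (\<tau> i))"
      using s i by (simp add: simple_integrand_def)
    have mU: "(\<lambda>\<omega>. \<xi> i \<omega> * Z \<omega>) \<in> borel_measurable (F (\<tau> i))"
      using mx measurable_F_mono[OF t(3) Z(1)] by (rule borel_measurable_times)
    have iU: "integrable M (\<lambda>\<omega>. \<xi> i \<omega> * Z \<omega>)"
      using Z(2) measurable_F_M[OF mx] K[OF i] by (rule integrable_bounded_mult)
    show ?thesis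
      using increment_indep_moment(1)[OF t(1,2) mU iU, of 1] increment_indep_moment(2)[OF t(1,2) mU iU]
      by simp
  qed
  have eq: "Z \<omega> * incr_sum \<tau> \<xi> n \<omega> = (\<Sum>i<n. (\<xi> i \<omega> * Z \<omega>) * (B (\<tau> (Suc i)) \<omega> - B (\<tau> i) \<omega>))" for \<omega>
    by (simp add: incr_sum_def sum_distrib_left mult_ac)
  show "integrable M (\<lambda>\<omega>. Z \<omega> * incr_sum \<tau> \<xi> n \<omega>)"
    unfolding eq using * by (intro Bochner_Integration.integrable_sum) auto
  show "expectation (\<lambda>\<omega>. Z \<omega> * incr_sum \<tau> \<xi> n \<omega>) = 0"
    unfolding eq using * by (subst Bochner_Integration.integral_sum) auto
qed

text \<open>A conditional Ito isometry, with the weight \<open>Z\<close> in place of an event of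
  \<open>F (\<tau> 0)\<close>. The cross terms vanish since \<open>Z * \<xi> n * S\<close> is known
  before the increment \<open>D\<close>.\<close>

lemma incr_sum_isometry:
  assumes s: "simple_integrand M F m \<tau> \<xi>" and n: "n \<le> m"
    and Z: "Z \<in> borel_measurable (F (\<tau> 0))" "\<And>\<omega>. \<omega> \<in> space M \<Longrightarrow> \<bar>Z \<omega>\<bar> \<le> c"
  shows "expectation (\<lambda>\<omega>. Z \<omega> * incr_sum \<tau> \<xi> n \<omega> ^ 2) =
    expectation (\<lambda>\<omega>. Z \<omega> * (\<Sum>i<n. \<xi> i \<omega> ^ 2 * (\<tau> (Suc i) - \<tau> i)))"
proof -
  obtain K where K: "\<And>i \<omega>. i < m \<Longrightarrow> \<omega> \<in> space M \<Longrightarrow> \<bar>\<xi> i \<omega>\<bar> \<le> K"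
    using simple_integrand_bound[OF s] by metis
  have mZ: "Z \<in> borel_measurable M" by (rule measurable_F_M[OF Z(1)])
  have mx: "\<xi> i \<in> borel_measurable (F (\<tau> i))" if "i < m" for i
    using s that by (simp add: simple_integrand_def)
  have ix: "integrable M (\<lambda>\<omega>. Z \<omega> * \<xi> i \<omega> ^ 2)" if i: "i < m" for i
    by (rule integrable_bounded_mult[OF coefficient_power_integrable[OF s i] mZ Z(2)])
  have "expectation (\<lambda>\<omega>. Z \<omega> * incr_sum \<tau> \<xi> n \<omega> ^ 2) =
    (\<Sum>i<n. expectation (\<lambda>\<omega>. Z \<omega> * \<xi> i \<omega> ^ 2) * (\<tau> (Suc i) - \<tau> i))"
    using n
  proof (induction n)
    case (Suc n)
    define S where "S = incr_sum \<tau> \<xi> n"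
    define D where "D = (\<lambda>\<omega>. B (\<tau> (Suc n)) \<omega> - B (\<tau> n) \<omega>)"
    have n: "n < m" using Suc.prems by simp
    have t: "0 \<le> \<tau> n" "\<tau> n \<le> \<tau> (Suc n)" "\<tau> 0 \<le> \<tau> n"
      using n simple_integrand_mono[OF s, of n "Suc n"] simple_integrand_mono[OF s, of 0 n]
        simple_integrand_nonneg[OF s, of n] by auto
    have S4: "integrable M (\<lambda>\<omega>. S \<omega> ^ 4)"
      using incr_sum_moments[OF s _ K, of n] n by (simp add: S_def)
    have mS: "S \<in> borel_measurable (F (\<tau> n))"
      unfolding S_def using n by (intro incr_sum_measurable[OF s]) auto
    have iS: "integrable M (\<lambda>\<omega>. S \<omega> ^ k)" if "k \<le> 4" for k
      by (rule integrable_power_le_4[OF measurable_F_M[OF mS] S4 that])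
    have mZn: "Z \<in> borel_measurable (F (\<tau> n))" by (rule measurable_F_mono[OF t(3) Z(1)])
    have m1: "(\<lambda>\<omega>. Z \<omega> * (\<xi> n \<omega> * S \<omega> ^ 1)) \<in> borel_measurable (F (\<tau> n))"
      using mZn mx[OF n] mS by simp
    have i1: "integrable M (\<lambda>\<omega>. Z \<omega> * (\<xi> n \<omega> * S \<omega> ^ 1))"
      by (intro integrable_bounded_mult[OF _ mZ Z(2)] integrable_bounded_mult[OF iS measurable_F_M[OF mx[OF n]] K[OF n]])
        auto
    have m2: "(\<lambda>\<omega>. Z \<omega> * \<xi> n \<omega> ^ 2) \<in> borel_measurable (F (\<tau> n))"
      using mZn mx[OF n] by simp
    have i2: "integrable M (\<lambda>\<omega>. Z \<omega> * S \<omega> ^ 2)"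
      by (intro integrable_bounded_mult[OF iS mZ Z(2)]) auto
    have eq: "Z \<omega> * incr_sum \<tau> \<xi> (Suc n) \<omega> ^ 2 = Z \<omega> * S \<omega> ^ 2 + 2 * (Z \<omega> * (\<xi> n \<omega> * S \<omega> ^ 1) * D \<omega>)
      + Z \<omega> * \<xi> n \<omega> ^ 2 * D \<omega> ^ 2" for \<omega>
      by (simp add: incr_sum_Suc S_def D_def power2_eq_square algebra_simps)
    have U: "integrable M (\<lambda>\<omega>. Z \<omega> * (\<xi> n \<omega> * S \<omega> ^ 1) * D \<omega>)"
      "expectation (\<lambda>\<omega>. Z \<omega> * (\<xi> n \<omega> * S \<omega> ^ 1) * D \<omega>) = 0"
      "integrable M (\<lambda>\<omega>. Z \<omega> * \<xi> n \<omega> ^ 2 * D \<omega> ^ 2)"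
      "expectation (\<lambda>\<omega>. Z \<omega> * \<xi> n \<omega> ^ 2 * D \<omega> ^ 2) = expectation (\<lambda>\<omega>. Z \<omega> * \<xi> n \<omega> ^ 2) * (\<tau> (Suc n) - \<tau> n)"
      unfolding D_def
      using increment_indep_moment(1)[OF t(1,2) m1 i1, of 1] increment_indep_moment(2)[OF t(1,2) m1 i1]
        increment_indep_moment(1)[OF t(1,2) m2 ix[OF n], of 2] increment_indep_moment(3)[OF t(1,2) m2 ix[OF n]]
      by simp_all
    have "expectation (\<lambda>\<omega>. Z \<omega> * incr_sum \<tau> \<xi> (Suc n) \<omega> ^ 2) = expectation (\<lambda>\<omega>. Z \<omega> * S \<omega> ^ 2)
      + expectation (\<lambda>\<omega>. Z \<omega> * \<xi> n \<omega> ^ 2) * (\<tau> (Suc n) - \<tau> n)"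
      unfolding eq using U i2 by simp
    then show ?case using Suc n by (simp add: S_def)
  qed simp
  also have "\<dots> = expectation (\<lambda>\<omega>. \<Sum>i<n. (Z \<omega> * \<xi> i \<omega> ^ 2) * (\<tau> (Suc i) - \<tau> i))"
    using ix n by (subst Bochner_Integration.integral_sum) auto
  also have "\<dots> = expectation (\<lambda>\<omega>. Z \<omega> * (\<Sum>i<n. \<xi> i \<omega> ^ 2 * (\<tau> (Suc i) - \<tau> i)))"
    by (simp add: sum_distrib_left mult_ac)
  finally show ?thesis .
qed

text \<open>Proof by truncation: the coefficients are switched off as soon as the quadratic variation
  exceeds \<open>d\<close>, and Chebyshev's inequality is applied to the truncated sum.\<close>

lemma incr_sum_tail_bound:
  assumes s: "simple_integrand M F m \<tau> \<xi>" and ed: "0 < e" "0 \<le> d"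
  shows "prob {\<omega> \<in> space M. e < \<bar>incr_sum \<tau> \<xi> m \<omega>\<bar>} \<le>
    prob {\<omega> \<in> space M. d < (\<Sum>i<m. \<xi> i \<omega> ^ 2 * (\<tau> (Suc i) - \<tau> i))} + d / e\<^sup>2"
proof -
  define Q where "Q = (\<lambda>n \<omega>. \<Sum>i<n. \<xi> i \<omega> ^ 2 * (\<tau> (Suc i) - \<tau> i))"
  \<comment> \<open>The test uses \<open>Q (Suc i)\<close>, which already contains the term of index
    \<open>i\<close>: it is still \<open>F (\<tau> i)\<close>-measurable, because
    \<open>\<xi> i\<close> is, and it keeps the truncated quadratic variation from overshooting
    \<open>d\<close>.\<close>
  define \<eta> where "\<eta> = (\<lambda>i \<omega>. if Q (Suc i) \<omega> \<le> d then \<xi> i \<omega> else 0)"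
  have mx: "\<xi> i \<in> borel_measurable (F (\<tau> j))" if "i \<le> j" "j < m" for i j
    using s that measurable_F_mono[OF simple_integrand_mono[OF s, of i j], of "\<xi> i"]
    by (simp add: simple_integrand_def)
  have mQ: "Q (Suc i) \<in> borel_measurable (F (\<tau> i))" if "i < m" for i
    unfolding Q_def using that mx by (intro borel_measurable_sum borel_measurable_times borel_measurable_power) auto
  have m\<eta>: "\<eta> i \<in> borel_measurable (F (\<tau> i))" if "i < m" for i
    unfolding \<eta>_def using mQ[OF that] mx[OF order_refl that] by measurable
  obtain K where K: "K \<ge> 0" "\<And>i \<omega>. i < m \<Longrightarrow> \<omega> \<in> space M \<Longrightarrow> \<bar>\<xi> i \<omega>\<bar> \<le> K"
    using simple_integrand_bound[OF s] by metis
  have K': "\<bar>\<eta> i \<omega>\<bar> \<le> K" if "i < m" "\<omega> \<in> space M" for i \<omega>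
    using K that by (simp add: \<eta>_def)
  have s': "simple_integrand M F m \<tau> \<eta>"
    using s m\<eta> K' by (auto simp: simple_integrand_def bounded_iff)
  have Qpos: "0 \<le> \<xi> i \<omega> ^ 2 * (\<tau> (Suc i) - \<tau> i)" if "i < m" for i \<omega>
    using s that by (simp add: simple_integrand_def)
  have Q': "(\<Sum>i<n. \<eta> i \<omega> ^ 2 * (\<tau> (Suc i) - \<tau> i)) \<le> min d (Q n \<omega>)" if "n \<le> m" for n \<omega>
    using that
  proof (induction n)
    case (Suc n)
    then show ?case using Qpos[of n \<omega>] by (auto simp: \<eta>_def Q_def)
  qed (use ed in \<open>simp add: Q_def\<close>)
  have Qm: "Q n \<omega> \<le> Q m \<omega>" if "n \<le> m" for n \<omega>
    unfolding Q_def using that Qpos by (intro sum_mono2) auto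
  have eq: "incr_sum \<tau> \<eta> m \<omega> = incr_sum \<tau> \<xi> m \<omega>" if "Q m \<omega> \<le> d" for \<omega>
    unfolding incr_sum_def
  proof (rule sum.cong)
    fix i assume "i \<in> {..<m}"
    then have "Q (Suc i) \<omega> \<le> d" using Qm[of "Suc i" \<omega>] that by simp
    then show "\<eta> i \<omega> * (B (\<tau> (Suc i)) \<omega> - B (\<tau> i) \<omega>) = \<xi> i \<omega> * (B (\<tau> (Suc i)) \<omega> - B (\<tau> i) \<omega>)"
      by (simp add: \<eta>_def)
  qed simp
  have mS [measurable]: "incr_sum \<tau> \<xi> m \<in> borel_measurable M" "incr_sum \<tau> \<eta> m \<in> borel_measurable M"
    using incr_sum_measurable[OF s] incr_sum_measurable[OF s'] measurable_F_M by blast+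
  have [measurable]: "Q m \<in> borel_measurable M"
  proof -
    have "\<xi> i \<in> borel_measurable M" if "i < m" for i
      using measurable_F_M[OF mx[OF order_refl that]] .
    then show ?thesis
      unfolding Q_def by (intro borel_measurable_sum borel_measurable_times borel_measurable_power) auto
  qed
  have i4: "integrable M (\<lambda>\<omega>. incr_sum \<tau> \<eta> m \<omega> ^ 4)"
    using incr_sum_moments[OF s' order_refl K'] by blast
  have i2: "integrable M (\<lambda>\<omega>. incr_sum \<tau> \<eta> m \<omega> ^ 2)"
    by (rule integrable_power_le_4[OF mS(2) i4]) simp
  have "prob {\<omega> \<in> space M. e < \<bar>incr_sum \<tau> \<xi> m \<omega>\<bar>} \<le>
    prob ({\<omega> \<in> space M. d < Q m \<omega>} \<union> {\<omega> \<in> space M. e\<^sup>2 \<le> incr_sum \<tau> \<eta> m \<omega> ^ 2})"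
  proof (rule finite_measure_mono)
    show "{\<omega> \<in> space M. e < \<bar>incr_sum \<tau> \<xi> m \<omega>\<bar>} \<subseteq>
      {\<omega> \<in> space M. d < Q m \<omega>} \<union> {\<omega> \<in> space M. e\<^sup>2 \<le> incr_sum \<tau> \<eta> m \<omega> ^ 2}"
    proof (intro subsetI)
      fix \<omega> assume \<omega>: "\<omega> \<in> {\<omega> \<in> space M. e < \<bar>incr_sum \<tau> \<xi> m \<omega>\<bar>}"
      show "\<omega> \<in> {\<omega> \<in> space M. d < Q m \<omega>} \<union> {\<omega> \<in> space M. e\<^sup>2 \<le> incr_sum \<tau> \<eta> m \<omega> ^ 2}"
      proof (cases "Q m \<omega> \<le> d")
        case True
        then have "e\<^sup>2 \<le> incr_sum \<tau> \<eta> m \<omega> ^ 2"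
          using \<omega> ed eq[of \<omega>] by (simp flip: abs_le_square_iff)
        then show ?thesis using \<omega> by simp
      qed (use \<omega> in simp)
    qed
  qed measurable
  also have "\<dots> \<le> prob {\<omega> \<in> space M. d < Q m \<omega>} + prob {\<omega> \<in> space M. e\<^sup>2 \<le> incr_sum \<tau> \<eta> m \<omega> ^ 2}"
    by (rule measure_Un_le) measurable
  also have "prob {\<omega> \<in> space M. e\<^sup>2 \<le> incr_sum \<tau> \<eta> m \<omega> ^ 2} \<le> expectation (\<lambda>\<omega>. incr_sum \<tau> \<eta> m \<omega> ^ 2) / e\<^sup>2"
    using integral_Markov_inequality_measure[OF i2, of "{}" "e\<^sup>2"] ed by simp
  also have "expectation (\<lambda>\<omega>. incr_sum \<tau> \<eta> m \<omega> ^ 2) = expectation (\<lambda>\<omega>. \<Sum>i<m. \<eta> i \<omega> ^ 2 * (\<tau> (Suc i) - \<tau> i))"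
    using incr_sum_isometry[OF s' order_refl, of "\<lambda>_. 1" 1] by simp
  also have "\<dots> \<le> d"
    using Q'[OF order_refl] ed by (intro integral_le_const)
      (auto intro!: Bochner_Integration.integrable_sum coefficient_power_integrable[OF s'])
  finally show ?thesis
    using ed by (simp add: Q_def divide_right_mono)
qed

end

section \<open>Step processes, time windows and refinements\<close>

abbreviation lebesgue_on_ivl :: "real \<Rightarrow> real \<Rightarrow> real measure" where
  "lebesgue_on_ivl s t \<equiv> restrict_space lborel {s..t}"

abbreviation sq_err ::
    "real \<Rightarrow> real \<Rightarrow> (real \<Rightarrow> 'a \<Rightarrow> real) \<Rightarrow> nat \<Rightarrow> (nat \<Rightarrow> real) \<Rightarrow> (nat \<Rightarrow> 'a \<Rightarrow> real) \<Rightarrow> 'a \<Rightarrow> ennreal" where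
  "sq_err s t H m \<tau> \<xi> \<omega> \<equiv>
    \<integral>\<^sup>+u. ennreal ((H u \<omega> - step_process m \<tau> \<xi> u \<omega>)\<^sup>2) \<partial>lebesgue_on_ivl s t"

lemma step_process_eq:
  assumes s: "simple_integrand M F m \<tau> \<xi>" and i: "i < m" "\<tau> i < u" "u \<le> \<tau> (Suc i)"
  shows "step_process m \<tau> \<zeta> u \<omega> = \<zeta> i \<omega>"
proof -
  have "indicator {\<tau> j<..\<tau> (Suc j)} u = (of_bool (j = i) :: real)" if j: "j < m" for j
  proof (cases j i rule: linorder_cases)
    case less
    then have "\<tau> (Suc j) \<le> \<tau> i" using simple_integrand_mono[OF s, of "Suc j" i] i by simp
    then show ?thesis using less i by simp
  next
    case greater
    then have "\<tau> (Suc i) \<le> \<tau> j" using simple_integrand_mono[OF s, of "Suc i" j] j by simp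
    then show ?thesis using greater i by simp
  qed (use i in simp)
  then have "step_process m \<tau> \<zeta> u \<omega> = (\<Sum>j<m. \<zeta> j \<omega> * of_bool (j = i))"
    unfolding step_process_def by (intro sum.cong) auto
  then show ?thesis using i by (simp add: if_distrib of_bool_def cong: if_cong)
qed

lemma step_process_eq_0:
  assumes "\<And>i. i < m \<Longrightarrow> \<not> (\<tau> i < u \<and> u \<le> \<tau> (Suc i))"
  shows "step_process m \<tau> \<zeta> u \<omega> = 0"
  using assms unfolding step_process_def by (intro sum.neutral) auto

text \<open>At each time at most one summand is nonzero, so \<open>f\<close> acts on it alone;
  \<open>f 0 = 0\<close> covers times outside the partition. Used for squares and for
  clipping.\<close>

lemma step_process_map:
  assumes s: "simple_integrand M F m \<tau> \<xi>" and f: "f 0 = 0"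
  shows "step_process m \<tau> (\<lambda>i \<omega>. f (\<xi> i \<omega>)) u \<omega> = f (step_process m \<tau> \<xi> u \<omega>)"
proof (cases "\<exists>i<m. \<tau> i < u \<and> u \<le> \<tau> (Suc i)")
  case True
  then obtain i where "i < m" "\<tau> i < u" "u \<le> \<tau> (Suc i)" by blast
  then show ?thesis by (simp add: step_process_eq[OF s])
qed (use f in \<open>simp add: step_process_eq_0\<close>)

lemma step_process_diff:
  "step_process m \<tau> (\<lambda>i \<omega>. \<xi> i \<omega> - \<eta> i \<omega>) u \<omega> = step_process m \<tau> \<xi> u \<omega> - step_process m \<tau> \<eta> u \<omega>"
  by (simp add: step_process_def left_diff_distrib sum_subtractf)

lemma step_integral_diff:
  "step_integral B m \<tau> (\<lambda>i \<omega>. \<xi> i \<omega> - \<eta> i \<omega>) u \<omega> = step_integral B m \<tau> \<xi> u \<omega> - step_integral B m \<tau> \<eta> u \<omega>"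
  by (simp add: step_integral_def left_diff_distrib sum_subtractf)

text \<open>Identifies the sum in the isometry and in the tail bound with the squared norm in time,
  the quantity in which the definition of the Ito integral measures approximation.\<close>

lemma nn_integral_step_process:
  assumes s: "simple_integrand M F m \<tau> \<xi>" and "0 \<le> s"
    and \<tau>: "\<And>i. i \<le> m \<Longrightarrow> s \<le> \<tau> i \<and> \<tau> i \<le> t"
  shows "(\<integral>\<^sup>+u. ennreal ((step_process m \<tau> \<xi> u \<omega>)\<^sup>2) \<partial>lebesgue_on_ivl s t) =
    ennreal (\<Sum>i<m. \<xi> i \<omega> ^ 2 * (\<tau> (Suc i) - \<tau> i))"
proof -
  have le: "\<tau> i \<le> \<tau> (Suc i)" if "i < m" for i
    using that s by (simp add: simple_integrand_def)
  have "ennreal ((step_process m \<tau> \<xi> u \<omega>)\<^sup>2) * indicator {s..t} u =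
    (\<Sum>i<m. ennreal (\<xi> i \<omega> ^ 2) * indicator {\<tau> i<..\<tau> (Suc i)} u)" for u
  proof -
    have "(step_process m \<tau> \<xi> u \<omega>)\<^sup>2 = step_process m \<tau> (\<lambda>i \<omega>. (\<xi> i \<omega>)\<^sup>2) u \<omega>"
      using step_process_map[OF s, of "\<lambda>x. x\<^sup>2"] by simp
    also have "ennreal \<dots> = (\<Sum>i<m. ennreal (\<xi> i \<omega> ^ 2 * indicator {\<tau> i<..\<tau> (Suc i)} u))"
      unfolding step_process_def by (subst sum_ennreal) auto
    also have "\<dots> * indicator {s..t} u = (\<Sum>i<m. ennreal (\<xi> i \<omega> ^ 2) * indicator {\<tau> i<..\<tau> (Suc i)} u)"
      unfolding sum_distrib_right
    proof (intro sum.cong refl)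
      fix i assume "i \<in> {..<m}"
      then show "ennreal (\<xi> i \<omega> ^ 2 * indicator {\<tau> i<..\<tau> (Suc i)} u) * indicator {s..t} u =
        ennreal (\<xi> i \<omega> ^ 2) * indicator {\<tau> i<..\<tau> (Suc i)} u"
        using \<tau>[of i] \<tau>[of "Suc i"] by (auto simp: indicator_def)
    qed
    finally show ?thesis .
  qed
  then have "(\<integral>\<^sup>+u. ennreal ((step_process m \<tau> \<xi> u \<omega>)\<^sup>2) \<partial>lebesgue_on_ivl s t) =
    (\<integral>\<^sup>+u. (\<Sum>i<m. ennreal (\<xi> i \<omega> ^ 2) * indicator {\<tau> i<..\<tau> (Suc i)} u) \<partial>lborel)"
    by (simp add: nn_integral_restrict_space)
  also have "\<dots> = (\<Sum>i<m. \<integral>\<^sup>+u. ennreal (\<xi> i \<omega> ^ 2) * indicator {\<tau> i<..\<tau> (Suc i)} u \<partial>lborel)"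
    by (rule nn_integral_sum) auto
  also have "\<dots> = (\<Sum>i<m. ennreal (\<xi> i \<omega> ^ 2 * (\<tau> (Suc i) - \<tau> i)))"
    using le by (intro sum.cong refl) (simp add: nn_integral_cmult_indicator ennreal_mult)
  also have "\<dots> = ennreal (\<Sum>i<m. \<xi> i \<omega> ^ 2 * (\<tau> (Suc i) - \<tau> i))"
    using le by (intro sum_ennreal) auto
  finally show ?thesis .
qed

context brownian_setting
begin

text \<open>Restriction to the window from \<open>s\<close> to \<open>t\<close>. A coefficient with
  \<open>\<tau> i > t\<close> is set to \<open>0\<close> because it need not be known at the clamped
  time \<open>t\<close>; its interval has collapsed there, so nothing is lost. Raising an early time
  to \<open>s\<close> keeps measurability.\<close>

lemma simple_integrand_clamp:
  assumes s: "simple_integrand M F m \<tau> \<xi>" and st: "0 \<le> s" "s \<le> t"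
  defines "\<tau>' \<equiv> \<lambda>i. max s (min t (\<tau> i))"
  defines "\<xi>' \<equiv> \<lambda>i \<omega>. if \<tau> i \<le> t then \<xi> i \<omega> else 0"
  shows "simple_integrand M F m \<tau>' \<xi>'"
    and "step_integral B m \<tau> \<xi> t \<omega> - step_integral B m \<tau> \<xi> s \<omega> = incr_sum \<tau>' \<xi>' m \<omega>"
    and "s < u \<Longrightarrow> u \<le> t \<Longrightarrow> step_process m \<tau>' \<xi>' u \<omega> = step_process m \<tau> \<xi> u \<omega>"
proof -
  have mono: "\<tau> i \<le> \<tau> (Suc i)" if "i < m" for i
    using that s by (simp add: simple_integrand_def)
  have "\<xi>' i \<in> borel_measurable (F (\<tau>' i))" if i: "i < m" for i
  proof (cases "\<tau> i \<le> t")
    case True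
    then have "\<tau> i \<le> \<tau>' i" by (simp add: \<tau>'_def)
    with True show ?thesis
      using s i measurable_F_mono[of "\<tau> i" "\<tau>' i" "\<xi> i"] by (simp add: \<xi>'_def simple_integrand_def)
  qed (simp add: \<xi>'_def)
  moreover have "bounded (\<xi>' i ` space M)" if i: "i < m" for i
    using s i by (cases "\<tau> i \<le> t") (auto simp: \<xi>'_def simple_integrand_def image_constant_conv)
  moreover have "\<tau>' i \<le> \<tau>' (Suc i)" if "i < m" for i
    unfolding \<tau>'_def using mono[OF that] by (intro max.mono min.mono) auto
  ultimately show "simple_integrand M F m \<tau>' \<xi>'"
    using st by (auto simp: simple_integrand_def \<tau>'_def)
  have B: "B (min x t) \<omega> - B (min x s) \<omega> = B (max s (min t x)) \<omega> - B s \<omega>" for x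
    using st by (auto simp: min_def max_def)
  have "\<xi> i \<omega> * (B (min (\<tau> (Suc i)) t) \<omega> - B (min (\<tau> i) t) \<omega>) -
      \<xi> i \<omega> * (B (min (\<tau> (Suc i)) s) \<omega> - B (min (\<tau> i) s) \<omega>) =
      \<xi>' i \<omega> * (B (\<tau>' (Suc i)) \<omega> - B (\<tau>' i) \<omega>)" if i: "i < m" for i
  proof -
    have "\<xi> i \<omega> * (B (min (\<tau> (Suc i)) t) \<omega> - B (min (\<tau> i) t) \<omega>) -
      \<xi> i \<omega> * (B (min (\<tau> (Suc i)) s) \<omega> - B (min (\<tau> i) s) \<omega>) =
      \<xi> i \<omega> * ((B (min (\<tau> (Suc i)) t) \<omega> - B (min (\<tau> (Suc i)) s) \<omega>) -
       (B (min (\<tau> i) t) \<omega> - B (min (\<tau> i) s) \<omega>))"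
      by (simp add: algebra_simps)
    also have "\<dots> = \<xi> i \<omega> * (B (\<tau>' (Suc i)) \<omega> - B (\<tau>' i) \<omega>)"
      unfolding B by (simp add: \<tau>'_def)
    also have "\<dots> = \<xi>' i \<omega> * (B (\<tau>' (Suc i)) \<omega> - B (\<tau>' i) \<omega>)"
    proof (cases "\<tau> i \<le> t")
      case False
      then have "\<tau>' (Suc i) = \<tau>' i" using mono[OF i] by (simp add: \<tau>'_def)
      then show ?thesis by simp
    qed (simp add: \<xi>'_def)
    finally show ?thesis .
  qed
  then show "step_integral B m \<tau> \<xi> t \<omega> - step_integral B m \<tau> \<xi> s \<omega> = incr_sum \<tau>' \<xi>' m \<omega>"
    by (simp add: step_integral_def incr_sum_def flip: sum_subtractf)
  show "step_process m \<tau>' \<xi>' u \<omega> = step_process m \<tau> \<xi> u \<omega>" if u: "s < u" "u \<le> t"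
    unfolding step_process_def
  proof (intro sum.cong refl)
    fix i
    show "\<xi>' i \<omega> * indicator {\<tau>' i<..\<tau>' (Suc i)} u = \<xi> i \<omega> * indicator {\<tau> i<..\<tau> (Suc i)} u"
      using u by (auto simp: \<xi>'_def \<tau>'_def indicator_def)
  qed
qed

lemma simple_integrand_diff:
  assumes "simple_integrand M F m \<tau> \<xi>" "simple_integrand M F m \<tau> \<eta>"
  shows "simple_integrand M F m \<tau> (\<lambda>i \<omega>. \<xi> i \<omega> - \<eta> i \<omega>)"
proof -
  have "bounded ((\<lambda>\<omega>. \<xi> i \<omega> - \<eta> i \<omega>) ` space M)" if "i < m" for i
    using assms that by (intro bounded_minus_comp) (auto simp: simple_integrand_def)
  moreover have "(\<lambda>\<omega>. \<xi> i \<omega> - \<eta> i \<omega>) \<in> borel_measurable (F (\<tau> i))" if "i < m" for i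
    using assms that by (intro borel_measurable_diff) (simp_all add: simple_integrand_def)
  ultimately show ?thesis using assms by (simp add: simple_integrand_def)
qed

end

text \<open>A cell from \<open>p j\<close> to \<open>p (Suc j)\<close> lies in the interval from
  \<open>p a\<close> to \<open>p b\<close> exactly when its right endpoint does, so the indicator
  selects consecutive cells and the sum telescopes.\<close>

lemma telescope_refinement:
  fixes p :: "nat \<Rightarrow> real" and f :: "real \<Rightarrow> real"
  assumes p: "\<And>i j. i < j \<Longrightarrow> j \<le> N \<Longrightarrow> p i < p j" and ab: "a \<le> b" "b \<le> N"
  shows "(\<Sum>j<N. indicator {p a<..p b} (p (Suc j)) * (f (p (Suc j)) - f (p j))) = f (p b) - f (p a)"
proof -
  have pm: "p i < p j \<longleftrightarrow> i < j" "p i \<le> p j \<longleftrightarrow> i \<le> j" if "i \<le> N" "j \<le> N" for i j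
    using p[of i j] p[of j i] that by (cases i j rule: linorder_cases; force)+
  have "(\<Sum>j<N. indicator {p a<..p b} (p (Suc j)) * (f (p (Suc j)) - f (p j))) =
    (\<Sum>j<N. if a \<le> j \<and> j < b then f (p (Suc j)) - f (p j) else 0)"
    using ab by (intro sum.cong refl) (auto simp: pm less_Suc_eq_le)
  also have "\<dots> = (\<Sum>j=a..<b. f (p (Suc j)) - f (p j))"
    using ab by (subst sum.inter_filter[symmetric]) (auto intro!: sum.cong)
  also have "\<dots> = f (p b) - f (p a)"
    using ab by (intro sum_Suc_diff') auto
  finally show ?thesis .
qed

lemma sorted_enumeration:
  fixes P :: "real set"
  assumes "finite P" "P \<noteq> {}"
  obtains p N where "\<And>i j. i < j \<Longrightarrow> j \<le> N \<Longrightarrow> p i < p j" "P = p ` {..N::nat}"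
proof -
  define xs where "xs = sorted_list_of_set P"
  have xs: "sorted xs" "distinct xs" "set xs = P"
    using assms by (auto simp: xs_def)
  then have l: "length xs > 0" using assms by auto
  have "{..length xs - 1} = {..<length xs}"
    using l by (cases xs) (auto simp: lessThan_Suc_atMost)
  then have "P = (!) xs ` {..length xs - 1}"
    using xs by (auto simp: set_conv_nth)
  moreover have "xs ! i < xs ! j" if "i < j" "j \<le> length xs - 1" for i j
  proof -
    have "j < length xs" using that l by linarith
    then show ?thesis
      using that xs sorted_wrt_nth_less[of "(<)" xs i j] by (simp add: strict_sorted_iff)
  qed
  ultimately show thesis using that by metis
qed

context brownian_setting
begin

text \<open>The coefficient on a cell is the value of the process at the right endpoint. It is known
  at the left endpoint: a time \<open>\<tau> i\<close> before \<open>p (Suc j)\<close> is itself a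
  point of \<open>p\<close>, hence at most \<open>p j\<close>.\<close>

lemma simple_integrand_refine:
  assumes s: "simple_integrand M F m \<tau> \<xi>"
    and p: "\<And>i j. i < j \<Longrightarrow> j \<le> N \<Longrightarrow> p i < p j" and P: "\<tau> ` {..m} \<subseteq> p ` {..N::nat}" and p0: "0 \<le> p 0"
  defines "\<eta> \<equiv> \<lambda>j. step_process m \<tau> \<xi> (p (Suc j))"
  shows "simple_integrand M F N p \<eta>"
    and "step_process N p \<eta> u \<omega> = step_process m \<tau> \<xi> u \<omega>"
    and "step_integral B N p \<eta> u \<omega> = step_integral B m \<tau> \<xi> u \<omega>"
proof -
  have pm: "p i < p j \<longleftrightarrow> i < j" "p i \<le> p j \<longleftrightarrow> i \<le> j" if "i \<le> N" "j \<le> N" for i j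
    using p[of i j] p[of j i] that by (cases i j rule: linorder_cases; force)+
  have ex: "\<exists>a. a \<le> N \<and> \<tau> i = p a" if "i \<le> m" for i
    using P that by force
  have tel: "(\<Sum>j<N. indicator {\<tau> i<..\<tau> (Suc i)} (p (Suc j)) * (f (p (Suc j)) - f (p j))) = f (\<tau> (Suc i)) - f (\<tau> i)"
    if i: "i < m" for i and f :: "real \<Rightarrow> real"
  proof -
    obtain a b where ab: "a \<le> N" "b \<le> N" "\<tau> i = p a" "\<tau> (Suc i) = p b"
      using ex[of i] ex[of "Suc i"] i by auto
    moreover have "a \<le> b"
      using simple_integrand_mono[OF s, of i "Suc i"] i ab pm(2)[of a b] by simp
    ultimately show ?thesis using telescope_refinement[OF p] by simp
  qed
  have "\<eta> j \<in> borel_measurable (F (p j))" if j: "j < N" for j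
    unfolding \<eta>_def step_process_def
  proof (intro borel_measurable_sum)
    fix i assume "i \<in> {..<m}"
    then have i: "i < m" by simp
    obtain a where a: "a \<le> N" "\<tau> i = p a" using ex[of i] i by auto
    show "(\<lambda>\<omega>. \<xi> i \<omega> * indicator {\<tau> i<..\<tau> (Suc i)} (p (Suc j))) \<in> borel_measurable (F (p j))"
    proof (cases "\<tau> i < p (Suc j)")
      case True
      then have "\<tau> i \<le> p j" using a pm[of a "Suc j"] pm[of a j] j by simp
      then have "\<xi> i \<in> borel_measurable (F (p j))"
        using s i measurable_F_mono[of "\<tau> i" "p j" "\<xi> i"] by (simp add: simple_integrand_def)
      then show ?thesis by simp
    qed simp
  qed
  moreover have "bounded (\<eta> j ` space M)" for j
  proof -
    obtain K where K: "\<And>i \<omega>. i < m \<Longrightarrow> \<omega> \<in> space M \<Longrightarrow> \<bar>\<xi> i \<omega>\<bar> \<le> K"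
      using simple_integrand_bound[OF s] by metis
    have "\<bar>\<eta> j \<omega>\<bar> \<le> (\<Sum>i<m. K)" if "\<omega> \<in> space M" for \<omega>
      unfolding \<eta>_def step_process_def
      using K that by (intro order_trans[OF sum_abs] sum_mono)
        (auto simp: indicator_def abs_mult intro: order_trans[OF abs_ge_zero])
    then show ?thesis by (auto simp: bounded_iff)
  qed
  moreover have "p j \<le> p (Suc j)" if "j < N" for j
    using pm[of j "Suc j"] that by simp
  ultimately show "simple_integrand M F N p \<eta>"
    using p0 by (simp add: simple_integrand_def)
  have ind: "indicator {x<..y} u = of_bool (x < u) - (of_bool (y < u) :: real)" if "x \<le> y" for x y
    using that by (auto simp: indicator_def)
  \<comment> \<open>Stated for arbitrary \<open>f\<close> to serve twice:
    \<open>f x = B (min x u) \<omega>\<close> yields the integral, and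
    \<open>f x = - of_bool (x < u)\<close> yields the process, since the indicator of a half-open
    interval is a difference of two such values.\<close>
  have swap: "(\<Sum>j<N. (\<Sum>i<m. \<xi> i \<omega> * indicator {\<tau> i<..\<tau> (Suc i)} (p (Suc j))) * (f (p (Suc j)) - f (p j))) =
      (\<Sum>i<m. \<xi> i \<omega> * (f (\<tau> (Suc i)) - f (\<tau> i)))" for f :: "real \<Rightarrow> real"
  proof -
    have "(\<Sum>j<N. (\<Sum>i<m. \<xi> i \<omega> * indicator {\<tau> i<..\<tau> (Suc i)} (p (Suc j))) * (f (p (Suc j)) - f (p j))) =
      (\<Sum>j<N. \<Sum>i<m. \<xi> i \<omega> * (indicator {\<tau> i<..\<tau> (Suc i)} (p (Suc j)) * (f (p (Suc j)) - f (p j))))"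
      unfolding sum_distrib_right by (intro sum.cong refl mult.assoc)
    also have "\<dots> = (\<Sum>i<m. \<Sum>j<N. \<xi> i \<omega> * (indicator {\<tau> i<..\<tau> (Suc i)} (p (Suc j)) * (f (p (Suc j)) - f (p j))))"
      by (rule sum.swap)
    also have "\<dots> = (\<Sum>i<m. \<xi> i \<omega> * (f (\<tau> (Suc i)) - f (\<tau> i)))"
      unfolding sum_distrib_left[symmetric] by (intro sum.cong refl arg_cong2[of _ _ _ _ "(*)"] tel) simp
    finally show ?thesis .
  qed
  show "step_integral B N p \<eta> u \<omega> = step_integral B m \<tau> \<xi> u \<omega>"
    using swap[of "\<lambda>x. B (min x u) \<omega>"] by (simp add: step_integral_def \<eta>_def step_process_def)
  have "step_process N p \<eta> u \<omega> = (\<Sum>j<N. \<eta> j \<omega> * (- of_bool (p (Suc j) < u) - - of_bool (p j < u)))"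
    unfolding step_process_def using pm by (intro sum.cong refl) (simp add: ind)
  also have "\<dots> = (\<Sum>i<m. \<xi> i \<omega> * (- of_bool (\<tau> (Suc i) < u) - - of_bool (\<tau> i < u)))"
    using swap[of "\<lambda>x. - of_bool (x < u)"] by (simp add: \<eta>_def step_process_def)
  also have "\<dots> = step_process m \<tau> \<xi> u \<omega>"
    unfolding step_process_def using s by (intro sum.cong refl) (simp add: ind simple_integrand_def)
  finally show "step_process N p \<eta> u \<omega> = step_process m \<tau> \<xi> u \<omega>" .
qed

text \<open>Two simple processes can be subtracted coefficient by coefficient once they share their
  times; the merged set of times is listed in increasing order.\<close>

lemma common_refinement:
  assumes s1: "simple_integrand M F m1 \<tau>1 \<xi>1" and s2: "simple_integrand M F m2 \<tau>2 \<xi>2"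
  obtains N p \<eta>1 \<eta>2 where
    "simple_integrand M F N p \<eta>1" "simple_integrand M F N p \<eta>2"
    "\<And>u \<omega>. step_process N p \<eta>1 u \<omega> = step_process m1 \<tau>1 \<xi>1 u \<omega>"
    "\<And>u \<omega>. step_process N p \<eta>2 u \<omega> = step_process m2 \<tau>2 \<xi>2 u \<omega>"
    "\<And>u \<omega>. step_integral B N p \<eta>1 u \<omega> = step_integral B m1 \<tau>1 \<xi>1 u \<omega>"
    "\<And>u \<omega>. step_integral B N p \<eta>2 u \<omega> = step_integral B m2 \<tau>2 \<xi>2 u \<omega>"
proof -
  let ?P = "\<tau>1 ` {..m1} \<union> \<tau>2 ` {..m2}"
  obtain p N where p: "\<And>i j. i < j \<Longrightarrow> j \<le> N \<Longrightarrow> p i < p j" and P: "?P = p ` {..N::nat}"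
    by (rule sorted_enumeration[of ?P]) auto
  have "p 0 \<in> ?P" unfolding P by simp
  then have p0: "0 \<le> p 0"
    using simple_integrand_nonneg[OF s1] simple_integrand_nonneg[OF s2] by auto
  have "\<tau>1 ` {..m1} \<subseteq> p ` {..N}" "\<tau>2 ` {..m2} \<subseteq> p ` {..N}"
    unfolding P[symmetric] by auto
  note r = simple_integrand_refine[OF s1 p this(1) p0] simple_integrand_refine[OF s2 p this(2) p0]
  show thesis by (rule that[OF r(1,4,2,5,3,6)])
qed

end

section \<open>Increments of Ito integrals of bounded processes\<close>

text \<open>Values in \<open>ennreal\<close> admit squared distances that may be infinite; real
  sequences enter through their absolute values.\<close>

definition (in prob_space) vanishes_in_prob :: "(nat \<Rightarrow> 'a \<Rightarrow> ennreal) \<Rightarrow> bool" where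
  "vanishes_in_prob f \<longleftrightarrow> (\<forall>e>0. (\<lambda>k. prob {\<omega> \<in> space M. ennreal e < f k \<omega>}) \<longlonglongrightarrow> 0)"

section \<open>Calculus of convergence in probability\<close>

context prob_space
begin

lemma vanishes_in_probD:
  "vanishes_in_prob f \<Longrightarrow> 0 < e \<Longrightarrow> (\<lambda>k. prob {\<omega> \<in> space M. ennreal e < f k \<omega>}) \<longlonglongrightarrow> 0"
  by (simp add: vanishes_in_prob_def)

lemma vanishes_in_prob_mono:
  assumes g: "vanishes_in_prob g" "\<And>k. g k \<in> borel_measurable M"
    and fg: "\<And>k \<omega>. \<omega> \<in> space M \<Longrightarrow> f k \<omega> \<le> g k \<omega>"
  shows "vanishes_in_prob f"
  unfolding vanishes_in_prob_def
proof (intro allI impI)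
  fix e :: real assume "0 < e"
  note [measurable] = g(2)
  show "(\<lambda>k. prob {\<omega> \<in> space M. ennreal e < f k \<omega>}) \<longlonglongrightarrow> 0"
  proof (rule tendsto_sandwich[OF _ _ tendsto_const vanishes_in_probD[OF g(1) \<open>0 < e\<close>]])
    show "\<forall>\<^sub>F k in sequentially. prob {\<omega> \<in> space M. ennreal e < f k \<omega>} \<le> prob {\<omega> \<in> space M. ennreal e < g k \<omega>}"
      by (intro always_eventually allI finite_measure_mono) (use fg in \<open>auto intro: less_le_trans\<close>)
  qed simp
qed

lemma vanishes_in_prob_add:
  assumes f: "vanishes_in_prob f" "\<And>k. f k \<in> borel_measurable M"
    and g: "vanishes_in_prob g" "\<And>k. g k \<in> borel_measurable M"
  shows "vanishes_in_prob (\<lambda>k \<omega>. f k \<omega> + g k \<omega>)"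
  unfolding vanishes_in_prob_def
proof (intro allI impI)
  fix e :: real assume e: "0 < e"
  note [measurable] = f(2) g(2)
  let ?P = "\<lambda>e f k. prob {\<omega> \<in> space M. ennreal e < f k \<omega>}"
  have "(\<lambda>k. ?P (e / 2) f k + ?P (e / 2) g k) \<longlonglongrightarrow> 0 + 0"
    using e by (intro tendsto_add vanishes_in_probD f(1) g(1)) auto
  then have lim: "(\<lambda>k. ?P (e / 2) f k + ?P (e / 2) g k) \<longlonglongrightarrow> 0" by simp
  show "(\<lambda>k. prob {\<omega> \<in> space M. ennreal e < f k \<omega> + g k \<omega>}) \<longlonglongrightarrow> 0"
  proof (rule tendsto_sandwich[OF _ _ tendsto_const lim])
    have "prob {\<omega> \<in> space M. ennreal e < f k \<omega> + g k \<omega>} \<le> ?P (e / 2) f k + ?P (e / 2) g k" for k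
    proof -
      have "a + b \<le> ennreal e" if "a \<le> ennreal (e / 2)" "b \<le> ennreal (e / 2)" for a b
        using add_mono[OF that] e by (simp flip: ennreal_plus)
      then have "{\<omega> \<in> space M. ennreal e < f k \<omega> + g k \<omega>} \<subseteq>
        {\<omega> \<in> space M. ennreal (e / 2) < f k \<omega>} \<union> {\<omega> \<in> space M. ennreal (e / 2) < g k \<omega>}"
        by (force simp: not_less[symmetric])
      then have "prob {\<omega> \<in> space M. ennreal e < f k \<omega> + g k \<omega>} \<le>
        prob ({\<omega> \<in> space M. ennreal (e / 2) < f k \<omega>} \<union> {\<omega> \<in> space M. ennreal (e / 2) < g k \<omega>})"
        by (intro finite_measure_mono) auto
      also have "\<dots> \<le> ?P (e / 2) f k + ?P (e / 2) g k"
        by (rule measure_Un_le) auto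
      finally show ?thesis .
    qed
    then show "\<forall>\<^sub>F k in sequentially. prob {\<omega> \<in> space M. ennreal e < f k \<omega> + g k \<omega>} \<le> ?P (e / 2) f k + ?P (e / 2) g k"
      by simp
  qed simp
qed

text \<open>Bounded convergence: off the set where \<open>f k\<close> exceeds \<open>r / 2\<close>
  the integral is at most \<open>r / 2\<close>, and on it at most \<open>c\<close> times a vanishing
  probability.\<close>

lemma vanishes_in_prob_nn_integral:
  assumes f: "vanishes_in_prob f" "\<And>k. f k \<in> borel_measurable M"
    and c: "\<And>k \<omega>. \<omega> \<in> space M \<Longrightarrow> f k \<omega> \<le> ennreal c" "0 \<le> c"
  shows "(\<lambda>k. \<integral>\<^sup>+\<omega>. f k \<omega> \<partial>M) \<longlonglongrightarrow> 0"
proof (rule tendsto_zero_ennreal)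
  fix r :: real assume r: "0 < r"
  note [measurable] = f(2)
  let ?A = "\<lambda>k. {\<omega> \<in> space M. ennreal (r / 2) < f k \<omega>}"
  have "(\<lambda>k. r / 2 + c * prob (?A k)) \<longlonglongrightarrow> r / 2 + c * 0"
    using r by (intro tendsto_intros vanishes_in_probD[OF f(1)]) auto
  then have "\<forall>\<^sub>F k in sequentially. r / 2 + c * prob (?A k) < r"
    using r by (elim order_tendstoD(2)) auto
  then show "\<forall>\<^sub>F k in sequentially. (\<integral>\<^sup>+\<omega>. f k \<omega> \<partial>M) < ennreal r"
  proof eventually_elim
    case (elim k)
    have "(\<integral>\<^sup>+\<omega>. f k \<omega> \<partial>M) \<le> (\<integral>\<^sup>+\<omega>. ennreal (r / 2) + ennreal c * indicator (?A k) \<omega> \<partial>M)"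
    proof (rule nn_integral_mono)
      fix \<omega> assume "\<omega> \<in> space M"
      then show "f k \<omega> \<le> ennreal (r / 2) + ennreal c * indicator (?A k) \<omega>"
        using c(1)[of \<omega> k] by (cases "ennreal (r / 2) < f k \<omega>")
          (auto intro: order_trans[OF _ add_increasing[OF _ order_refl]] simp: not_less)
    qed
    also have "\<dots> = ennreal (r / 2) + ennreal c * emeasure M (?A k)"
      by (simp add: nn_integral_add nn_integral_cmult emeasure_space_1)
    also have "\<dots> = ennreal (r / 2 + c * prob (?A k))"
      using c r by (simp add: emeasure_eq_measure ennreal_mult)
    also have "\<dots> < ennreal r"
      using elim r c(2) by (intro ennreal_lessI) auto
    finally show ?case .
  qed
qed

end

text \<open>\<open>F t\<close> is coarser than \<open>M\<close>, so progressive measurability gives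
  joint measurability over \<open>M\<close>; the coordinates are swapped to have \<open>M\<close> as
  the first factor in Fubini's theorem.\<close>

lemma (in filtered_prob_space) progressive_joint_measurable:
  assumes H: "progressive_on F t H" and st: "0 \<le> s" "s \<le> t"
  shows "(\<lambda>(\<omega>, u). H u \<omega>) \<in> borel_measurable (M \<Otimes>\<^sub>M lebesgue_on_ivl s t)"
proof -
  have H': "(\<lambda>(s, \<omega>). H s \<omega>) \<in> borel_measurable (restrict_space borel {0..t} \<Otimes>\<^sub>M F t)"
    using H st by (auto simp: progressive_on_def)
  have "(\<lambda>\<omega>. \<omega>) \<in> M \<rightarrow>\<^sub>M F t"
    using subalg[of t] by (auto simp: subalgebra_def intro!: measurableI)
  moreover have "(\<lambda>u. u) \<in> lebesgue_on_ivl s t \<rightarrow>\<^sub>M restrict_space borel {0..t}"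
    using st by (intro measurable_restrict_space2 measurable_restrict_space1) auto
  ultimately have "(\<lambda>p. (snd p, fst p)) \<in> (M \<Otimes>\<^sub>M lebesgue_on_ivl s t) \<rightarrow>\<^sub>M (restrict_space borel {0..t} \<Otimes>\<^sub>M F t)"
    by (intro measurable_Pair measurable_compose[OF measurable_snd] measurable_compose[OF measurable_fst])
  from measurable_compose[OF this H'] show ?thesis
    by (simp add: split_beta')
qed

lemma finite_measure_lebesgue_on_ivl: "finite_measure (lebesgue_on_ivl s t)"
  by (intro finite_measureI) (auto simp: emeasure_restrict_space emeasure_lborel_Icc_eq)

lemma space_lebesgue_on_ivl: "space (lebesgue_on_ivl s t) = {s..t}"
  by (simp add: space_restrict_space)

context brownian_setting
begin

lemma step_process_joint_measurable:
  assumes s: "simple_integrand M F m \<tau> \<xi>"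
  shows "(\<lambda>(\<omega>, u). step_process m \<tau> \<xi> u \<omega>) \<in> borel_measurable (M \<Otimes>\<^sub>M lebesgue_on_ivl s t)"
proof -
  have "(\<lambda>p. \<xi> i (fst p) * indicator {\<tau> i<..\<tau> (Suc i)} (snd p)) \<in> borel_measurable (M \<Otimes>\<^sub>M lebesgue_on_ivl s t)"
    if "i < m" for i
  proof (intro borel_measurable_times)
    have "\<xi> i \<in> borel_measurable M"
      using s that by (auto simp: simple_integrand_def intro: measurable_F_M)
    then show "(\<lambda>p. \<xi> i (fst p)) \<in> borel_measurable (M \<Otimes>\<^sub>M lebesgue_on_ivl s t)" by measurable
    have "(indicator {\<tau> i<..\<tau> (Suc i)} :: real \<Rightarrow> real) \<in> borel_measurable (lebesgue_on_ivl s t)"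
      by (intro measurable_restrict_space1) simp
    then show "(\<lambda>p. indicator {\<tau> i<..\<tau> (Suc i)} (snd p) :: real) \<in> borel_measurable (M \<Otimes>\<^sub>M lebesgue_on_ivl s t)"
      by (rule measurable_compose[OF measurable_snd])
  qed
  then show ?thesis
    unfolding step_process_def split_beta' by (intro borel_measurable_sum) auto
qed

lemma measurable_square_integral:
  assumes "(\<lambda>(\<omega>, u). f u \<omega>) \<in> borel_measurable (M \<Otimes>\<^sub>M lebesgue_on_ivl s t)"
  shows "(\<lambda>\<omega>. \<integral>\<^sup>+u. ennreal ((f u \<omega>)\<^sup>2) \<partial>lebesgue_on_ivl s t) \<in> borel_measurable M"
proof -
  interpret L: finite_measure "lebesgue_on_ivl s t" by (rule finite_measure_lebesgue_on_ivl)
  show ?thesis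
    using assms by (intro L.borel_measurable_nn_integral) (simp add: split_beta')
qed

text \<open>Elementary integrals are continuous in probability with respect to the integrand: in
  \<open>incr_sum_tail_bound\<close> the level \<open>d\<close> is fixed first, making
  \<open>d / e^2\<close> small, and then \<open>k\<close> is taken large.\<close>

lemma incr_sum_vanishes:
  assumes s: "\<And>k. simple_integrand M F (m k) (\<tau> k) (\<xi> k)"
    and Q: "vanishes_in_prob (\<lambda>k \<omega>. ennreal (\<Sum>i<m k. \<xi> k i \<omega> ^ 2 * (\<tau> k (Suc i) - \<tau> k i)))"
  shows "vanishes_in_prob (\<lambda>k \<omega>. ennreal \<bar>incr_sum (\<tau> k) (\<xi> k) (m k) \<omega>\<bar>)"
  unfolding vanishes_in_prob_def
proof (intro allI impI)
  fix e :: real assume e: "0 < e"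
  let ?P = "\<lambda>k. prob {\<omega> \<in> space M. ennreal e < ennreal \<bar>incr_sum (\<tau> k) (\<xi> k) (m k) \<omega>\<bar>}"
  let ?Q = "\<lambda>d k. prob {\<omega> \<in> space M. ennreal d < ennreal (\<Sum>i<m k. \<xi> k i \<omega> ^ 2 * (\<tau> k (Suc i) - \<tau> k i))}"
  have le: "?P k \<le> ?Q d k + d / e\<^sup>2" if "0 < d" for d k
  proof -
    have "0 \<le> (\<Sum>i<m k. \<xi> k i \<omega> ^ 2 * (\<tau> k (Suc i) - \<tau> k i))" for \<omega>
      using s[of k] by (intro sum_nonneg) (simp add: simple_integrand_def)
    then show ?thesis
      using incr_sum_tail_bound[OF s e, of d k] e that by (simp add: ennreal_less_iff)
  qed
  show "?P \<longlonglongrightarrow> 0"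
  proof (rule order_tendstoI)
    fix r :: real assume r: "0 < r"
    define d where "d = e\<^sup>2 * r / 2"
    have d: "0 < d" "d / e\<^sup>2 = r / 2" using e r by (auto simp: d_def)
    have "\<forall>\<^sub>F k in sequentially. ?Q d k < r / 2"
      using order_tendstoD(2)[OF vanishes_in_probD[OF Q d(1)], of "r / 2"] r by simp
    then show "\<forall>\<^sub>F k in sequentially. ?P k < r"
    proof eventually_elim
      case (elim k)
      then show ?case using le[OF d(1), of k] d(2) by linarith
    qed
  qed (use measure_nonneg in \<open>auto intro!: always_eventually intro: less_le_trans\<close>)
qed

end

lemma diff_power4_le: "(a - b) ^ 4 \<le> 8 * (a ^ 4 + b ^ 4 :: real)"
proof -
  have "(a - b)\<^sup>2 \<le> 2 * (a\<^sup>2 + b\<^sup>2)"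
    using zero_le_power2[of "a + b"] by (simp add: power2_eq_square algebra_simps)
  then have "((a - b)\<^sup>2)\<^sup>2 \<le> (2 * (a\<^sup>2 + b\<^sup>2))\<^sup>2"
    by (intro power_mono) auto
  also have "\<dots> \<le> 8 * ((a\<^sup>2)\<^sup>2 + (b\<^sup>2)\<^sup>2)"
    using zero_le_power2[of "a\<^sup>2 - b\<^sup>2"] by (simp add: power2_eq_square algebra_simps)
  finally show ?thesis by (simp flip: power_mult)
qed

text \<open>Small values cost \<open>e^2\<close>, medium ones \<open>R^2\<close> times an indicator,
  and large ones are dominated by the fourth power. After integration it is the indicator term to
  which convergence in probability applies.\<close>

lemma square_le_truncation:
  fixes x :: real
  assumes "0 < R"
  shows "x\<^sup>2 \<le> e\<^sup>2 + R\<^sup>2 * of_bool (e < \<bar>x\<bar>) + x ^ 4 / R\<^sup>2"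
proof -
  have 4: "0 \<le> x ^ 4 / R\<^sup>2" by simp
  consider "\<bar>x\<bar> \<le> e" | "e < \<bar>x\<bar>" "\<bar>x\<bar> \<le> R" | "e < \<bar>x\<bar>" "R < \<bar>x\<bar>" by linarith
  then show ?thesis
  proof cases
    case 1
    then have "x\<^sup>2 \<le> e\<^sup>2" by (simp flip: abs_le_square_iff)
    then show ?thesis using 4 1 by (intro order_trans[OF \<open>x\<^sup>2 \<le> e\<^sup>2\<close>]) simp
  next
    case 2
    then have "x\<^sup>2 \<le> R\<^sup>2" by (simp flip: abs_le_square_iff)
    then have "x\<^sup>2 \<le> e\<^sup>2 + R\<^sup>2 * 1 + x ^ 4 / R\<^sup>2"
      using 4 zero_le_power2[of e] by linarith
    then show ?thesis using 2 by simp
  next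
    case 3
    then have "R\<^sup>2 \<le> x\<^sup>2" using assms by (simp flip: abs_le_square_iff)
    then have "x\<^sup>2 * R\<^sup>2 \<le> x\<^sup>2 * x\<^sup>2" by (intro mult_left_mono) auto
    then have "x\<^sup>2 \<le> x ^ 4 / R\<^sup>2"
      using assms by (simp add: field_simps power4_eq_xxxx power2_eq_square)
    then have "x\<^sup>2 \<le> e\<^sup>2 + R\<^sup>2 * 1 + x ^ 4 / R\<^sup>2"
      using zero_le_power2[of e] zero_le_power2[of R] by linarith
    then show ?thesis using 3 by simp
  qed
qed

section \<open>From convergence in probability to convergence in mean square\<close>

context prob_space
begin

text \<open>Capping the distance at \<open>1\<close> turns convergence in probability into
  convergence in mean, which has an almost surely convergent subsequence; near the limit the cap is
  inactive.\<close>

lemma vanishes_in_prob_AE_subseq: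
  assumes S: "\<And>k. S k \<in> borel_measurable M" and D: "D \<in> borel_measurable M"
    and v: "vanishes_in_prob (\<lambda>k \<omega>. ennreal \<bar>S k \<omega> - D \<omega>\<bar>)"
  obtains r where "strict_mono (r :: nat \<Rightarrow> nat)" "AE \<omega> in M. (\<lambda>k. S (r k) \<omega>) \<longlonglongrightarrow> D \<omega>"
proof -
  note [measurable] = S D
  define f where "f k \<omega> = min 1 \<bar>S k \<omega> - D \<omega>\<bar>" for k \<omega>
  have mf [measurable]: "f k \<in> borel_measurable M" for k unfolding f_def by measurable
  have f01: "0 \<le> f k \<omega>" "f k \<omega> \<le> 1" for k \<omega> by (auto simp: f_def)
  have int: "integrable M (f k)" for k
    using f01 mf by (intro integrable_const_bound[of _ 1]) auto
  have "vanishes_in_prob (\<lambda>k \<omega>. ennreal (f k \<omega>))"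
    by (rule vanishes_in_prob_mono[OF v]) (auto simp: f_def intro!: ennreal_leI)
  then have "(\<lambda>k. \<integral>\<^sup>+\<omega>. ennreal (f k \<omega>) \<partial>M) \<longlonglongrightarrow> 0"
    by (rule vanishes_in_prob_nn_integral[where c = 1]) (use f01 in \<open>auto intro: ennreal_leI\<close>)
  moreover have "(\<integral>\<^sup>+\<omega>. ennreal (f k \<omega>) \<partial>M) = ennreal (expectation (\<lambda>\<omega>. norm (f k \<omega>)))" for k
    using f01 int by (subst nn_integral_eq_integral) auto
  ultimately have "(\<lambda>k. ennreal (expectation (\<lambda>\<omega>. norm (f k \<omega>)))) \<longlonglongrightarrow> 0"
    by simp
  then have "(\<lambda>k. expectation (\<lambda>\<omega>. norm (f k \<omega>))) \<longlonglongrightarrow> 0"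
    by (subst (asm) ennreal_tendsto_0_iff) (auto intro!: integral_nonneg_AE)
  from tendsto_L1_AE_subseq[OF int this] obtain r
    where r: "strict_mono r" "AE \<omega> in M. (\<lambda>k. f (r k) \<omega>) \<longlonglongrightarrow> 0" by blast
  from r(2) have "AE \<omega> in M. (\<lambda>k. S (r k) \<omega>) \<longlonglongrightarrow> D \<omega>"
  proof eventually_elim
    case (elim \<omega>)
    then have "\<forall>\<^sub>F k in sequentially. f (r k) \<omega> < 1"
      by (rule order_tendstoD) simp
    then have "\<forall>\<^sub>F k in sequentially. f (r k) \<omega> = \<bar>S (r k) \<omega> - D \<omega>\<bar>"
      by eventually_elim (simp add: f_def min_def split: if_splits)
    with elim have "(\<lambda>k. \<bar>S (r k) \<omega> - D \<omega>\<bar>) \<longlonglongrightarrow> 0"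
      by (simp cong: tendsto_cong)
    then show ?case
      by (simp add: tendsto_rabs_zero_iff LIM_zero_iff)
  qed
  with r(1) that show thesis by blast
qed

text \<open>Fatou's lemma along an almost surely convergent subsequence carries the fourth moment
  bound over to \<open>D\<close>. The differences then have fourth moments at most
  \<open>16 * C\<close>, and truncation gives mean square convergence of the whole sequence.\<close>

lemma fourth_moment_limit:
  assumes S: "\<And>k. S k \<in> borel_measurable M" and D: "D \<in> borel_measurable M"
    and v: "vanishes_in_prob (\<lambda>k \<omega>. ennreal \<bar>S k \<omega> - D \<omega>\<bar>)"
    and int: "\<And>k. integrable M (\<lambda>\<omega>. S k \<omega> ^ 4)" and C: "\<And>k. expectation (\<lambda>\<omega>. S k \<omega> ^ 4) \<le> C"
  shows "integrable M (\<lambda>\<omega>. D \<omega> ^ 4)" and "expectation (\<lambda>\<omega>. D \<omega> ^ 4) \<le> C"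
    and "(\<lambda>k. expectation (\<lambda>\<omega>. (S k \<omega> - D \<omega>)\<^sup>2)) \<longlonglongrightarrow> 0"
proof -
  note [measurable] = S D
  obtain r where r: "AE \<omega> in M. (\<lambda>k. S (r k) \<omega>) \<longlonglongrightarrow> D \<omega>"
    using vanishes_in_prob_AE_subseq[OF S D v] by blast
  have C0: "0 \<le> C"
    using order_trans[OF _ C[of 0]] by (simp add: integral_nonneg_AE)
  have "(\<integral>\<^sup>+\<omega>. ennreal (D \<omega> ^ 4) \<partial>M) = (\<integral>\<^sup>+\<omega>. liminf (\<lambda>k. ennreal (S (r k) \<omega> ^ 4)) \<partial>M)"
  proof (rule nn_integral_cong_AE, use r in eventually_elim)
    case (elim \<omega>)
    then have "(\<lambda>k. ennreal (S (r k) \<omega> ^ 4)) \<longlonglongrightarrow> ennreal (D \<omega> ^ 4)"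
      by (intro tendsto_ennrealI tendsto_power)
    from lim_imp_Liminf[OF _ this] show ?case by simp
  qed
  also have "\<dots> \<le> liminf (\<lambda>k. \<integral>\<^sup>+\<omega>. ennreal (S (r k) \<omega> ^ 4) \<partial>M)"
    by (rule nn_integral_liminf) measurable
  also have "\<dots> \<le> limsup (\<lambda>k. \<integral>\<^sup>+\<omega>. ennreal (S (r k) \<omega> ^ 4) \<partial>M)"
    by (rule Liminf_le_Limsup) simp
  also have "\<dots> \<le> ennreal C"
    by (intro Limsup_bounded always_eventually allI)
      (use int C in \<open>simp add: nn_integral_eq_integral ennreal_leI\<close>)
  finally have le: "(\<integral>\<^sup>+\<omega>. ennreal (D \<omega> ^ 4) \<partial>M) \<le> ennreal C" .
  show iD: "integrable M (\<lambda>\<omega>. D \<omega> ^ 4)"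
    by (rule integrableI_bounded) (use le in \<open>auto simp: abs_of_nonneg intro: le_less_trans\<close>)
  from le show ED: "expectation (\<lambda>\<omega>. D \<omega> ^ 4) \<le> C"
    using C0 iD by (simp add: nn_integral_eq_integral)
  have i4: "integrable M (\<lambda>\<omega>. (S k \<omega> - D \<omega>) ^ 4)" for k
  proof (rule Bochner_Integration.integrable_bound)
    show "integrable M (\<lambda>\<omega>. 8 * (S k \<omega> ^ 4 + D \<omega> ^ 4))" using int iD by simp
    show "AE \<omega> in M. norm ((S k \<omega> - D \<omega>) ^ 4) \<le> norm (8 * (S k \<omega> ^ 4 + D \<omega> ^ 4))"
      using diff_power4_le by (auto simp: abs_of_nonneg)
  qed measurable
  have E4: "expectation (\<lambda>\<omega>. (S k \<omega> - D \<omega>) ^ 4) \<le> 16 * C" for k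
  proof -
    have "expectation (\<lambda>\<omega>. (S k \<omega> - D \<omega>) ^ 4) \<le> expectation (\<lambda>\<omega>. 8 * (S k \<omega> ^ 4 + D \<omega> ^ 4))"
      using i4 int iD diff_power4_le by (intro integral_mono) auto
    also have "\<dots> = 8 * (expectation (\<lambda>\<omega>. S k \<omega> ^ 4) + expectation (\<lambda>\<omega>. D \<omega> ^ 4))"
      using int iD by simp
    also have "\<dots> \<le> 16 * C"
      using C[of k] ED by simp
    finally show ?thesis .
  qed
  show "(\<lambda>k. expectation (\<lambda>\<omega>. (S k \<omega> - D \<omega>)\<^sup>2)) \<longlonglongrightarrow> 0"
  proof (rule order_tendstoI)
    fix a :: real assume a: "0 < a"
    \<comment> \<open>Each of the three parts of the truncation is to be at most
      \<open>a / 4\<close>: hence \<open>16 * C / R^2 <= a / 4\<close> and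
      \<open>e^2 = a / 4\<close>. The summand \<open>1\<close> keeps \<open>R\<close> positive when
      \<open>C = 0\<close>.\<close>
    define R where "R = sqrt (64 * C / a + 1)"
    define e where "e = sqrt (a / 4)"
    have R: "0 < R" "R\<^sup>2 = 64 * C / a + 1" using C0 a by (auto simp: R_def add_nonneg_pos)
    have e: "0 < e" "e\<^sup>2 = a / 4" using a by (auto simp: e_def)
    have "16 * C / R\<^sup>2 \<le> a / 4"
      using R(1) a C0 unfolding R(2) by (simp add: field_simps)
    let ?P = "\<lambda>k. prob {\<omega> \<in> space M. ennreal e < ennreal \<bar>S k \<omega> - D \<omega>\<bar>}"
    have "(\<lambda>k. R\<^sup>2 * ?P k) \<longlonglongrightarrow> R\<^sup>2 * 0"
      by (intro tendsto_intros vanishes_in_probD[OF v e(1)])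
    then have "\<forall>\<^sub>F k in sequentially. R\<^sup>2 * ?P k < a / 4"
      using a by (elim order_tendstoD(2)) auto
    then show "\<forall>\<^sub>F k in sequentially. expectation (\<lambda>\<omega>. (S k \<omega> - D \<omega>)\<^sup>2) < a"
    proof eventually_elim
      case (elim k)
      let ?A = "{\<omega> \<in> space M. e < \<bar>S k \<omega> - D \<omega>\<bar>}"
      have mA: "?A \<in> sets M" by measurable
      have iA: "integrable M (indicator ?A :: 'a \<Rightarrow> real)"
        by (rule integrable_const_bound[of _ 1]) (auto simp: indicator_def)
      have EA: "expectation (indicator ?A) = prob ?A"
        using mA by (simp add: Int_absorb2[OF sets.sets_into_space])
      have "expectation (\<lambda>\<omega>. (S k \<omega> - D \<omega>)\<^sup>2) \<le>
        expectation (\<lambda>\<omega>. e\<^sup>2 + R\<^sup>2 * indicator ?A \<omega> + (S k \<omega> - D \<omega>) ^ 4 / R\<^sup>2)"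
      proof (rule integral_mono)
        show "integrable M (\<lambda>\<omega>. (S k \<omega> - D \<omega>)\<^sup>2)"
          by (rule integrable_power_le_4[OF _ i4]) auto
        show "integrable M (\<lambda>\<omega>. e\<^sup>2 + R\<^sup>2 * indicator ?A \<omega> + (S k \<omega> - D \<omega>) ^ 4 / R\<^sup>2)"
          using i4 iA by (intro Bochner_Integration.integrable_add integrable_mult_right) auto
        show "(S k \<omega> - D \<omega>)\<^sup>2 \<le> e\<^sup>2 + R\<^sup>2 * indicator ?A \<omega> + (S k \<omega> - D \<omega>) ^ 4 / R\<^sup>2"
          if "\<omega> \<in> space M" for \<omega>
          using square_le_truncation[OF R(1), of "S k \<omega> - D \<omega>" e] that by (simp add: indicator_def of_bool_def)
      qed
      also have "\<dots> = e\<^sup>2 + R\<^sup>2 * prob ?A + expectation (\<lambda>\<omega>. (S k \<omega> - D \<omega>) ^ 4) / R\<^sup>2"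
        using i4[of k] iA EA by (simp add: prob_space del: integral_indicator)
      also have "\<dots> \<le> a / 4 + a / 4 + a / 4"
      proof (intro add_mono)
        show "R\<^sup>2 * prob ?A \<le> a / 4"
          using elim e(1) by (simp add: ennreal_less_iff)
        show "expectation (\<lambda>\<omega>. (S k \<omega> - D \<omega>) ^ 4) / R\<^sup>2 \<le> a / 4"
          using E4[of k] \<open>16 * C / R\<^sup>2 \<le> a / 4\<close> R(1)
          by (meson divide_right_mono order_trans zero_le_power2)
      qed (simp add: e(2))
      also have "\<dots> < a" using a by simp
      finally show ?case .
    qed
  next
    fix a :: real assume "a < 0"
    then show "\<forall>\<^sub>F k in sequentially. a < expectation (\<lambda>\<omega>. (S k \<omega> - D \<omega>)\<^sup>2)"
      by (intro always_eventually allI less_le_trans[OF _ integral_nonneg_AE]) auto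
  qed
qed

end

text \<open>The identities for clamped step processes hold for \<open>s < u\<close> and
  \<open>u <= t\<close>; the missing endpoint is a null set.\<close>

lemma AE_lebesgue_on_ivl: "AE u in lebesgue_on_ivl s t. s < u \<and> u \<le> t"
  using AE_lborel_singleton[of s] by (subst AE_restrict_space_iff) auto

lemma nn_integral_lebesgue_on_ivl_mono:
  assumes "s' \<le> s" "t \<le> t'"
  shows "(\<integral>\<^sup>+u. f u \<partial>lebesgue_on_ivl s t) \<le> (\<integral>\<^sup>+u. f u \<partial>lebesgue_on_ivl s' t')"
proof -
  have "f u * indicator {s..t} u \<le> f u * indicator {s'..t'} u" for u
    using assms by (cases "u \<in> {s..t}") auto
  then show ?thesis
    by (simp add: nn_integral_restrict_space nn_integral_mono)
qed

section \<open>Approximating sequences on common partitions\<close>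

context brownian_setting
begin

lemma step_integral_measurable:
  assumes s: "simple_integrand M F m \<tau> \<xi>" and u: "0 \<le> u"
  shows "step_integral B m \<tau> \<xi> u \<in> borel_measurable M"
  unfolding step_integral_def[abs_def]
proof (intro borel_measurable_sum borel_measurable_times borel_measurable_diff)
  fix i assume "i \<in> {..<m}"
  then show "\<xi> i \<in> borel_measurable M" "B (min (\<tau> (Suc i)) u) \<in> borel_measurable M"
    "B (min (\<tau> i) u) \<in> borel_measurable M"
    using s u simple_integrand_nonneg[OF s, of i] simple_integrand_nonneg[OF s, of "Suc i"]
    by (auto simp: simple_integrand_def intro: measurable_F_M B_measurable_M)
qed

lemma step_integral_at_0:
  assumes s: "simple_integrand M F m \<tau> \<xi>"
  shows "step_integral B m \<tau> \<zeta> 0 \<omega> = 0"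
  unfolding step_integral_def
proof (intro sum.neutral ballI)
  fix i assume "i \<in> {..<m}"
  then have "min (\<tau> i) 0 = 0" "min (\<tau> (Suc i)) 0 = 0"
    using simple_integrand_nonneg[OF s, of i] simple_integrand_nonneg[OF s, of "Suc i"] by auto
  then show "\<zeta> i \<omega> * (B (min (\<tau> (Suc i)) 0) \<omega> - B (min (\<tau> i) 0) \<omega>) = 0" by simp
qed

lemma incr_sum_diff:
  "incr_sum \<tau> (\<lambda>i \<omega>. \<xi> i \<omega> - \<eta> i \<omega>) m \<omega> = incr_sum \<tau> \<xi> m \<omega> - incr_sum \<tau> \<eta> m \<omega>"
  by (simp add: incr_sum_def left_diff_distrib sum_subtractf)

lemma has_ito_integral_approx:
  assumes J: "has_ito_integral M F B H t J" and t: "0 \<le> t"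
  obtains m \<tau> \<xi> where "\<And>k. simple_integrand M F (m k) (\<tau> k) (\<xi> k)"
    "vanishes_in_prob (\<lambda>k \<omega>. sq_err 0 t H (m k) (\<tau> k) (\<xi> k) \<omega>)"
    "vanishes_in_prob (\<lambda>k \<omega>. ennreal \<bar>step_integral B (m k) (\<tau> k) (\<xi> k) t \<omega> - J \<omega>\<bar>)"
proof -
  obtain m \<tau> \<xi> where s: "\<And>k. simple_integrand M F (m k) (\<tau> k) (\<xi> k)"
    and H: "\<And>e. 0 < e \<Longrightarrow> (\<lambda>k. measure M {\<omega> \<in> space M.
         ennreal e < (\<integral>\<^sup>+s\<in>{0..t}. ennreal ((H s \<omega> - step_process (m k) (\<tau> k) (\<xi> k) s \<omega>)\<^sup>2) \<partial>lborel)})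
         \<longlonglongrightarrow> 0"
    and I: "\<And>e. 0 < e \<Longrightarrow> (\<lambda>k. measure M {\<omega> \<in> space M.
         e < \<bar>step_integral B (m k) (\<tau> k) (\<xi> k) t \<omega> - J \<omega>\<bar>}) \<longlonglongrightarrow> 0"
    using J unfolding has_ito_integral_def by blast
  show thesis
  proof (rule that[OF s])
    show "vanishes_in_prob (\<lambda>k \<omega>. sq_err 0 t H (m k) (\<tau> k) (\<xi> k) \<omega>)"
      using H by (simp add: vanishes_in_prob_def nn_integral_restrict_space)
    show "vanishes_in_prob (\<lambda>k \<omega>. ennreal \<bar>step_integral B (m k) (\<tau> k) (\<xi> k) t \<omega> - J \<omega>\<bar>)"
      using I by (simp add: vanishes_in_prob_def ennreal_less_iff)
  qed
qed

lemma has_ito_integral_approx2: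
  assumes J1: "has_ito_integral M F B H1 t1 J1" and t1: "0 \<le> t1"
    and J2: "has_ito_integral M F B H2 t2 J2" and t2: "0 \<le> t2"
  obtains m \<tau> \<xi> \<eta> where "\<And>k. simple_integrand M F (m k) (\<tau> k) (\<xi> k)"
    "\<And>k. simple_integrand M F (m k) (\<tau> k) (\<eta> k)"
    "vanishes_in_prob (\<lambda>k \<omega>. sq_err 0 t1 H1 (m k) (\<tau> k) (\<xi> k) \<omega>)"
    "vanishes_in_prob (\<lambda>k \<omega>. sq_err 0 t2 H2 (m k) (\<tau> k) (\<eta> k) \<omega>)"
    "vanishes_in_prob (\<lambda>k \<omega>. ennreal \<bar>step_integral B (m k) (\<tau> k) (\<xi> k) t1 \<omega> - J1 \<omega>\<bar>)"
    "vanishes_in_prob (\<lambda>k \<omega>. ennreal \<bar>step_integral B (m k) (\<tau> k) (\<eta> k) t2 \<omega> - J2 \<omega>\<bar>)"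
proof -
  obtain m1 \<tau>1 \<xi>1 where 1: "\<And>k. simple_integrand M F (m1 k) (\<tau>1 k) (\<xi>1 k)"
    "vanishes_in_prob (\<lambda>k \<omega>. sq_err 0 t1 H1 (m1 k) (\<tau>1 k) (\<xi>1 k) \<omega>)"
    "vanishes_in_prob (\<lambda>k \<omega>. ennreal \<bar>step_integral B (m1 k) (\<tau>1 k) (\<xi>1 k) t1 \<omega> - J1 \<omega>\<bar>)"
    using has_ito_integral_approx[OF J1 t1] by blast
  obtain m2 \<tau>2 \<xi>2 where 2: "\<And>k. simple_integrand M F (m2 k) (\<tau>2 k) (\<xi>2 k)"
    "vanishes_in_prob (\<lambda>k \<omega>. sq_err 0 t2 H2 (m2 k) (\<tau>2 k) (\<xi>2 k) \<omega>)"
    "vanishes_in_prob (\<lambda>k \<omega>. ennreal \<bar>step_integral B (m2 k) (\<tau>2 k) (\<xi>2 k) t2 \<omega> - J2 \<omega>\<bar>)"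
    using has_ito_integral_approx[OF J2 t2] by blast
  have "\<exists>N p \<eta>1 \<eta>2. simple_integrand M F N p \<eta>1 \<and> simple_integrand M F N p \<eta>2 \<and>
    (\<forall>u \<omega>. step_process N p \<eta>1 u \<omega> = step_process (m1 k) (\<tau>1 k) (\<xi>1 k) u \<omega> \<and>
      step_process N p \<eta>2 u \<omega> = step_process (m2 k) (\<tau>2 k) (\<xi>2 k) u \<omega> \<and>
      step_integral B N p \<eta>1 u \<omega> = step_integral B (m1 k) (\<tau>1 k) (\<xi>1 k) u \<omega> \<and>
      step_integral B N p \<eta>2 u \<omega> = step_integral B (m2 k) (\<tau>2 k) (\<xi>2 k) u \<omega>)" for k
    by (rule common_refinement[OF 1(1)[of k] 2(1)[of k]]) blast
  then obtain N p \<eta>1 \<eta>2 where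
    s: "\<And>k. simple_integrand M F (N k) (p k) (\<eta>1 k)" "\<And>k. simple_integrand M F (N k) (p k) (\<eta>2 k)"
    and eq: "\<And>k u \<omega>. step_process (N k) (p k) (\<eta>1 k) u \<omega> = step_process (m1 k) (\<tau>1 k) (\<xi>1 k) u \<omega>"
      "\<And>k u \<omega>. step_process (N k) (p k) (\<eta>2 k) u \<omega> = step_process (m2 k) (\<tau>2 k) (\<xi>2 k) u \<omega>"
      "\<And>k u \<omega>. step_integral B (N k) (p k) (\<eta>1 k) u \<omega> = step_integral B (m1 k) (\<tau>1 k) (\<xi>1 k) u \<omega>"
      "\<And>k u \<omega>. step_integral B (N k) (p k) (\<eta>2 k) u \<omega> = step_integral B (m2 k) (\<tau>2 k) (\<xi>2 k) u \<omega>"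
    by metis
  show thesis
    by (rule that[of N p \<eta>1 \<eta>2]) (simp_all add: s eq 1 2)
qed

end

text \<open>Applied with \<open>Y\<close> the difference of the two solutions and \<open>H\<close>
  the difference of their coefficients. Each \<open>Y t\<close> is a version of the integral up to
  \<open>t\<close>; continuity of paths is assumed separately where the supremum is taken.\<close>

locale bounded_ito_process = brownian_setting M F B
  for M :: "'a measure" and F :: "real \<Rightarrow> 'a measure" and B :: "real \<Rightarrow> 'a \<Rightarrow> real" +
  fixes T K :: real and H Y :: "real \<Rightarrow> 'a \<Rightarrow> real"
  assumes T_pos: "0 < T"
    and Y_adapted: "\<And>t. t \<in> {0..T} \<Longrightarrow> Y t \<in> borel_measurable (F t)"
    and Y_ito: "\<And>t. t \<in> {0..T} \<Longrightarrow> has_ito_integral M F B H t (Y t)"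
    and H_bound: "\<And>u \<omega>. u \<in> {0..T} \<Longrightarrow> \<omega> \<in> space M \<Longrightarrow> \<bar>H u \<omega>\<bar> \<le> K"
begin

lemma K_nonneg: "0 \<le> K"
proof -
  obtain \<omega>0 where "\<omega>0 \<in> space M" using not_empty by blast
  then show ?thesis using H_bound[of 0 \<omega>0] T_pos by simp
qed

lemma Y_measurable: "t \<in> {0..T} \<Longrightarrow> Y t \<in> borel_measurable M"
  by (rule measurable_F_M[OF Y_adapted])

lemma H_joint_measurable:
  assumes "0 \<le> s" "s \<le> t" "t \<le> T"
  shows "(\<lambda>(\<omega>, u). H u \<omega>) \<in> borel_measurable (M \<Otimes>\<^sub>M lebesgue_on_ivl s t)"
  using assms Y_ito[of t] by (intro progressive_joint_measurable) (auto simp: has_ito_integral_def)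

lemma increment_measurable:
  assumes "0 \<le> s" "s \<le> t" "t \<le> T"
  shows "(\<lambda>\<omega>. Y t \<omega> - Y s \<omega>) \<in> borel_measurable M"
  using assms by (intro borel_measurable_diff Y_measurable) auto

text \<open>The approximations that define \<open>Y s\<close> and \<open>Y t\<close> are unrelated. They are compared on a common
  refinement, where the tail bound for \<^const>\<open>incr_sum\<close> shows that their integrals up to \<open>s\<close> have the
  same limit. Clipping the coefficients to \<open>[-K, K]\<close> does not increase the distance to \<open>H\<close>.\<close>

lemma increment_approx:
  assumes st: "0 \<le> s" "s \<le> t" and tT: "t \<le> T"
  obtains m \<tau> \<xi> where "\<And>k. simple_integrand M F (m k) (\<tau> k) (\<xi> k)"
    "\<And>k i. i \<le> m k \<Longrightarrow> s \<le> \<tau> k i \<and> \<tau> k i \<le> t"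
    "\<And>k i \<omega>. \<bar>\<xi> k i \<omega>\<bar> \<le> K"
    "vanishes_in_prob (\<lambda>k \<omega>. ennreal \<bar>incr_sum (\<tau> k) (\<xi> k) (m k) \<omega> - (Y t \<omega> - Y s \<omega>)\<bar>)"
    "(\<lambda>k. \<integral>\<^sup>+\<omega>. sq_err s t H (m k) (\<tau> k) (\<xi> k) \<omega> \<partial>M) \<longlonglongrightarrow> 0"
proof -
  have t: "0 \<le> t" using st by simp
  have K: "\<bar>H u \<omega>\<bar> \<le> K" if "0 \<le> u" "u \<le> t" "\<omega> \<in> space M" for u \<omega>
    using that tT by (intro H_bound) auto
  have Jt: "has_ito_integral M F B H t (Y t)" and Js: "has_ito_integral M F B H s (Y s)"
    using st tT by (auto intro!: Y_ito)
  obtain m \<tau> a b where a: "\<And>k. simple_integrand M F (m k) (\<tau> k) (a k)"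
    and b: "\<And>k. simple_integrand M F (m k) (\<tau> k) (b k)"
    and Ha: "vanishes_in_prob (\<lambda>k \<omega>. sq_err 0 t H (m k) (\<tau> k) (a k) \<omega>)"
    and Hb: "vanishes_in_prob (\<lambda>k \<omega>. sq_err 0 s H (m k) (\<tau> k) (b k) \<omega>)"
    and Ia: "vanishes_in_prob (\<lambda>k \<omega>. ennreal \<bar>step_integral B (m k) (\<tau> k) (a k) t \<omega> - Y t \<omega>\<bar>)"
    and Ib: "vanishes_in_prob (\<lambda>k \<omega>. ennreal \<bar>step_integral B (m k) (\<tau> k) (b k) s \<omega> - Y s \<omega>\<bar>)"
    using has_ito_integral_approx2[OF Jt t Js st(1)] by blast
  have mJ [measurable]: "Y t \<in> borel_measurable M" "Y s \<in> borel_measurable M"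
    using st tT by (auto intro!: Y_measurable)
  have mH: "(\<lambda>(\<omega>, u). H u \<omega>) \<in> borel_measurable (M \<Otimes>\<^sub>M lebesgue_on_ivl r q)" if "0 \<le> r" "r \<le> q" "q \<le> t" for r q
    using that tT by (intro H_joint_measurable) auto
  have mD: "(\<lambda>(\<omega>, u). H u \<omega> - step_process m' \<tau>' \<xi>' u \<omega>) \<in> borel_measurable (M \<Otimes>\<^sub>M lebesgue_on_ivl r q)"
    if "simple_integrand M F m' \<tau>' \<xi>'" "0 \<le> r" "r \<le> q" "q \<le> t" for m' \<tau>' \<xi>' r q
    using borel_measurable_diff[OF mH[OF that(2-4)] step_process_joint_measurable[OF that(1), of r q]]
    unfolding split_beta' .
  have mD1: "(\<lambda>u. H u \<omega> - step_process m' \<tau>' \<xi>' u \<omega>) \<in> borel_measurable (lebesgue_on_ivl r q)"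
    if "simple_integrand M F m' \<tau>' \<xi>'" "0 \<le> r" "r \<le> q" "q \<le> t" "\<omega> \<in> space M" for m' \<tau>' \<xi>' r q \<omega>
    using measurable_compose_Pair1[OF that(5) mD[OF that(1-4)]] unfolding prod.case .
  have mE: "(\<lambda>\<omega>. sq_err r q H m' \<tau>' \<xi>' \<omega>) \<in> borel_measurable M"
    if "simple_integrand M F m' \<tau>' \<xi>'" "0 \<le> r" "r \<le> q" "q \<le> t" for m' \<tau>' \<xi>' r q
    by (rule measurable_square_integral) (rule mD[OF that])

  let ?err = "\<lambda>x k r q \<omega>. sq_err r q H (m k) (\<tau> k) (x k) \<omega>"

  define \<sigma> where "\<sigma> = (\<lambda>k i. max 0 (min s (\<tau> k i)))"
  \<comment> \<open>\<open>g\<close> is the difference of the two approximants up to time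
    \<open>s\<close>. Both are close to \<open>H\<close> there, so \<open>V1\<close> will show that
    their integrals up to \<open>s\<close> merge.\<close>
  define g where "g = (\<lambda>k i \<omega>. if \<tau> k i \<le> s then a k i \<omega> - b k i \<omega> else 0)"
  have g_simple: "simple_integrand M F (m k) (\<sigma> k) (g k)" for k
    unfolding \<sigma>_def g_def by (rule simple_integrand_clamp(1)[OF simple_integrand_diff[OF a[of k] b[of k]] order_refl st(1)])
  have z: "step_integral B (m k) (\<tau> k) \<zeta> 0 \<omega> = 0" for k \<zeta> \<omega>
    by (rule step_integral_at_0[OF a])
  have g_sum: "incr_sum (\<sigma> k) (g k) (m k) \<omega> =
     step_integral B (m k) (\<tau> k) (a k) s \<omega> - step_integral B (m k) (\<tau> k) (b k) s \<omega>" for k \<omega>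
    using simple_integrand_clamp(2)[OF simple_integrand_diff[OF a[of k] b[of k]] order_refl st(1), of \<omega>]
    by (simp add: \<sigma>_def g_def step_integral_diff z)
  have g_proc: "step_process (m k) (\<sigma> k) (g k) u \<omega> =
     step_process (m k) (\<tau> k) (a k) u \<omega> - step_process (m k) (\<tau> k) (b k) u \<omega>" if "0 < u" "u \<le> s" for k u \<omega>
    using simple_integrand_clamp(3)[OF simple_integrand_diff[OF a[of k] b[of k]] order_refl st(1) that, of \<omega>]
    by (simp add: \<sigma>_def g_def step_process_diff)
  have "vanishes_in_prob (\<lambda>k \<omega>. ennreal (\<Sum>i<m k. g k i \<omega> ^ 2 * (\<sigma> k (Suc i) - \<sigma> k i)))"
  proof (rule vanishes_in_prob_mono)
    show "vanishes_in_prob (\<lambda>k \<omega>. (?err a k 0 t \<omega> + ?err a k 0 t \<omega>) + (?err b k 0 s \<omega> + ?err b k 0 s \<omega>))"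
      using st by (intro vanishes_in_prob_add borel_measurable_add mE Ha Hb a b) auto
    show "(\<lambda>\<omega>. (?err a k 0 t \<omega> + ?err a k 0 t \<omega>) + (?err b k 0 s \<omega> + ?err b k 0 s \<omega>)) \<in> borel_measurable M" for k
      using st by (intro borel_measurable_add mE a b) auto
    fix k \<omega> assume \<omega>: "\<omega> \<in> space M"
    note [measurable] = mD1[OF a order_refl st(1) st(2) \<omega>, of k] mD1[OF b order_refl st(1) st(2) \<omega>, of k]
    have "ennreal (\<Sum>i<m k. g k i \<omega> ^ 2 * (\<sigma> k (Suc i) - \<sigma> k i)) =
      (\<integral>\<^sup>+u. ennreal ((step_process (m k) (\<sigma> k) (g k) u \<omega>)\<^sup>2) \<partial>lebesgue_on_ivl 0 s)"
      using st by (intro nn_integral_step_process[OF g_simple, symmetric]) (auto simp: \<sigma>_def)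
    also have "\<dots> \<le> (\<integral>\<^sup>+u. (ennreal ((H u \<omega> - step_process (m k) (\<tau> k) (a k) u \<omega>)\<^sup>2) +
        ennreal ((H u \<omega> - step_process (m k) (\<tau> k) (a k) u \<omega>)\<^sup>2)) +
        (ennreal ((H u \<omega> - step_process (m k) (\<tau> k) (b k) u \<omega>)\<^sup>2) +
         ennreal ((H u \<omega> - step_process (m k) (\<tau> k) (b k) u \<omega>)\<^sup>2)) \<partial>lebesgue_on_ivl 0 s)"
    proof (intro nn_integral_mono_AE, use AE_lebesgue_on_ivl in eventually_elim)
      case (elim u)
      have "(x - y)\<^sup>2 \<le> ((h - x)\<^sup>2 + (h - x)\<^sup>2) + ((h - y)\<^sup>2 + (h - y)\<^sup>2)" for x y h :: real
        using zero_le_power2[of "(h - x) + (h - y)"] by (simp add: power2_eq_square algebra_simps)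
      then show ?case
        using elim by (simp add: g_proc flip: ennreal_plus)
    qed
    also have "\<dots> = (?err a k 0 s \<omega> + ?err a k 0 s \<omega>) + (?err b k 0 s \<omega> + ?err b k 0 s \<omega>)"
      by (simp add: nn_integral_add)
    also have "\<dots> \<le> (?err a k 0 t \<omega> + ?err a k 0 t \<omega>) + (?err b k 0 s \<omega> + ?err b k 0 s \<omega>)"
      using st by (intro add_mono order_refl nn_integral_lebesgue_on_ivl_mono) auto
    finally show "ennreal (\<Sum>i<m k. g k i \<omega> ^ 2 * (\<sigma> k (Suc i) - \<sigma> k i)) \<le>
      (?err a k 0 t \<omega> + ?err a k 0 t \<omega>) + (?err b k 0 s \<omega> + ?err b k 0 s \<omega>)" .
  qed
  from incr_sum_vanishes[OF g_simple this]
  have V1: "vanishes_in_prob (\<lambda>k \<omega>. ennreal \<bar>incr_sum (\<sigma> k) (g k) (m k) \<omega>\<bar>)" .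

  define \<rho> where "\<rho> = (\<lambda>k i. max s (min t (\<tau> k i)))"
  define c where "c = (\<lambda>k i \<omega>. if \<tau> k i \<le> t then a k i \<omega> else 0)"
  \<comment> \<open>Clipping supplies the bound \<open>K\<close> on the coefficients, uniform in
    \<open>k\<close>, on which the fourth moment estimate relies.\<close>
  define clip where "clip = (\<lambda>x. max (- K) (min K x))"
  define \<eta> where "\<eta> = (\<lambda>k i \<omega>. clip (c k i \<omega>))"
  have clip0: "clip 0 = 0" and clipK: "\<bar>clip x\<bar> \<le> K" for x
    using K_nonneg by (auto simp: clip_def)
  have clip_dist: "(x - clip x)\<^sup>2 \<le> (h - x)\<^sup>2" "(h - clip x)\<^sup>2 \<le> (h - x)\<^sup>2" if "\<bar>h\<bar> \<le> K" for x h
    using that by (auto simp: clip_def max_def min_def simp flip: abs_le_square_iff)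
  have c_simple: "simple_integrand M F (m k) (\<rho> k) (c k)" for k
    unfolding \<rho>_def c_def by (rule simple_integrand_clamp(1)[OF a[of k] st])
  have c_sum: "incr_sum (\<rho> k) (c k) (m k) \<omega> =
     step_integral B (m k) (\<tau> k) (a k) t \<omega> - step_integral B (m k) (\<tau> k) (a k) s \<omega>" for k \<omega>
    using simple_integrand_clamp(2)[OF a[of k] st, of \<omega>] by (simp add: \<rho>_def c_def)
  have c_proc: "step_process (m k) (\<rho> k) (c k) u \<omega> = step_process (m k) (\<tau> k) (a k) u \<omega>"
    if "s < u" "u \<le> t" for k u \<omega>
    using simple_integrand_clamp(3)[OF a[of k] st that, of \<omega>] by (simp add: \<rho>_def c_def)
  have \<eta>_simple: "simple_integrand M F (m k) (\<rho> k) (\<eta> k)" for k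
  proof -
    have "\<eta> k i \<in> borel_measurable (F (\<rho> k i))" if "i < m k" for i
      using c_simple[of k] that unfolding \<eta>_def clip_def simple_integrand_def
      by (intro borel_measurable_max borel_measurable_min) auto
    moreover have "bounded (\<eta> k i ` space M)" for i
      using clipK by (auto simp: bounded_iff \<eta>_def)
    ultimately show ?thesis
      using c_simple[of k] by (simp add: simple_integrand_def)
  qed
  have \<eta>_proc: "step_process (m k) (\<rho> k) (\<eta> k) u \<omega> = clip (step_process (m k) (\<rho> k) (c k) u \<omega>)" for k u \<omega>
    unfolding \<eta>_def by (rule step_process_map[OF c_simple, of clip, OF clip0])
  \<comment> \<open>The part cut off by clipping. As \<open>\<bar>H\<bar> <= K\<close>, a value is
    at least as far from \<open>H\<close> as from its clipped version, so the integral of this part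
    vanishes as well (\<open>V2\<close>).\<close>
  define d where "d = (\<lambda>k i \<omega>. c k i \<omega> - \<eta> k i \<omega>)"
  have d_simple: "simple_integrand M F (m k) (\<rho> k) (d k)" for k
    unfolding d_def by (rule simple_integrand_diff[OF c_simple \<eta>_simple])
  have \<rho>: "s \<le> \<rho> k i \<and> \<rho> k i \<le> t" for k i
    using st by (simp add: \<rho>_def)
  have "vanishes_in_prob (\<lambda>k \<omega>. ennreal (\<Sum>i<m k. d k i \<omega> ^ 2 * (\<rho> k (Suc i) - \<rho> k i)))"
  proof (rule vanishes_in_prob_mono[OF Ha])
    show "?err a k 0 t \<in> borel_measurable M" for k
      using t by (intro mE a) auto
    fix k \<omega> assume \<omega>: "\<omega> \<in> space M"
    have "ennreal (\<Sum>i<m k. d k i \<omega> ^ 2 * (\<rho> k (Suc i) - \<rho> k i)) =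
      (\<integral>\<^sup>+u. ennreal ((step_process (m k) (\<rho> k) (d k) u \<omega>)\<^sup>2) \<partial>lebesgue_on_ivl s t)"
      using st \<rho> by (intro nn_integral_step_process[OF d_simple, symmetric]) auto
    also have "\<dots> \<le> ?err a k s t \<omega>"
    proof (intro nn_integral_mono_AE, use AE_lebesgue_on_ivl in eventually_elim)
      case (elim u)
      then have "\<bar>H u \<omega>\<bar> \<le> K" using K \<omega> st by auto
      from clip_dist(1)[OF this] show ?case
        using elim by (simp add: d_def step_process_diff \<eta>_proc c_proc ennreal_leI)
    qed
    also have "\<dots> \<le> ?err a k 0 t \<omega>"
      using st by (intro nn_integral_lebesgue_on_ivl_mono) auto
    finally show "ennreal (\<Sum>i<m k. d k i \<omega> ^ 2 * (\<rho> k (Suc i) - \<rho> k i)) \<le> ?err a k 0 t \<omega>" .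
  qed
  from incr_sum_vanishes[OF d_simple this]
  have V2: "vanishes_in_prob (\<lambda>k \<omega>. ennreal \<bar>incr_sum (\<rho> k) (d k) (m k) \<omega>\<bar>)" .

  have mi [measurable]: "step_integral B (m k) (\<tau> k) (a k) t \<in> borel_measurable M"
    "step_integral B (m k) (\<tau> k) (b k) s \<in> borel_measurable M"
    "incr_sum (\<sigma> k) (g k) (m k) \<in> borel_measurable M"
    "incr_sum (\<rho> k) (d k) (m k) \<in> borel_measurable M" for k
    using step_integral_measurable[OF a t] step_integral_measurable[OF b st(1)]
      measurable_F_M[OF incr_sum_measurable[OF g_simple order_refl]]
      measurable_F_M[OF incr_sum_measurable[OF d_simple order_refl]] by blast+
  show thesis
  proof (rule that[OF \<eta>_simple \<rho>])
    show "\<bar>\<eta> k i \<omega>\<bar> \<le> K" for k i \<omega>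
      using clipK by (simp add: \<eta>_def)
    show "vanishes_in_prob (\<lambda>k \<omega>. ennreal \<bar>incr_sum (\<rho> k) (\<eta> k) (m k) \<omega> - (Y t \<omega> - Y s \<omega>)\<bar>)"
    proof (rule vanishes_in_prob_mono)
      let ?A = "\<lambda>k \<omega>. ennreal \<bar>step_integral B (m k) (\<tau> k) (a k) t \<omega> - Y t \<omega>\<bar>"
      let ?B = "\<lambda>k \<omega>. ennreal \<bar>step_integral B (m k) (\<tau> k) (b k) s \<omega> - Y s \<omega>\<bar>"
      let ?C = "\<lambda>k \<omega>. ennreal \<bar>incr_sum (\<sigma> k) (g k) (m k) \<omega>\<bar>"
      let ?D = "\<lambda>k \<omega>. ennreal \<bar>incr_sum (\<rho> k) (d k) (m k) \<omega>\<bar>"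
      show "vanishes_in_prob (\<lambda>k \<omega>. (?A k \<omega> + ?B k \<omega>) + (?C k \<omega> + ?D k \<omega>))"
        by (intro vanishes_in_prob_add Ia Ib V1 V2) measurable
      show "(\<lambda>\<omega>. (?A k \<omega> + ?B k \<omega>) + (?C k \<omega> + ?D k \<omega>)) \<in> borel_measurable M" for k
        by measurable
      fix k \<omega>
      \<comment> \<open>The quantity on the left equals the error of \<open>a\<close> at
        \<open>t\<close> minus the error of \<open>b\<close> at \<open>s\<close>, minus the sums of
        \<open>g\<close> and \<open>d\<close>.\<close>
      have "\<bar>incr_sum (\<rho> k) (\<eta> k) (m k) \<omega> - (Y t \<omega> - Y s \<omega>)\<bar> \<le>
        (\<bar>step_integral B (m k) (\<tau> k) (a k) t \<omega> - Y t \<omega>\<bar> + \<bar>step_integral B (m k) (\<tau> k) (b k) s \<omega> - Y s \<omega>\<bar>) +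
        (\<bar>incr_sum (\<sigma> k) (g k) (m k) \<omega>\<bar> + \<bar>incr_sum (\<rho> k) (d k) (m k) \<omega>\<bar>)"
        unfolding d_def incr_sum_diff g_sum c_sum by linarith
      from ennreal_leI[OF this]
      show "ennreal \<bar>incr_sum (\<rho> k) (\<eta> k) (m k) \<omega> - (Y t \<omega> - Y s \<omega>)\<bar> \<le> (?A k \<omega> + ?B k \<omega>) + (?C k \<omega> + ?D k \<omega>)"
        by (simp add: ennreal_plus del: ennreal_plus[symmetric])
    qed
    let ?N = "\<lambda>k \<omega>. sq_err s t H (m k) (\<rho> k) (\<eta> k) \<omega>"
    \<comment> \<open>\<open>H\<close> and the clipped process are both bounded by \<open>K\<close>,
      which dominates the squared error by a constant and upgrades convergence in probability to
      convergence of the mean.\<close>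
    show "(\<lambda>k. \<integral>\<^sup>+\<omega>. ?N k \<omega> \<partial>M) \<longlonglongrightarrow> 0"
    proof (rule vanishes_in_prob_nn_integral[where c = "(2 * K)\<^sup>2 * (t - s)"])
      show "vanishes_in_prob ?N"
      proof (rule vanishes_in_prob_mono[OF Ha])
        show "?err a k 0 t \<in> borel_measurable M" for k
          using t by (intro mE a) auto
        fix k \<omega> assume \<omega>: "\<omega> \<in> space M"
        have "?N k \<omega> \<le> ?err a k s t \<omega>"
        proof (intro nn_integral_mono_AE, use AE_lebesgue_on_ivl in eventually_elim)
          case (elim u)
          then have "\<bar>H u \<omega>\<bar> \<le> K" using K \<omega> st by auto
          from clip_dist(2)[OF this] show ?case
            using elim by (simp add: \<eta>_proc c_proc ennreal_leI)
        qed
        also have "\<dots> \<le> ?err a k 0 t \<omega>"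
          using st by (intro nn_integral_lebesgue_on_ivl_mono) auto
        finally show "?N k \<omega> \<le> ?err a k 0 t \<omega>" .
      qed
      show "?N k \<in> borel_measurable M" for k
        using st by (intro mE \<eta>_simple) auto
      show "?N k \<omega> \<le> ennreal ((2 * K)\<^sup>2 * (t - s))" if \<omega>: "\<omega> \<in> space M" for k \<omega>
      proof -
        have "?N k \<omega> \<le> (\<integral>\<^sup>+u. ennreal ((2 * K)\<^sup>2) \<partial>lebesgue_on_ivl s t)"
        proof (intro nn_integral_mono ennreal_leI)
          fix u assume "u \<in> space (lebesgue_on_ivl s t)"
          then have "\<bar>H u \<omega>\<bar> \<le> K" using K \<omega> st by (auto simp: space_lebesgue_on_ivl)
          then have "\<bar>H u \<omega> - step_process (m k) (\<rho> k) (\<eta> k) u \<omega>\<bar> \<le> \<bar>2 * K\<bar>"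
            using clipK[of "step_process (m k) (\<rho> k) (c k) u \<omega>"] by (simp add: \<eta>_proc)
          then show "(H u \<omega> - step_process (m k) (\<rho> k) (\<eta> k) u \<omega>)\<^sup>2 \<le> (2 * K)\<^sup>2"
            by (simp add: abs_le_square_iff)
        qed
        also have "\<dots> = ennreal ((2 * K)\<^sup>2 * (t - s))"
          using st by (simp add: emeasure_restrict_space ennreal_mult)
        finally show ?thesis .
      qed
    qed (use st in simp)
  qed
qed

end

text \<open>Young's inequality, used in place of Cauchy-Schwarz. In limit arguments
  \<open>\<theta>\<close> is kept fixed while an approximation error tends to \<open>0\<close>, and
  is then sent to \<open>0\<close> by \<open>le_of_le_add_scaled\<close>.\<close>

lemma abs_mult_le_weighted_squares:
  fixes a b \<theta> :: real
  assumes "0 < \<theta>"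
  shows "\<bar>a * b\<bar> \<le> \<theta> * a\<^sup>2 + b\<^sup>2 / \<theta>"
proof -
  have "2 * \<bar>a * b\<bar> \<le> \<theta> * a\<^sup>2 + b\<^sup>2 / \<theta>"
  proof -
    have "0 \<le> (\<theta> * \<bar>a\<bar> - \<bar>b\<bar>)\<^sup>2 / \<theta>" using assms by simp
    also have "\<dots> = \<theta> * a\<^sup>2 + b\<^sup>2 / \<theta> - 2 * \<bar>a * b\<bar>"
      using assms by (simp add: power2_diff abs_mult field_simps power2_eq_square)
    finally show ?thesis by simp
  qed
  then show ?thesis using abs_ge_zero[of "a * b"] by linarith
qed

lemma le_of_le_add_scaled:
  fixes x y w :: real
  assumes "\<And>\<theta>. 0 < \<theta> \<Longrightarrow> x \<le> y + \<theta> * w"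
  shows "x \<le> y"
proof -
  have "((\<lambda>\<theta>. y + \<theta> * w) \<longlongrightarrow> y + 0 * w) (at_right 0)"
    by (intro tendsto_intros)
  moreover have "\<forall>\<^sub>F \<theta> in at_right 0. x \<le> y + \<theta> * w"
    using assms by (auto simp: eventually_at_right_less eventually_at intro: exI[of _ 1])
  ultimately have "x \<le> y + 0 * w"
    by (intro tendsto_lowerbound) auto
  then show ?thesis by simp
qed

lemma (in prob_space) integrable_mult_squares:
  fixes Z D :: "'a \<Rightarrow> real"
  assumes "Z \<in> borel_measurable M" "D \<in> borel_measurable M"
    "integrable M (\<lambda>\<omega>. Z \<omega> ^ 2)" "integrable M (\<lambda>\<omega>. D \<omega> ^ 2)"
  shows "integrable M (\<lambda>\<omega>. Z \<omega> * D \<omega>)"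
proof (rule Bochner_Integration.integrable_bound)
  show "integrable M (\<lambda>\<omega>. Z \<omega> ^ 2 + D \<omega> ^ 2)" using assms by simp
  show "(\<lambda>\<omega>. Z \<omega> * D \<omega>) \<in> borel_measurable M"
    using assms(1,2) by (rule borel_measurable_times)
  show "AE \<omega> in M. norm (Z \<omega> * D \<omega>) \<le> norm (Z \<omega> ^ 2 + D \<omega> ^ 2)"
    using abs_mult_le_weighted_squares[of 1] by (intro AE_I2) simp
qed

lemma (in prob_space) integrable_diff_square:
  fixes Z D :: "'a \<Rightarrow> real"
  assumes "Z \<in> borel_measurable M" "D \<in> borel_measurable M"
    "integrable M (\<lambda>\<omega>. Z \<omega> ^ 2)" "integrable M (\<lambda>\<omega>. D \<omega> ^ 2)"
  shows "integrable M (\<lambda>\<omega>. (Z \<omega> - D \<omega>)\<^sup>2)"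
proof -
  have "integrable M (\<lambda>\<omega>. Z \<omega> ^ 2 - 2 * (Z \<omega> * D \<omega>) + D \<omega> ^ 2)"
    using assms integrable_mult_squares[OF assms] by (intro Bochner_Integration.integrable_add
      Bochner_Integration.integrable_diff integrable_mult_right) auto
  also have "(\<lambda>\<omega>. Z \<omega> ^ 2 - 2 * (Z \<omega> * D \<omega>) + D \<omega> ^ 2) = (\<lambda>\<omega>. (Z \<omega> - D \<omega>)\<^sup>2)"
    by (simp add: power2_eq_square algebra_simps)
  finally show ?thesis .
qed

section \<open>Orthogonality and conditional second moments of increments\<close>

context bounded_ito_process
begin

lemma increment_L2_approx:
  assumes st: "0 \<le> s" "s \<le> t" "t \<le> T"
  obtains m \<tau> \<xi> where "\<And>k. simple_integrand M F (m k) (\<tau> k) (\<xi> k)"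
    "\<And>k i. i \<le> m k \<Longrightarrow> s \<le> \<tau> k i \<and> \<tau> k i \<le> t"
    "\<And>k i \<omega>. \<bar>\<xi> k i \<omega>\<bar> \<le> K"
    "\<And>k. integrable M (\<lambda>\<omega>. incr_sum (\<tau> k) (\<xi> k) (m k) \<omega> ^ 4)"
    "\<And>k. expectation (\<lambda>\<omega>. incr_sum (\<tau> k) (\<xi> k) (m k) \<omega> ^ 4) \<le> 3 * K ^ 4 * (t - s)\<^sup>2"
    "integrable M (\<lambda>\<omega>. (Y t \<omega> - Y s \<omega>) ^ 4)"
    "expectation (\<lambda>\<omega>. (Y t \<omega> - Y s \<omega>) ^ 4) \<le> 3 * K ^ 4 * (t - s)\<^sup>2"
    "(\<lambda>k. expectation (\<lambda>\<omega>. (incr_sum (\<tau> k) (\<xi> k) (m k) \<omega> - (Y t \<omega> - Y s \<omega>))\<^sup>2)) \<longlonglongrightarrow> 0"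
    "(\<lambda>k. \<integral>\<^sup>+\<omega>. sq_err s t H (m k) (\<tau> k) (\<xi> k) \<omega> \<partial>M) \<longlonglongrightarrow> 0"
proof -
  obtain m \<tau> \<xi> where s: "\<And>k. simple_integrand M F (m k) (\<tau> k) (\<xi> k)"
    and \<tau>: "\<And>k i. i \<le> m k \<Longrightarrow> s \<le> \<tau> k i \<and> \<tau> k i \<le> t"
    and \<xi>: "\<And>k i \<omega>. \<bar>\<xi> k i \<omega>\<bar> \<le> K"
    and v: "vanishes_in_prob (\<lambda>k \<omega>. ennreal \<bar>incr_sum (\<tau> k) (\<xi> k) (m k) \<omega> - (Y t \<omega> - Y s \<omega>)\<bar>)"
    and H: "(\<lambda>k. \<integral>\<^sup>+\<omega>. sq_err s t H (m k) (\<tau> k) (\<xi> k) \<omega> \<partial>M) \<longlonglongrightarrow> 0"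
    using increment_approx[OF st] by blast
  have mS: "incr_sum (\<tau> k) (\<xi> k) (m k) \<in> borel_measurable M" for k
    by (rule measurable_F_M[OF incr_sum_measurable[OF s order_refl]])
  have mD: "(\<lambda>\<omega>. Y t \<omega> - Y s \<omega>) \<in> borel_measurable M"
    by (rule increment_measurable[OF st])
  have 4: "integrable M (\<lambda>\<omega>. incr_sum (\<tau> k) (\<xi> k) (m k) \<omega> ^ 4)"
    "expectation (\<lambda>\<omega>. incr_sum (\<tau> k) (\<xi> k) (m k) \<omega> ^ 4) \<le> 3 * K ^ 4 * (t - s)\<^sup>2" for k
  proof -
    note mom = incr_sum_moments[OF s[of k] order_refl \<xi>]
    show "integrable M (\<lambda>\<omega>. incr_sum (\<tau> k) (\<xi> k) (m k) \<omega> ^ 4)" using mom by blast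
    have "expectation (\<lambda>\<omega>. incr_sum (\<tau> k) (\<xi> k) (m k) \<omega> ^ 4) \<le> 3 * K ^ 4 * (\<tau> k (m k) - \<tau> k 0)\<^sup>2"
      using mom by blast
    also have "(\<tau> k (m k) - \<tau> k 0)\<^sup>2 \<le> (t - s)\<^sup>2"
      using \<tau>[of "m k" k] \<tau>[of 0 k] simple_integrand_mono[OF s, of 0 "m k" k] by (intro power_mono) auto
    finally show "expectation (\<lambda>\<omega>. incr_sum (\<tau> k) (\<xi> k) (m k) \<omega> ^ 4) \<le> 3 * K ^ 4 * (t - s)\<^sup>2"
      by (simp add: mult_left_mono)
  qed
  note lim = fourth_moment_limit[OF mS mD v 4]
  show thesis
    by (rule that[OF s \<tau> \<xi> 4 lim H])
qed

lemma increment_moment4: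
  assumes st: "0 \<le> s" "s \<le> t" "t \<le> T"
  shows "integrable M (\<lambda>\<omega>. (Y t \<omega> - Y s \<omega>) ^ 4)"
    and "expectation (\<lambda>\<omega>. (Y t \<omega> - Y s \<omega>) ^ 4) \<le> 3 * K ^ 4 * (t - s)\<^sup>2"
  by (rule increment_L2_approx[OF st]; assumption)+

lemma increment_integrable:
  assumes st: "0 \<le> s" "s \<le> t" "t \<le> T"
    and k: "k \<le> 4"
  shows "integrable M (\<lambda>\<omega>. (Y t \<omega> - Y s \<omega>) ^ k)"
  by (rule integrable_power_le_4[OF increment_measurable[OF st] increment_moment4(1)[OF st] k])

text \<open>The martingale property in weak form. The approximants are exactly orthogonal to
  \<open>Z\<close>, and Young's inequality bounds the remaining error by \<open>\<theta>\<close>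
  times the second moment of \<open>Z\<close> plus the mean square error divided by
  \<open>\<theta>\<close>.\<close>

lemma increment_orthogonal:
  assumes st: "0 \<le> s" "s \<le> t" "t \<le> T"
    and Z: "Z \<in> borel_measurable (F s)" "integrable M (\<lambda>\<omega>. Z \<omega> ^ 2)"
  shows "integrable M (\<lambda>\<omega>. Z \<omega> * (Y t \<omega> - Y s \<omega>))"
    and "expectation (\<lambda>\<omega>. Z \<omega> * (Y t \<omega> - Y s \<omega>)) = 0"
proof -
  let ?D = "\<lambda>\<omega>. Y t \<omega> - Y s \<omega>"
  have mD: "?D \<in> borel_measurable M"
    by (rule increment_measurable[OF st])
  have mZ: "Z \<in> borel_measurable M" by (rule measurable_F_M[OF Z(1)])
  have iD: "integrable M (\<lambda>\<omega>. ?D \<omega> ^ 2)"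
    by (rule increment_integrable[OF st]) simp
  show iZD: "integrable M (\<lambda>\<omega>. Z \<omega> * ?D \<omega>)"
    by (rule integrable_mult_squares[OF mZ mD Z(2) iD])
  have iZ: "integrable M Z"
    using integrable_mult_squares[OF mZ _ Z(2), of "\<lambda>_. 1"] by simp
  show "expectation (\<lambda>\<omega>. Z \<omega> * ?D \<omega>) = 0"
  proof (rule increment_L2_approx[OF st])
    fix m \<tau> \<xi> assume s: "\<And>k. simple_integrand M F (m k) (\<tau> k) (\<xi> k)"
      and \<tau>: "\<And>k i. i \<le> m k \<Longrightarrow> s \<le> \<tau> k i \<and> \<tau> k i \<le> t"
      and S4: "\<And>k. integrable M (\<lambda>\<omega>. incr_sum (\<tau> k) (\<xi> k) (m k) \<omega> ^ 4)"
      and lim: "(\<lambda>k. expectation (\<lambda>\<omega>. (incr_sum (\<tau> k) (\<xi> k) (m k) \<omega> - ?D \<omega>)\<^sup>2)) \<longlonglongrightarrow> 0"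
    define S where "S k = incr_sum (\<tau> k) (\<xi> k) (m k)" for k
    have mS: "S k \<in> borel_measurable M" for k
      unfolding S_def by (rule measurable_F_M[OF incr_sum_measurable[OF s order_refl]])
    have iS: "integrable M (\<lambda>\<omega>. S k \<omega> ^ 2)" for k
      by (rule integrable_power_le_4[OF mS]) (use S4 in \<open>simp_all add: S_def\<close>)
    have iZS: "integrable M (\<lambda>\<omega>. Z \<omega> * S k \<omega>)" for k
      by (rule integrable_mult_squares[OF mZ mS Z(2) iS])
    have ZS: "expectation (\<lambda>\<omega>. Z \<omega> * S k \<omega>) = 0" for k
    proof -
      have "Z \<in> borel_measurable (F (\<tau> k 0))"
        using \<tau>[of 0 k] by (intro measurable_F_mono[OF _ Z(1)]) auto
      then show ?thesis
        unfolding S_def by (intro incr_sum_mean_zero(2)[OF s order_refl _ iZ])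
    qed
    have i2: "integrable M (\<lambda>\<omega>. (S k \<omega> - ?D \<omega>)\<^sup>2)" for k
      by (rule integrable_diff_square[OF mS mD iS iD])
    have "\<bar>expectation (\<lambda>\<omega>. Z \<omega> * ?D \<omega>)\<bar> \<le> 0 + \<theta> * expectation (\<lambda>\<omega>. Z \<omega> ^ 2)" if \<theta>: "0 < \<theta>" for \<theta>
    proof -
      have "\<bar>expectation (\<lambda>\<omega>. Z \<omega> * ?D \<omega>)\<bar> \<le> \<theta> * expectation (\<lambda>\<omega>. Z \<omega> ^ 2) +
        expectation (\<lambda>\<omega>. (S k \<omega> - ?D \<omega>)\<^sup>2) / \<theta>" for k
      proof -
        have iZSD: "integrable M (\<lambda>\<omega>. Z \<omega> * (S k \<omega> - ?D \<omega>))"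
          using Bochner_Integration.integrable_diff[OF iZS[of k] iZD]
          by (subst right_diff_distrib)
        have "expectation (\<lambda>\<omega>. Z \<omega> * (S k \<omega> - ?D \<omega>)) =
          expectation (\<lambda>\<omega>. Z \<omega> * S k \<omega>) - expectation (\<lambda>\<omega>. Z \<omega> * ?D \<omega>)"
          by (subst right_diff_distrib, rule Bochner_Integration.integral_diff[OF iZS[of k] iZD])
        then have "\<bar>expectation (\<lambda>\<omega>. Z \<omega> * ?D \<omega>)\<bar> = \<bar>expectation (\<lambda>\<omega>. Z \<omega> * (S k \<omega> - ?D \<omega>))\<bar>"
          using ZS[of k] by simp
        also have "\<dots> \<le> expectation (\<lambda>\<omega>. \<bar>Z \<omega> * (S k \<omega> - ?D \<omega>)\<bar>)"
          by (rule integral_abs_bound)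
        also have "\<dots> \<le> expectation (\<lambda>\<omega>. \<theta> * Z \<omega> ^ 2 + (S k \<omega> - ?D \<omega>)\<^sup>2 / \<theta>)"
        proof (rule integral_mono)
          show "integrable M (\<lambda>\<omega>. \<bar>Z \<omega> * (S k \<omega> - ?D \<omega>)\<bar>)"
            by (rule integrable_abs[OF iZSD])
          show "integrable M (\<lambda>\<omega>. \<theta> * Z \<omega> ^ 2 + (S k \<omega> - ?D \<omega>)\<^sup>2 / \<theta>)"
            using Z(2) i2[of k] by simp
        qed (rule abs_mult_le_weighted_squares[OF \<theta>])
        also have "\<dots> = \<theta> * expectation (\<lambda>\<omega>. Z \<omega> ^ 2) + expectation (\<lambda>\<omega>. (S k \<omega> - ?D \<omega>)\<^sup>2) / \<theta>"
          using Z(2) i2[of k] by simp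
        finally show ?thesis .
      qed
      moreover have "(\<lambda>k. \<theta> * expectation (\<lambda>\<omega>. Z \<omega> ^ 2) + expectation (\<lambda>\<omega>. (S k \<omega> - ?D \<omega>)\<^sup>2) / \<theta>)
        \<longlonglongrightarrow> \<theta> * expectation (\<lambda>\<omega>. Z \<omega> ^ 2) + 0 / \<theta>"
        using lim \<theta> by (intro tendsto_intros) (auto simp: S_def)
      ultimately have "\<bar>expectation (\<lambda>\<omega>. Z \<omega> * ?D \<omega>)\<bar> \<le> \<theta> * expectation (\<lambda>\<omega>. Z \<omega> ^ 2) + 0 / \<theta>"
        by (intro LIMSEQ_le_const) auto
      then show ?thesis by simp
    qed
    from le_of_le_add_scaled[OF this]
    show ?thesis by simp
  qed
qed

end

text \<open>Exchanges \<open>x^2\<close> for \<open>y^2\<close> under a weight. The first form costs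
  second moments and serves the increment and its approximants; the second relies on a bound
  \<open>K\<close> and serves the integrands.\<close>

lemma weighted_square_perturb:
  fixes x y z c \<theta> :: real
  assumes z: "\<bar>z\<bar> \<le> c" and \<theta>: "0 < \<theta>"
  shows "z * x\<^sup>2 \<le> z * y\<^sup>2 + c * (\<theta> * (2 * x\<^sup>2 + 2 * y\<^sup>2) + (y - x)\<^sup>2 / \<theta>)"
    and "\<bar>x\<bar> \<le> K \<Longrightarrow> \<bar>y\<bar> \<le> K \<Longrightarrow> z * x\<^sup>2 \<le> z * y\<^sup>2 + 2 * c * K * (\<theta> + (y - x)\<^sup>2 / \<theta>)"
proof -
  have c: "0 \<le> c" using z by linarith
  have "z * (x\<^sup>2 - y\<^sup>2) \<le> \<bar>z\<bar> * \<bar>x\<^sup>2 - y\<^sup>2\<bar>"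
    using abs_ge_self[of "z * (x\<^sup>2 - y\<^sup>2)"] by (simp add: abs_mult)
  also have "\<dots> \<le> c * \<bar>x\<^sup>2 - y\<^sup>2\<bar>"
    using z by (intro mult_right_mono) auto
  also have "\<bar>x\<^sup>2 - y\<^sup>2\<bar> = \<bar>(x + y) * (y - x)\<bar>"
    by (subst abs_minus_commute) (simp add: power2_eq_square algebra_simps)
  finally have le: "z * x\<^sup>2 \<le> z * y\<^sup>2 + c * \<bar>(x + y) * (y - x)\<bar>"
    by (simp only: right_diff_distrib)
  have "\<bar>(x + y) * (y - x)\<bar> \<le> \<theta> * (x + y)\<^sup>2 + (y - x)\<^sup>2 / \<theta>"
    by (rule abs_mult_le_weighted_squares[OF \<theta>])
  also have "\<dots> \<le> \<theta> * (2 * x\<^sup>2 + 2 * y\<^sup>2) + (y - x)\<^sup>2 / \<theta>"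
    using \<theta> zero_le_power2[of "x - y"] by (intro add_right_mono mult_left_mono)
      (auto simp: power2_eq_square algebra_simps)
  finally have "c * \<bar>(x + y) * (y - x)\<bar> \<le> c * (\<theta> * (2 * x\<^sup>2 + 2 * y\<^sup>2) + (y - x)\<^sup>2 / \<theta>)"
    using c by (rule mult_left_mono)
  with le show "z * x\<^sup>2 \<le> z * y\<^sup>2 + c * (\<theta> * (2 * x\<^sup>2 + 2 * y\<^sup>2) + (y - x)\<^sup>2 / \<theta>)"
    by linarith
  show "z * x\<^sup>2 \<le> z * y\<^sup>2 + 2 * c * K * (\<theta> + (y - x)\<^sup>2 / \<theta>)" if "\<bar>x\<bar> \<le> K" "\<bar>y\<bar> \<le> K"
  proof -
    have "\<bar>y - x\<bar> \<le> \<theta> + (y - x)\<^sup>2 / \<theta>"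
      using abs_mult_le_weighted_squares[OF \<theta>, of 1 "y - x"] by simp
    then have "\<bar>x + y\<bar> * \<bar>y - x\<bar> \<le> (2 * K) * (\<theta> + (y - x)\<^sup>2 / \<theta>)"
      using that by (intro mult_mono) auto
    then have "c * \<bar>(x + y) * (y - x)\<bar> \<le> c * ((2 * K) * (\<theta> + (y - x)\<^sup>2 / \<theta>))"
      using c by (intro mult_left_mono) (simp_all add: abs_mult)
    with le show ?thesis by (simp add: mult_ac)
  qed
qed

context bounded_ito_process
begin

text \<open>The isometry with weight \<open>Z\<close> holds for the approximants and passes to the
  limit on both sides. The bound \<open>a\<close> is imposed at each single time \<open>u\<close>,
  and Fubini's theorem assembles it over the interval.\<close>

lemma increment_weighted_square_le:
  assumes st: "0 \<le> s" "s \<le> t" "t \<le> T"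
    and Z: "Z \<in> borel_measurable (F s)" "\<And>\<omega>. \<omega> \<in> space M \<Longrightarrow> \<bar>Z \<omega>\<bar> \<le> c"
    and a: "\<And>u. u \<in> {s..t} \<Longrightarrow> expectation (\<lambda>\<omega>. Z \<omega> * H u \<omega> ^ 2) \<le> a"
  shows "expectation (\<lambda>\<omega>. Z \<omega> * (Y t \<omega> - Y s \<omega>) ^ 2) \<le> a * (t - s)"
proof (rule increment_L2_approx[OF st])
  let ?D = "\<lambda>\<omega>. Y t \<omega> - Y s \<omega>"
  let ?L = "lebesgue_on_ivl s t"
  let ?P = "M \<Otimes>\<^sub>M ?L"
  fix m \<tau> \<xi> assume s: "\<And>k. simple_integrand M F (m k) (\<tau> k) (\<xi> k)"
    and \<tau>: "\<And>k i. i \<le> m k \<Longrightarrow> s \<le> \<tau> k i \<and> \<tau> k i \<le> t"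
    and \<xi>: "\<And>k i \<omega>. \<bar>\<xi> k i \<omega>\<bar> \<le> K"
    and S4: "\<And>k. integrable M (\<lambda>\<omega>. incr_sum (\<tau> k) (\<xi> k) (m k) \<omega> ^ 4)"
    and ES4: "\<And>k. expectation (\<lambda>\<omega>. incr_sum (\<tau> k) (\<xi> k) (m k) \<omega> ^ 4) \<le> 3 * K ^ 4 * (t - s)\<^sup>2"
    and D4: "integrable M (\<lambda>\<omega>. ?D \<omega> ^ 4)"
    and ED4: "expectation (\<lambda>\<omega>. ?D \<omega> ^ 4) \<le> 3 * K ^ 4 * (t - s)\<^sup>2"
    and lim: "(\<lambda>k. expectation (\<lambda>\<omega>. (incr_sum (\<tau> k) (\<xi> k) (m k) \<omega> - ?D \<omega>)\<^sup>2)) \<longlonglongrightarrow> 0"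
    and limH: "(\<lambda>k. \<integral>\<^sup>+\<omega>. sq_err s t H (m k) (\<tau> k) (\<xi> k) \<omega> \<partial>M) \<longlonglongrightarrow> 0"
  interpret L: finite_measure ?L by (rule finite_measure_lebesgue_on_ivl)
  interpret PS: pair_sigma_finite M ?L ..
  interpret P: finite_measure ?P
    by (rule finite_measure_pair_measure[OF L.finite_measure_axioms finite_measure_axioms])
  \<comment> \<open>A common bound for the second moments of the increment and of all approximants,
    by \<open>x^2 <= 1 + x^4\<close>.\<close>
  define V where "V = 1 + 3 * K ^ 4 * (t - s)\<^sup>2"
  obtain \<omega>0 where "\<omega>0 \<in> space M" using not_empty by blast
  then have c0: "0 \<le> c"
    using Z(2)[of \<omega>0] by auto
  define h where "h = (\<lambda>(\<omega>, u). H u \<omega>)"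
  define g where "g k = (\<lambda>(\<omega>, u). step_process (m k) (\<tau> k) (\<xi> k) u \<omega>)" for k
  define S where "S k = incr_sum (\<tau> k) (\<xi> k) (m k)" for k
  have mZ: "Z \<in> borel_measurable M" by (rule measurable_F_M[OF Z(1)])
  have mh [measurable]: "h \<in> borel_measurable ?P"
    unfolding h_def by (rule H_joint_measurable[OF st])
  have mg [measurable]: "g k \<in> borel_measurable ?P" for k
    unfolding g_def by (rule step_process_joint_measurable[OF s])
  have mZp [measurable]: "(\<lambda>p. Z (fst p)) \<in> borel_measurable ?P"
    by (rule measurable_compose[OF measurable_fst mZ])
  have mS: "S k \<in> borel_measurable M" for k
    unfolding S_def by (rule measurable_F_M[OF incr_sum_measurable[OF s order_refl]])
  have mD: "?D \<in> borel_measurable M"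
    by (rule increment_measurable[OF st])
  have hK: "\<bar>h p\<bar> \<le> K" if "p \<in> space ?P" for p
    using that H_bound st by (auto simp: h_def space_pair_measure space_lebesgue_on_ivl)
  have gK: "\<bar>g k p\<bar> \<le> K" for k p
  proof -
    obtain \<omega> u where p: "p = (\<omega>, u)" by (cases p)
    show ?thesis
    proof (cases "\<exists>i<m k. \<tau> k i < u \<and> u \<le> \<tau> k (Suc i)")
      case True
      then show ?thesis using \<xi> by (auto simp: g_def p step_process_eq[OF s])
    next
      case False
      then have "step_process (m k) (\<tau> k) (\<xi> k) u \<omega> = 0"
        by (intro step_process_eq_0) blast
      then show ?thesis using K_nonneg by (simp add: g_def p)
    qed
  qed
  have Zp: "\<bar>Z (fst p)\<bar> \<le> c" if "p \<in> space ?P" for p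
    using that Z(2) by (auto simp: space_pair_measure)
  have sq: "x\<^sup>2 \<le> b\<^sup>2" if "\<bar>x\<bar> \<le> b" for x b :: real
    using that by (simp flip: abs_le_square_iff)
  have ih: "integrable ?P (\<lambda>p. Z (fst p) * h p ^ 2)"
  proof (rule integrable_bounded_mult[OF _ mZp Zp])
    show "integrable ?P (\<lambda>p. h p ^ 2)"
      using sq[OF hK] by (intro P.integrable_const_bound[of _ "K\<^sup>2"] AE_I2) auto
  qed
  have ig: "integrable ?P (\<lambda>p. Z (fst p) * g k p ^ 2)" for k
  proof (rule integrable_bounded_mult[OF _ mZp Zp])
    show "integrable ?P (\<lambda>p. g k p ^ 2)"
      using sq[OF gK] by (intro P.integrable_const_bound[of _ "K\<^sup>2"] AE_I2) auto
  qed
  have hgK: "\<bar>h p - g k p\<bar> \<le> 2 * K" "\<bar>h p + g k p\<bar> \<le> 2 * K" if "p \<in> space ?P" for p k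
    using hK[OF that] gK[of k p] by linarith+
  have ihg: "integrable ?P (\<lambda>p. (h p - g k p)\<^sup>2)" for k
    using sq[OF hgK(1)] by (intro P.integrable_const_bound[of _ "(2 * K)\<^sup>2"] AE_I2) auto
  define e where "e k = integral\<^sup>L ?P (\<lambda>p. (h p - g k p)\<^sup>2)" for k
  define d where "d k = expectation (\<lambda>\<omega>. (S k \<omega> - ?D \<omega>)\<^sup>2)" for k
  have "e \<longlonglongrightarrow> 0"
  proof -
    have "(\<integral>\<^sup>+\<omega>. sq_err s t H (m k) (\<tau> k) (\<xi> k) \<omega> \<partial>M) = ennreal (e k)" for k
    proof -
      have "(\<integral>\<^sup>+\<omega>. \<integral>\<^sup>+u. ennreal ((h (\<omega>, u) - g k (\<omega>, u))\<^sup>2) \<partial>?L \<partial>M) =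
        (\<integral>\<^sup>+p. ennreal ((h p - g k p)\<^sup>2) \<partial>?P)"
        by (rule L.nn_integral_fst) measurable
      also have "\<dots> = ennreal (e k)"
        unfolding e_def by (rule nn_integral_eq_integral[OF ihg]) simp
      finally show ?thesis by (simp add: h_def g_def)
    qed
    then have "(\<lambda>k. ennreal (e k)) \<longlonglongrightarrow> 0" using limH by simp
    then show ?thesis
      by (subst (asm) ennreal_tendsto_0_iff) (simp_all add: e_def)
  qed
  have d: "d \<longlonglongrightarrow> 0" using lim by (simp add: d_def[abs_def] S_def)
  have eL: "emeasure ?L {s..t} = ennreal (t - s)"
    using st by (simp add: emeasure_restrict_space)
  then have mL: "measure ?L {s..t} = t - s"
    using st by (simp add: measure_def)
  have mP: "measure ?P (space ?P) = t - s"
  proof -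
    have "emeasure ?P (space M \<times> {s..t}) = emeasure M (space M) * emeasure ?L {s..t}"
      by (rule L.emeasure_pair_measure_Times) (auto simp: sets_restrict_space)
    then show ?thesis
      using st by (simp add: measure_def space_pair_measure space_lebesgue_on_ivl eL emeasure_space_1)
  qed
  have Zh: "integral\<^sup>L ?P (\<lambda>p. Z (fst p) * h p ^ 2) \<le> a * (t - s)"
  proof -
    have i: "integrable ?P (\<lambda>(\<omega>, u). Z \<omega> * H u \<omega> ^ 2)"
      using ih by (simp add: h_def split_beta')
    have "integral\<^sup>L ?P (\<lambda>p. Z (fst p) * h p ^ 2) = (\<integral>u. expectation (\<lambda>\<omega>. Z \<omega> * H u \<omega> ^ 2) \<partial>?L)"
      using PS.integral_snd[OF i] by (simp add: h_def split_beta')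
    also have "\<dots> \<le> (\<integral>u. a \<partial>?L)"
      using PS.integrable_snd[OF i] a by (intro integral_mono) (auto simp: space_lebesgue_on_ivl)
    also have "\<dots> = a * (t - s)" by (simp add: mL)
    finally show ?thesis .
  qed
  \<comment> \<open>The isometry is moved to the product space, where \<open>g k\<close> can be
    compared with \<open>h\<close>.\<close>
  have ZS: "expectation (\<lambda>\<omega>. Z \<omega> * S k \<omega> ^ 2) = integral\<^sup>L ?P (\<lambda>p. Z (fst p) * g k p ^ 2)" for k
  proof -
    have Zt: "Z \<in> borel_measurable (F (\<tau> k 0))"
      using \<tau>[of 0 k] by (intro measurable_F_mono[OF _ Z(1)]) auto
    have i: "integrable ?P (\<lambda>(\<omega>, u). Z \<omega> * step_process (m k) (\<tau> k) (\<xi> k) u \<omega> ^ 2)"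
      using ig[of k] by (simp add: g_def split_beta')
    have q: "(\<integral>u. step_process (m k) (\<tau> k) (\<xi> k) u \<omega> ^ 2 \<partial>?L) = (\<Sum>i<m k. \<xi> k i \<omega> ^ 2 * (\<tau> k (Suc i) - \<tau> k i))"
      if "\<omega> \<in> space M" for \<omega>
    proof -
      have "(\<lambda>u. step_process (m k) (\<tau> k) (\<xi> k) u \<omega>) \<in> borel_measurable ?L"
        using measurable_compose_Pair1[OF that mg[of k]] unfolding g_def prod.case .
      then have "(\<integral>u. step_process (m k) (\<tau> k) (\<xi> k) u \<omega> ^ 2 \<partial>?L) =
        enn2real (\<integral>\<^sup>+u. ennreal (step_process (m k) (\<tau> k) (\<xi> k) u \<omega> ^ 2) \<partial>?L)"
        by (intro integral_eq_nn_integral borel_measurable_power) auto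
      also have "\<dots> = enn2real (ennreal (\<Sum>i<m k. \<xi> k i \<omega> ^ 2 * (\<tau> k (Suc i) - \<tau> k i)))"
        using \<tau> by (subst nn_integral_step_process[OF s st(1)]) auto
      also have "\<dots> = (\<Sum>i<m k. \<xi> k i \<omega> ^ 2 * (\<tau> k (Suc i) - \<tau> k i))"
        using s[of k] by (intro enn2real_ennreal sum_nonneg) (simp add: simple_integrand_def)
      finally show ?thesis .
    qed
    have "expectation (\<lambda>\<omega>. Z \<omega> * S k \<omega> ^ 2) =
      expectation (\<lambda>\<omega>. Z \<omega> * (\<Sum>i<m k. \<xi> k i \<omega> ^ 2 * (\<tau> k (Suc i) - \<tau> k i)))"
      unfolding S_def by (rule incr_sum_isometry[OF s order_refl Zt Z(2)])
    also have "\<dots> = expectation (\<lambda>\<omega>. \<integral>u. Z \<omega> * step_process (m k) (\<tau> k) (\<xi> k) u \<omega> ^ 2 \<partial>?L)"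
      by (intro Bochner_Integration.integral_cong refl) (simp add: q)
    also have "\<dots> = integral\<^sup>L ?P (\<lambda>p. Z (fst p) * g k p ^ 2)"
      using PS.integral_fst[OF i] by (simp add: g_def split_beta')
    finally show ?thesis .
  qed
  have iD: "integrable M (\<lambda>\<omega>. ?D \<omega> ^ 2)"
    by (rule integrable_power_le_4[OF mD D4]) simp
  have iS: "integrable M (\<lambda>\<omega>. S k \<omega> ^ 2)" for k
    by (rule integrable_power_le_4[OF mS]) (use S4 in \<open>simp_all add: S_def\<close>)
  have i2: "integrable M (\<lambda>\<omega>. (S k \<omega> - ?D \<omega>)\<^sup>2)" for k
    by (rule integrable_diff_square[OF mS mD iS iD])
  have x24: "x\<^sup>2 \<le> 1 + x ^ 4" for x :: real
  proof -
    have "0 \<le> (x\<^sup>2 - 1)\<^sup>2 + x\<^sup>2" by simp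
    then have "0 \<le> x ^ 4 - x\<^sup>2 + 1" by (simp add: power2_eq_square power4_eq_xxxx algebra_simps)
    then show ?thesis by simp
  qed
  have ED: "expectation (\<lambda>\<omega>. ?D \<omega> ^ 2) \<le> V"
  proof -
    have "expectation (\<lambda>\<omega>. ?D \<omega> ^ 2) \<le> expectation (\<lambda>\<omega>. 1 + ?D \<omega> ^ 4)"
      using iD D4 x24 by (intro integral_mono) auto
    then show ?thesis using D4 ED4 by (simp add: V_def prob_space)
  qed
  have ES: "expectation (\<lambda>\<omega>. S k \<omega> ^ 2) \<le> V" for k
  proof -
    have "expectation (\<lambda>\<omega>. S k \<omega> ^ 2) \<le> expectation (\<lambda>\<omega>. 1 + S k \<omega> ^ 4)"
      using iS S4[of k] x24 by (intro integral_mono) (auto simp: S_def)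
    then show ?thesis using S4[of k] ES4[of k] by (simp add: V_def prob_space S_def)
  qed
  show ?thesis
  proof (rule le_of_le_add_scaled)
    fix \<theta> :: real assume \<theta>: "0 < \<theta>"
    \<comment> \<open>Two errors occur, \<open>e k\<close> from the integrands and
      \<open>d k\<close> from the integrals; with \<open>\<theta>\<close> fixed both vanish as
      \<open>k\<close> grows.\<close>
    have "expectation (\<lambda>\<omega>. Z \<omega> * ?D \<omega> ^ 2) \<le>
      a * (t - s) + 2 * c * K * (\<theta> * (t - s) + e k / \<theta>) + c * (\<theta> * (4 * V) + d k / \<theta>)" for k
    proof -
      have "expectation (\<lambda>\<omega>. Z \<omega> * ?D \<omega> ^ 2) \<le>
        expectation (\<lambda>\<omega>. Z \<omega> * S k \<omega> ^ 2 + c * (\<theta> * (2 * ?D \<omega> ^ 2 + 2 * S k \<omega> ^ 2) + (S k \<omega> - ?D \<omega>)\<^sup>2 / \<theta>))"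
      proof (rule integral_mono)
        show "integrable M (\<lambda>\<omega>. Z \<omega> * ?D \<omega> ^ 2)"
          by (rule integrable_bounded_mult[OF iD mZ Z(2)])
        show "integrable M (\<lambda>\<omega>. Z \<omega> * S k \<omega> ^ 2 + c * (\<theta> * (2 * ?D \<omega> ^ 2 + 2 * S k \<omega> ^ 2) + (S k \<omega> - ?D \<omega>)\<^sup>2 / \<theta>))"
          using integrable_bounded_mult[OF iS[of k] mZ Z(2)] iD iS[of k] i2[of k]
          by (intro Bochner_Integration.integrable_add integrable_mult_right) auto
        show "Z \<omega> * ?D \<omega> ^ 2 \<le> Z \<omega> * S k \<omega> ^ 2 + c * (\<theta> * (2 * ?D \<omega> ^ 2 + 2 * S k \<omega> ^ 2) + (S k \<omega> - ?D \<omega>)\<^sup>2 / \<theta>)"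
          if "\<omega> \<in> space M" for \<omega>
          by (rule weighted_square_perturb(1)[OF Z(2)[OF that] \<theta>])
      qed
      also have "\<dots> = expectation (\<lambda>\<omega>. Z \<omega> * S k \<omega> ^ 2) + c * (\<theta> * (2 * expectation (\<lambda>\<omega>. ?D \<omega> ^ 2) +
         2 * expectation (\<lambda>\<omega>. S k \<omega> ^ 2)) + d k / \<theta>)"
        using integrable_bounded_mult[OF iS[of k] mZ Z(2)] iD iS[of k] i2[of k] by (simp add: d_def)
      also have "\<dots> \<le> expectation (\<lambda>\<omega>. Z \<omega> * S k \<omega> ^ 2) + c * (\<theta> * (4 * V) + d k / \<theta>)"
        using ED ES[of k] c0 \<theta> by (intro add_left_mono mult_left_mono add_right_mono) auto
      also have "expectation (\<lambda>\<omega>. Z \<omega> * S k \<omega> ^ 2) \<le> a * (t - s) + 2 * c * K * (\<theta> * (t - s) + e k / \<theta>)"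
      proof -
        have "integral\<^sup>L ?P (\<lambda>p. Z (fst p) * g k p ^ 2) \<le>
          integral\<^sup>L ?P (\<lambda>p. Z (fst p) * h p ^ 2 + 2 * c * K * (\<theta> + (h p - g k p)\<^sup>2 / \<theta>))"
        proof (rule integral_mono[OF ig])
          show "integrable ?P (\<lambda>p. Z (fst p) * h p ^ 2 + 2 * c * K * (\<theta> + (h p - g k p)\<^sup>2 / \<theta>))"
            using ih ihg[of k] by (intro Bochner_Integration.integrable_add integrable_mult_right) auto
          show "Z (fst p) * g k p ^ 2 \<le> Z (fst p) * h p ^ 2 + 2 * c * K * (\<theta> + (h p - g k p)\<^sup>2 / \<theta>)"
            if "p \<in> space ?P" for p
            by (rule weighted_square_perturb(2)[OF Zp[OF that] \<theta> gK hK[OF that]])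
        qed
        also have "\<dots> = integral\<^sup>L ?P (\<lambda>p. Z (fst p) * h p ^ 2) + 2 * c * K * (\<theta> * measure ?P (space ?P) + e k / \<theta>)"
          using ih ihg[of k] by (simp add: e_def)
        also note mP
        finally show ?thesis using Zh by (simp add: ZS)
      qed
      finally show ?thesis by simp
    qed
    moreover have "(\<lambda>k. a * (t - s) + 2 * c * K * (\<theta> * (t - s) + e k / \<theta>) + c * (\<theta> * (4 * V) + d k / \<theta>))
      \<longlonglongrightarrow> a * (t - s) + 2 * c * K * (\<theta> * (t - s) + 0 / \<theta>) + c * (\<theta> * (4 * V) + 0 / \<theta>)"
      using \<theta> by (intro tendsto_intros \<open>e \<longlonglongrightarrow> 0\<close> d) auto
    ultimately have "expectation (\<lambda>\<omega>. Z \<omega> * ?D \<omega> ^ 2) \<le>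
      a * (t - s) + 2 * c * K * (\<theta> * (t - s) + 0 / \<theta>) + c * (\<theta> * (4 * V) + 0 / \<theta>)"
      by (intro LIMSEQ_le_const) auto
    also have "\<dots> = a * (t - s) + \<theta> * (2 * c * K * (t - s) + 4 * c * V)"
      by (simp add: algebra_simps)
    finally show "expectation (\<lambda>\<omega>. Z \<omega> * ?D \<omega> ^ 2) \<le> a * (t - s) + \<theta> * (2 * c * K * (t - s) + 4 * c * V)" .
  qed
qed

end

lemma (in filtered_prob_space) progressive_on_measurable:
  assumes H: "progressive_on F t H" and u: "u \<in> {0..t}"
  shows "H u \<in> borel_measurable M"
proof -
  have "(\<lambda>(s, \<omega>). H s \<omega>) \<in> borel_measurable (restrict_space borel {0..u} \<Otimes>\<^sub>M F u)"
    using H u unfolding progressive_on_def by blast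
  from measurable_compose_Pair1[OF _ this, of u]
  have "H u \<in> borel_measurable (F u)"
    using u unfolding prod.case by (simp add: space_restrict_space)
  then show ?thesis by (rule measurable_from_subalg[OF subalg])
qed

section \<open>Moments of the process and of its increments\<close>

context bounded_ito_process
begin

lemma H_measurable: "u \<in> {0..T} \<Longrightarrow> H u \<in> borel_measurable M"
  using Y_ito[of T] T_pos by (intro progressive_on_measurable[of T H u]) (auto simp: has_ito_integral_def)

text \<open>Elementary integrals up to time \<open>0\<close> vanish, so \<open>Y 0\<close> is a
  limit in probability of zeros and \<open>fourth_moment_limit\<close> applies with
  \<open>C = 0\<close>.\<close>

lemma Y_0: "AE \<omega> in M. Y 0 \<omega> = 0"
proof (rule has_ito_integral_approx[OF Y_ito[of 0]])
  show "0 \<in> {0..T}" "(0::real) \<le> 0" using T_pos by auto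
  fix m \<tau> \<xi> assume s: "\<And>k. simple_integrand M F (m k) (\<tau> k) (\<xi> k)"
    and v: "vanishes_in_prob (\<lambda>k \<omega>. ennreal \<bar>step_integral B (m k) (\<tau> k) (\<xi> k) 0 \<omega> - Y 0 \<omega>\<bar>)"
  have "vanishes_in_prob (\<lambda>k \<omega>. ennreal \<bar>0 - Y 0 \<omega>\<bar>)"
    using v unfolding step_integral_at_0[OF s] .
  from fourth_moment_limit(1,2)[OF _ Y_measurable this, of 0]
  have i: "integrable M (\<lambda>\<omega>. Y 0 \<omega> ^ 4)" and E: "expectation (\<lambda>\<omega>. Y 0 \<omega> ^ 4) \<le> 0"
    using T_pos by simp_all
  have "expectation (\<lambda>\<omega>. Y 0 \<omega> ^ 4) = 0"
    using E by (intro antisym integral_nonneg_AE) auto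
  then have "AE \<omega> in M. Y 0 \<omega> ^ 4 = 0"
    using integral_nonneg_eq_0_iff_AE[OF i] by simp
  then show ?thesis by eventually_elim simp
qed

lemma H_power_integrable: "u \<in> {0..T} \<Longrightarrow> integrable M (\<lambda>\<omega>. H u \<omega> ^ k)"
  using H_bound H_measurable
  by (intro integrable_const_bound[of _ "K ^ k"] borel_measurable_power AE_I2) (auto simp: power_abs power_mono)

lemma increment_square_le:
  assumes st: "0 \<le> s" "s \<le> t" "t \<le> T"
  shows "expectation (\<lambda>\<omega>. (Y t \<omega> - Y s \<omega>) ^ 2) \<le> K\<^sup>2 * (t - s)"
proof -
  have "expectation (\<lambda>\<omega>. 1 * H u \<omega> ^ 2) \<le> K\<^sup>2" if "u \<in> {s..t}" for u
  proof -
    have u: "u \<in> {0..T}" using that st by auto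
    have "H u \<omega> ^ 2 \<le> K\<^sup>2" if "\<omega> \<in> space M" for \<omega>
      using H_bound[OF u that] by (simp flip: abs_le_square_iff)
    then show ?thesis
      using H_power_integrable[OF u, of 2] by (auto intro!: integral_le_const)
  qed
  from increment_weighted_square_le[OF st, of "\<lambda>_. 1" 1, OF _ _ this]
  show ?thesis by simp
qed

text \<open>\<open>d\<close> is the square root of a time scale: with \<open>\<theta> = d\<close>
  both terms of Young's inequality are of order \<open>d\<close>.\<close>

lemma increment_abs_le:
  assumes st: "0 \<le> s" "s \<le> u" "u \<le> T" and d: "0 < d" "u - s \<le> d\<^sup>2"
  shows "expectation (\<lambda>\<omega>. \<bar>Y u \<omega> - Y s \<omega>\<bar>) \<le> (1 + K\<^sup>2) * d"
proof -
  have i: "integrable M (\<lambda>\<omega>. (Y u \<omega> - Y s \<omega>) ^ 2)" "integrable M (\<lambda>\<omega>. Y u \<omega> - Y s \<omega>)"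
    using increment_integrable[OF st, of 2] increment_integrable[OF st, of 1] by simp_all
  have "expectation (\<lambda>\<omega>. \<bar>Y u \<omega> - Y s \<omega>\<bar>) \<le> expectation (\<lambda>\<omega>. d + (Y u \<omega> - Y s \<omega>)\<^sup>2 / d)"
    using i abs_mult_le_weighted_squares[OF d(1), of 1] by (intro integral_mono) auto
  also have "\<dots> = d + expectation (\<lambda>\<omega>. (Y u \<omega> - Y s \<omega>)\<^sup>2) / d"
    using i by (simp add: prob_space)
  also have "\<dots> \<le> d + (K\<^sup>2 * d\<^sup>2) / d"
    using order_trans[OF increment_square_le[OF st] mult_left_mono[OF d(2)]] d(1)
    by (intro add_left_mono divide_right_mono) auto
  also have "\<dots> = (1 + K\<^sup>2) * d"
    using d(1) by (simp add: power2_eq_square algebra_simps)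
  finally show ?thesis .
qed

text \<open>Interpolation between the second and the fourth moment: with weight
  \<open>d = sqrt (t - s)\<close> both contributions scale like \<open>d ^ 3\<close>.\<close>

lemma increment_cube_le:
  assumes st: "0 \<le> s" "s \<le> t" "t \<le> T" and d: "0 < d" "t - s = d\<^sup>2"
  shows "integrable M (\<lambda>\<omega>. \<bar>Y t \<omega> - Y s \<omega>\<bar> ^ 3)"
    and "expectation (\<lambda>\<omega>. \<bar>Y t \<omega> - Y s \<omega>\<bar> ^ 3) \<le> (K\<^sup>2 + 3 * K ^ 4) * d ^ 3"
proof -
  have i: "integrable M (\<lambda>\<omega>. (Y t \<omega> - Y s \<omega>) ^ 2)" "integrable M (\<lambda>\<omega>. (Y t \<omega> - Y s \<omega>) ^ 4)"
    using increment_integrable[OF st, of 2] increment_integrable[OF st, of 4] by simp_all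
  show i3: "integrable M (\<lambda>\<omega>. \<bar>Y t \<omega> - Y s \<omega>\<bar> ^ 3)"
    using integrable_abs[OF increment_integrable[OF st, of 3]] by (simp add: power_abs)
  have le: "\<bar>x\<bar> ^ 3 \<le> d * x\<^sup>2 + x ^ 4 / d" for x :: real
  proof -
    have "\<bar>x\<bar> ^ 3 = \<bar>\<bar>x\<bar> * x\<^sup>2\<bar>" by (simp add: power3_eq_cube power2_eq_square abs_mult)
    also have "\<dots> \<le> d * \<bar>x\<bar>\<^sup>2 + (x\<^sup>2)\<^sup>2 / d" by (rule abs_mult_le_weighted_squares[OF d(1)])
    finally show ?thesis by (simp flip: power_mult)
  qed
  have "expectation (\<lambda>\<omega>. \<bar>Y t \<omega> - Y s \<omega>\<bar> ^ 3) \<le>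
    expectation (\<lambda>\<omega>. d * (Y t \<omega> - Y s \<omega>) ^ 2 + (Y t \<omega> - Y s \<omega>) ^ 4 / d)"
    using i i3 le by (intro integral_mono) auto
  also have "\<dots> = d * expectation (\<lambda>\<omega>. (Y t \<omega> - Y s \<omega>) ^ 2) + expectation (\<lambda>\<omega>. (Y t \<omega> - Y s \<omega>) ^ 4) / d"
    using i by simp
  also have "\<dots> \<le> d * (K\<^sup>2 * d\<^sup>2) + (3 * K ^ 4 * (d\<^sup>2)\<^sup>2) / d"
    using increment_square_le[OF st] increment_moment4(2)[OF st] d
    by (intro add_mono mult_left_mono divide_right_mono) auto
  also have "\<dots> = (K\<^sup>2 + 3 * K ^ 4) * d ^ 3"
    using d(1) by (simp add: power2_eq_square power3_eq_cube algebra_simps)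
  finally show "expectation (\<lambda>\<omega>. \<bar>Y t \<omega> - Y s \<omega>\<bar> ^ 3) \<le> (K\<^sup>2 + 3 * K ^ 4) * d ^ 3" .
qed

lemma Y_power_integrable:
  assumes t: "t \<in> {0..T}" and k: "k \<le> 4"
  shows "integrable M (\<lambda>\<omega>. Y t \<omega> ^ k)"
proof -
  have "integrable M (\<lambda>\<omega>. (Y t \<omega> - Y 0 \<omega>) ^ k)"
    using t k by (intro increment_integrable) auto
  moreover have "AE \<omega> in M. (Y t \<omega> - Y 0 \<omega>) ^ k = Y t \<omega> ^ k"
    using Y_0 by eventually_elim simp
  ultimately show ?thesis
    using t T_pos Y_measurable[OF t]
    by (subst integrable_cong_AE[where g = "\<lambda>\<omega>. (Y t \<omega> - Y 0 \<omega>) ^ k"])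
      (auto intro!: borel_measurable_diff borel_measurable_power Y_measurable)
qed

lemma Y_square_le:
  assumes t: "t \<in> {0..T}" and a: "\<And>u. u \<in> {0..t} \<Longrightarrow> expectation (\<lambda>\<omega>. H u \<omega> ^ 2) \<le> a"
  shows "expectation (\<lambda>\<omega>. Y t \<omega> ^ 2) \<le> a * t"
proof -
  have "expectation (\<lambda>\<omega>. Y t \<omega> ^ 2) = expectation (\<lambda>\<omega>. 1 * (Y t \<omega> - Y 0 \<omega>) ^ 2)"
  proof (rule integral_cong_AE)
    show "AE \<omega> in M. Y t \<omega> ^ 2 = 1 * (Y t \<omega> - Y 0 \<omega>) ^ 2"
      using Y_0 by eventually_elim simp
  qed (use t in \<open>auto intro!: borel_measurable_diff borel_measurable_power Y_measurable\<close>)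
  also have "\<dots> \<le> a * (t - 0)"
    using t a by (intro increment_weighted_square_le[where c = 1]) auto
  finally show ?thesis by simp
qed

end

section \<open>A maximal inequality and an Ito inequality\<close>

primrec running_max :: "(nat \<Rightarrow> real) \<Rightarrow> nat \<Rightarrow> real" where
  "running_max s 0 = s 0"
| "running_max s (Suc n) = max (running_max s n) (s (Suc n))"

lemma running_max_ge: "j \<le> n \<Longrightarrow> s j \<le> running_max s n"
  by (induction n) (auto simp: le_Suc_eq le_max_iff_disj)

text \<open>Pathwise form of Doob's inequality in \<open>L\<^sup>2\<close>: if \<open>s\<close> is the absolute value of a martingale, then the
  sum on the right has nonnegative expectation.\<close>

lemma running_max_square_le:
  assumes s: "\<And>k. 0 \<le> s k"
  shows "(running_max s n)\<^sup>2 \<le> 4 * (s n)\<^sup>2 - 4 * (\<Sum>k<n. running_max s k * (s (Suc k) - s k))"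
proof -
  \<comment> \<open>Summation by parts as an inequality: a new maximum \<open>s'\<close> above the
    old \<open>m\<close> leaves a surplus of \<open>(s' - m)^2 / 2\<close>, and otherwise the
    maximum does not change.\<close>
  have "(\<Sum>k<n. running_max s k * (s (Suc k) - s k)) \<le> running_max s n * s n - (running_max s n)\<^sup>2 / 2"
  proof (induction n)
    case 0
    show ?case by (simp add: power2_eq_square)
  next
    case (Suc n)
    show ?case
    proof (cases "s (Suc n) \<le> running_max s n")
      case True
      then show ?thesis using Suc by (simp add: max_def algebra_simps)
    next
      case False
      have "0 \<le> (s (Suc n) - running_max s n)\<^sup>2 / 2" by simp
      with Suc False show ?thesis by (simp add: max_def power2_eq_square field_simps)
    qed
  qed
  \<comment> \<open>This weighting leaves a quarter of the squared maximum on the left, hence the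
    factor \<open>4\<close>.\<close>
  moreover have "running_max s n * s n \<le> (running_max s n)\<^sup>2 / 4 + (s n)\<^sup>2"
    using zero_le_power2[of "running_max s n / 2 - s n"] by (simp add: power2_eq_square field_simps)
  ultimately show ?thesis by (simp add: field_simps)
qed

text \<open>The second derivative is taken at the left point \<open>x\<close> instead of the
  intermediate point of the Lagrange remainder, because \<open>f'' (Y s)\<close> has to be known at
  time \<open>s\<close>; the exchange costs the cubic term.\<close>

lemma taylor_second_order_bound:
  fixes f f' f'' :: "real \<Rightarrow> real"
  assumes f: "\<And>x. (f has_real_derivative f' x) (at x)"
    and f': "\<And>x. (f' has_real_derivative f'' x) (at x)"
    and L: "\<And>x y. \<bar>f'' x - f'' y\<bar> \<le> L * \<bar>x - y\<bar>"
  shows "f y \<le> f x + f' x * (y - x) + f'' x * (y - x)\<^sup>2 / 2 + L * \<bar>y - x\<bar> ^ 3"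
proof (cases "x = y")
  case False
  define D where "D = (\<lambda>n::nat. if n = 0 then f else if n = 1 then f' else f'')"
  have "\<exists>z. (if y < x then y < z \<and> z < x else x < z \<and> z < y) \<and>
    f y = (\<Sum>m<2. D m x / fact m * (y - x) ^ m) + D 2 z / fact 2 * (y - x)\<^sup>2"
    using False f f' by (intro Taylor[where a = "min x y" and b = "max x y"]) (auto simp: D_def less_2_cases_iff)
  then obtain z where "if y < x then y < z \<and> z < x else x < z \<and> z < y"
    and "f y = (\<Sum>m<2. D m x / fact m * (y - x) ^ m) + D 2 z / fact 2 * (y - x)\<^sup>2"
    by blast
  then have z: "\<bar>x - z\<bar> \<le> \<bar>y - x\<bar>"
    and eq: "f y = f x + f' x * (y - x) + f'' z * (y - x)\<^sup>2 / 2"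
    by (auto simp: D_def numeral_2_eq_2 split: if_splits)
  have "0 \<le> L * \<bar>0 - 1\<bar>" using L[of 0 1] abs_ge_zero order_trans by blast
  then have L0: "0 \<le> L" by simp
  have "f'' z - f'' x \<le> L * \<bar>y - x\<bar>"
    using L[of x z] mult_left_mono[OF z L0] by linarith
  then have "(f'' z - f'' x) * (y - x)\<^sup>2 \<le> (L * \<bar>y - x\<bar>) * (y - x)\<^sup>2"
    by (intro mult_right_mono) auto
  also have "\<dots> = L * \<bar>y - x\<bar> ^ 3"
    by (simp add: power3_eq_cube power2_eq_square flip: abs_mult)
  finally have "f'' z * (y - x)\<^sup>2 / 2 \<le> f'' x * (y - x)\<^sup>2 / 2 + L * \<bar>y - x\<bar> ^ 3"
    using mult_nonneg_nonneg[OF L0, of "\<bar>y - x\<bar> ^ 3"] unfolding left_diff_distrib by simp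
  with eq show ?thesis by linarith
qed simp

section \<open>Expectations of test functions and the supremum\<close>

context bounded_ito_process
begin

text \<open>The first-order term vanishes by orthogonality. The second-order term has
  \<open>f''\<close> at \<open>Y s\<close>, whereas the hypothesis on \<open>A\<close> couples
  \<open>f''\<close> and \<open>H\<close> at the same time \<open>u\<close>; moving from
  \<open>s\<close> to \<open>u\<close> costs \<open>L * K^2\<close> times the mean of
  \<open>\<bar>Y u - Y s\<bar>\<close>, which is of order \<open>d\<close>. All errors are thus of
  order \<open>d ^ 3\<close>, smaller than \<open>t - s = d^2\<close>.\<close>

lemma one_step_expectation_le:
  fixes f f' f'' :: "real \<Rightarrow> real"
  assumes f: "\<And>x. (f has_real_derivative f' x) (at x)"
    and f': "\<And>x. (f' has_real_derivative f'' x) (at x)"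
    and Q: "\<And>x. \<bar>f'' x\<bar> \<le> Q"
    and L: "\<And>x y. \<bar>f'' x - f'' y\<bar> \<le> L * \<bar>x - y\<bar>"
    and int: "\<And>t. t \<in> {0..T} \<Longrightarrow> integrable M (\<lambda>\<omega>. f (Y t \<omega>))"
    and int': "\<And>t. t \<in> {0..T} \<Longrightarrow> integrable M (\<lambda>\<omega>. f' (Y t \<omega>) ^ 2)"
    and A: "\<And>u \<omega>. u \<in> {0..T} \<Longrightarrow> \<omega> \<in> space M \<Longrightarrow> f'' (Y u \<omega>) * H u \<omega> ^ 2 \<le> A"
    and st: "0 \<le> s" "s \<le> t" "t \<le> T" and d: "0 < d" "t - s = d\<^sup>2"
  shows "expectation (\<lambda>\<omega>. f (Y t \<omega>)) \<le>
    expectation (\<lambda>\<omega>. f (Y s \<omega>)) + A / 2 * (t - s) + L * (K\<^sup>2 * (1 + K\<^sup>2) + K\<^sup>2 + 3 * K ^ 4) * d ^ 3"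
proof -
  have s: "s \<in> {0..T}" and t: "t \<in> {0..T}" using st by auto
  have L0: "0 \<le> L" using L[of 0 1] abs_ge_zero[of "f'' 0 - f'' 1"] by simp
  have cf': "continuous_on UNIV f'"
    using f' by (intro continuous_at_imp_continuous_on ballI DERIV_isCont)
  have cf'': "continuous_on UNIV f''"
    using L L0 by (intro lipschitz_on_continuous_on[of L] lipschitz_onI) (auto simp: dist_real_def)
  have m': "(\<lambda>\<omega>. f' (Y s \<omega>)) \<in> borel_measurable (F s)"
    by (rule measurable_compose[OF Y_adapted[OF s] borel_measurable_continuous_onI[OF cf']])
  have m'': "(\<lambda>\<omega>. f'' (Y u \<omega>)) \<in> borel_measurable (F u)" if "u \<in> {0..T}" for u
    by (rule measurable_compose[OF Y_adapted[OF that] borel_measurable_continuous_onI[OF cf'']])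
  note orth = increment_orthogonal[OF st m' int'[OF s]]
  note cube = increment_cube_le[OF st d]
  have i2: "integrable M (\<lambda>\<omega>. (Y t \<omega> - Y s \<omega>) ^ 2)"
    using increment_integrable[OF st, of 2] by simp
  have i2': "integrable M (\<lambda>\<omega>. f'' (Y s \<omega>) * (Y t \<omega> - Y s \<omega>) ^ 2)"
    using Q by (intro integrable_bounded_mult[OF i2 measurable_F_M[OF m''[OF s]]])
  have "expectation (\<lambda>\<omega>. f (Y t \<omega>)) \<le> expectation (\<lambda>\<omega>. f (Y s \<omega>) + f' (Y s \<omega>) * (Y t \<omega> - Y s \<omega>)
    + f'' (Y s \<omega>) * (Y t \<omega> - Y s \<omega>)\<^sup>2 / 2 + L * \<bar>Y t \<omega> - Y s \<omega>\<bar> ^ 3)"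
    using int[OF s] int[OF t] orth(1) i2' cube(1)
    by (intro integral_mono taylor_second_order_bound[OF f f' L]) auto
  also have "\<dots> = expectation (\<lambda>\<omega>. f (Y s \<omega>)) + expectation (\<lambda>\<omega>. f'' (Y s \<omega>) * (Y t \<omega> - Y s \<omega>)\<^sup>2) / 2
    + L * expectation (\<lambda>\<omega>. \<bar>Y t \<omega> - Y s \<omega>\<bar> ^ 3)"
    using int[OF s] orth i2' cube(1) by simp
  also have "\<dots> \<le> expectation (\<lambda>\<omega>. f (Y s \<omega>)) + (A + L * K\<^sup>2 * ((1 + K\<^sup>2) * d)) * (t - s) / 2
    + L * ((K\<^sup>2 + 3 * K ^ 4) * d ^ 3)"
  proof (intro add_mono order_refl divide_right_mono mult_left_mono cube(2) L0)
    show "expectation (\<lambda>\<omega>. f'' (Y s \<omega>) * (Y t \<omega> - Y s \<omega>)\<^sup>2) \<le> (A + L * K\<^sup>2 * ((1 + K\<^sup>2) * d)) * (t - s)"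
    proof (rule increment_weighted_square_le[OF st m''[OF s] Q])
      fix u assume u: "u \<in> {s..t}"
      then have u': "u \<in> {0..T}" "s \<le> u" "u \<le> T" "u - s \<le> d\<^sup>2" using st d by auto
      have iH: "integrable M (\<lambda>\<omega>. H u \<omega> ^ 2)" by (rule H_power_integrable[OF u'(1)])
      have iD: "integrable M (\<lambda>\<omega>. \<bar>Y u \<omega> - Y s \<omega>\<bar>)"
        using integrable_abs[OF increment_integrable[OF st(1) u'(2,3), of 1]] by simp
      have "expectation (\<lambda>\<omega>. f'' (Y s \<omega>) * H u \<omega> ^ 2) \<le>
        expectation (\<lambda>\<omega>. A + L * K\<^sup>2 * \<bar>Y u \<omega> - Y s \<omega>\<bar>)"
      proof (rule integral_mono)
        show "integrable M (\<lambda>\<omega>. f'' (Y s \<omega>) * H u \<omega> ^ 2)"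
          using Q by (intro integrable_bounded_mult[OF iH measurable_F_M[OF m''[OF s]]])
        show "integrable M (\<lambda>\<omega>. A + L * K\<^sup>2 * \<bar>Y u \<omega> - Y s \<omega>\<bar>)" using iD by simp
        fix \<omega> assume \<omega>: "\<omega> \<in> space M"
        have "(f'' (Y s \<omega>) - f'' (Y u \<omega>)) * H u \<omega> ^ 2 \<le> (L * \<bar>Y s \<omega> - Y u \<omega>\<bar>) * K\<^sup>2"
        proof (rule mult_mono)
          show "f'' (Y s \<omega>) - f'' (Y u \<omega>) \<le> L * \<bar>Y s \<omega> - Y u \<omega>\<bar>"
            using L[of "Y s \<omega>" "Y u \<omega>"] by linarith
          show "H u \<omega> ^ 2 \<le> K\<^sup>2"
            using H_bound[OF u'(1) \<omega>] by (simp flip: abs_le_square_iff)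
        qed (use L0 in auto)
        then show "f'' (Y s \<omega>) * H u \<omega> ^ 2 \<le> A + L * K\<^sup>2 * \<bar>Y u \<omega> - Y s \<omega>\<bar>"
          using A[OF u'(1) \<omega>]
          by (simp only: left_diff_distrib abs_minus_commute[of "Y s \<omega>"] mult.commute[of _ "K\<^sup>2"] mult.left_commute[of _ "K\<^sup>2"] mult.assoc)
      qed
      also have "\<dots> = A + L * K\<^sup>2 * expectation (\<lambda>\<omega>. \<bar>Y u \<omega> - Y s \<omega>\<bar>)"
        using iD by (simp add: prob_space)
      also have "\<dots> \<le> A + L * K\<^sup>2 * ((1 + K\<^sup>2) * d)"
        using L0 by (intro add_left_mono mult_left_mono increment_abs_le[OF st(1) u'(2,3) d(1) u'(4)]) auto
      finally show "expectation (\<lambda>\<omega>. f'' (Y s \<omega>) * H u \<omega> ^ 2) \<le> A + L * K\<^sup>2 * ((1 + K\<^sup>2) * d)" .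
    qed
  qed simp
  also have "\<dots> = expectation (\<lambda>\<omega>. f (Y s \<omega>)) + A / 2 * (t - s) + L * (K\<^sup>2 * (1 + K\<^sup>2) / 2 + (K\<^sup>2 + 3 * K ^ 4)) * d ^ 3"
    unfolding d(2) by (simp add: field_simps power2_eq_square power3_eq_cube)
  also have "\<dots> \<le> expectation (\<lambda>\<omega>. f (Y s \<omega>)) + A / 2 * (t - s) + L * (K\<^sup>2 * (1 + K\<^sup>2) + (K\<^sup>2 + 3 * K ^ 4)) * d ^ 3"
    using L0 d(1) by (intro add_left_mono mult_right_mono mult_left_mono add_right_mono) auto
  finally show ?thesis by (simp add: add.assoc)
qed

text \<open>The inequality that Ito's formula would give, obtained from a Taylor expansion along
  equidistant partitions: the remainders are controlled by the fourth moments of the increments.\<close>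

lemma expectation_le_of_generator_bound:
  fixes f f' f'' :: "real \<Rightarrow> real"
  assumes f: "\<And>x. (f has_real_derivative f' x) (at x)"
    and f': "\<And>x. (f' has_real_derivative f'' x) (at x)"
    and Q: "\<And>x. \<bar>f'' x\<bar> \<le> Q"
    and L: "\<And>x y. \<bar>f'' x - f'' y\<bar> \<le> L * \<bar>x - y\<bar>"
    and A: "\<And>u \<omega>. u \<in> {0..T} \<Longrightarrow> \<omega> \<in> space M \<Longrightarrow> f'' (Y u \<omega>) * H u \<omega> ^ 2 \<le> A"
    and t: "t \<in> {0..T}"
  shows "integrable M (\<lambda>\<omega>. f (Y t \<omega>))" and "expectation (\<lambda>\<omega>. f (Y t \<omega>)) \<le> f 0 + A / 2 * t"
proof -
  have cf: "continuous_on UNIV f" "continuous_on UNIV f'"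
    using f f' by (auto intro!: continuous_at_imp_continuous_on DERIV_isCont)
  \<comment> \<open>A bounded \<open>f''\<close> forces linear growth of \<open>f'\<close> and
    quadratic growth of \<open>f\<close>; this provides the integrability that each single step asks
    for.\<close>
  have lin: "\<bar>f' y\<bar> \<le> \<bar>f' 0\<bar> + Q * \<bar>y\<bar>" for y
  proof -
    have "norm (f' y - f' 0) \<le> Q * norm (y - 0)"
      using f' Q by (intro field_differentiable_bound[of UNIV f' f'' Q])
        (auto intro: has_field_derivative_at_within)
    then show ?thesis by (simp add: abs_if split: if_splits)
  qed
  have Q0: "0 \<le> Q" using Q[of 0] by linarith
  have quad: "\<bar>f y\<bar> \<le> \<bar>f 0\<bar> + (\<bar>f' 0\<bar> + Q * \<bar>y\<bar>) * \<bar>y\<bar>" for y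
  proof -
    have "norm (f y - f 0) \<le> (\<bar>f' 0\<bar> + Q * \<bar>y\<bar>) * norm (y - 0)"
    proof (rule field_differentiable_bound[of "{-\<bar>y\<bar>..\<bar>y\<bar>}" f f'])
      show "norm (f' z) \<le> \<bar>f' 0\<bar> + Q * \<bar>y\<bar>" if "z \<in> {-\<bar>y\<bar>..\<bar>y\<bar>}" for z
      proof -
        have "\<bar>z\<bar> \<le> \<bar>y\<bar>" using that by auto
        from mult_left_mono[OF this Q0] show ?thesis using lin[of z] by simp
      qed
    qed (use f in \<open>auto intro: has_field_derivative_at_within\<close>)
    then show ?thesis by (simp add: abs_if split: if_splits)
  qed
  have mf: "(\<lambda>\<omega>. f (Y u \<omega>)) \<in> borel_measurable M" "(\<lambda>\<omega>. f' (Y u \<omega>)) \<in> borel_measurable M"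
    if "u \<in> {0..T}" for u
    using measurable_compose[OF Y_measurable[OF that] borel_measurable_continuous_onI] cf by blast+
  have intY: "integrable M (\<lambda>\<omega>. Y u \<omega> ^ 2)" "integrable M (\<lambda>\<omega>. \<bar>Y u \<omega>\<bar>)" if "u \<in> {0..T}" for u
    using Y_power_integrable[OF that, of 2] integrable_abs[OF Y_power_integrable[OF that, of 1]] by simp_all
  have int: "integrable M (\<lambda>\<omega>. f (Y u \<omega>))" if u: "u \<in> {0..T}" for u
  proof (rule Bochner_Integration.integrable_bound[OF _ mf(1)[OF u]])
    show "integrable M (\<lambda>\<omega>. \<bar>f 0\<bar> + \<bar>f' 0\<bar> * \<bar>Y u \<omega>\<bar> + Q * Y u \<omega> ^ 2)"
      using intY[OF u] by (intro Bochner_Integration.integrable_add integrable_mult_right) auto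
    show "AE \<omega> in M. norm (f (Y u \<omega>)) \<le> norm (\<bar>f 0\<bar> + \<bar>f' 0\<bar> * \<bar>Y u \<omega>\<bar> + Q * Y u \<omega> ^ 2)"
    proof (rule AE_I2)
      fix \<omega>
      have "\<bar>f (Y u \<omega>)\<bar> \<le> \<bar>f 0\<bar> + \<bar>f' 0\<bar> * \<bar>Y u \<omega>\<bar> + Q * Y u \<omega> ^ 2"
        using quad[of "Y u \<omega>"] by (simp add: distrib_right power2_eq_square mult.assoc flip: abs_mult)
      then show "norm (f (Y u \<omega>)) \<le> norm (\<bar>f 0\<bar> + \<bar>f' 0\<bar> * \<bar>Y u \<omega>\<bar> + Q * Y u \<omega> ^ 2)"
        by simp
    qed
  qed
  have int': "integrable M (\<lambda>\<omega>. f' (Y u \<omega>) ^ 2)" if u: "u \<in> {0..T}" for u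
  proof (rule Bochner_Integration.integrable_bound[OF _ borel_measurable_power[OF mf(2)[OF u]]])
    show "integrable M (\<lambda>\<omega>. 2 * \<bar>f' 0\<bar>\<^sup>2 + 2 * Q\<^sup>2 * Y u \<omega> ^ 2)"
      using intY(1)[OF u] by (intro Bochner_Integration.integrable_add integrable_mult_right) auto
    show "AE \<omega> in M. norm (f' (Y u \<omega>) ^ 2) \<le> norm (2 * \<bar>f' 0\<bar>\<^sup>2 + 2 * Q\<^sup>2 * Y u \<omega> ^ 2)"
    proof (rule AE_I2)
      fix \<omega>
      have "\<bar>f' (Y u \<omega>)\<bar> \<le> \<bar>\<bar>f' 0\<bar> + Q * \<bar>Y u \<omega>\<bar>\<bar>" using lin[of "Y u \<omega>"] by linarith
      then have "f' (Y u \<omega>) ^ 2 \<le> (\<bar>f' 0\<bar> + Q * \<bar>Y u \<omega>\<bar>)\<^sup>2"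
        by (simp only: abs_le_square_iff)
      also have "\<dots> \<le> 2 * \<bar>f' 0\<bar>\<^sup>2 + 2 * (Q * \<bar>Y u \<omega>\<bar>)\<^sup>2"
        using zero_le_power2[of "\<bar>f' 0\<bar> - Q * \<bar>Y u \<omega>\<bar>"] unfolding power2_sum power2_diff by linarith
      finally show "norm (f' (Y u \<omega>) ^ 2) \<le> norm (2 * \<bar>f' 0\<bar>\<^sup>2 + 2 * Q\<^sup>2 * Y u \<omega> ^ 2)"
        by (simp add: power_mult_distrib)
    qed
  qed
  show "integrable M (\<lambda>\<omega>. f (Y t \<omega>))" by (rule int[OF t])
  define W where "W = L * (K\<^sup>2 * (1 + K\<^sup>2) + K\<^sup>2 + 3 * K ^ 4)"
  have E0: "expectation (\<lambda>\<omega>. f (Y 0 \<omega>)) = f 0"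
  proof -
    have "expectation (\<lambda>\<omega>. f (Y 0 \<omega>)) = expectation (\<lambda>\<omega>. f 0)"
    proof (rule integral_cong_AE)
      show "AE \<omega> in M. f (Y 0 \<omega>) = f 0" using Y_0 by eventually_elim simp
    qed (use mf(1)[of 0] T_pos in auto)
    then show ?thesis by (simp add: prob_space)
  qed
  show "expectation (\<lambda>\<omega>. f (Y t \<omega>)) \<le> f 0 + A / 2 * t"
  proof (cases "t = 0")
    case True
    then show ?thesis by (simp add: E0)
  next
    case False
    then have t0: "0 < t" using t by simp
    \<comment> \<open>\<open>n + 1\<close> steps of length \<open>d^2 = t / (n + 1)\<close>
      accumulate the error \<open>(n + 1) * W * d^3 = W * t * d\<close>, which vanishes as
      \<open>n\<close> grows, however large \<open>W\<close> is.\<close>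
    have step: "expectation (\<lambda>\<omega>. f (Y t \<omega>)) \<le> f 0 + A / 2 * t + W * t * sqrt (t / Suc n)" for n
    proof -
      define d where "d = sqrt (t / Suc n)"
      have d: "0 < d" "d\<^sup>2 = t / Suc n" using t0 by (auto simp: d_def)
      have nd: "real (Suc n) * d\<^sup>2 = t" unfolding d(2) by simp
      have "expectation (\<lambda>\<omega>. f (Y (real i * d\<^sup>2) \<omega>)) \<le> f 0 + A / 2 * (real i * d\<^sup>2) + real i * (W * d ^ 3)"
        if "i \<le> Suc n" for i
        using that
      proof (induction i)
        case (Suc i)
        have "real (Suc i) * d\<^sup>2 \<le> real (Suc n) * d\<^sup>2"
          using Suc.prems by (intro mult_right_mono) auto
        then have le: "real (Suc i) * d\<^sup>2 \<le> T" using nd t by simp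
        have "expectation (\<lambda>\<omega>. f (Y (real (Suc i) * d\<^sup>2) \<omega>)) \<le> expectation (\<lambda>\<omega>. f (Y (real i * d\<^sup>2) \<omega>))
          + A / 2 * (real (Suc i) * d\<^sup>2 - real i * d\<^sup>2) + W * d ^ 3"
          unfolding W_def
          by (rule one_step_expectation_le[OF f f' Q L int int' A _ _ le d(1)])
            (auto simp: algebra_simps)
        also have "\<dots> \<le> (f 0 + A / 2 * (real i * d\<^sup>2) + real i * (W * d ^ 3)) +
          A / 2 * (real (Suc i) * d\<^sup>2 - real i * d\<^sup>2) + W * d ^ 3"
          using Suc by simp
        also have "\<dots> = f 0 + A / 2 * (real (Suc i) * d\<^sup>2) + real (Suc i) * (W * d ^ 3)"
          by (simp add: algebra_simps add_divide_distrib)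
        finally show ?case .
      qed (simp add: E0)
      from this[of "Suc n"] have "expectation (\<lambda>\<omega>. f (Y t \<omega>)) \<le> f 0 + A / 2 * t + real (Suc n) * (W * d ^ 3)"
        unfolding nd by simp
      also have "real (Suc n) * (W * d ^ 3) = W * (real (Suc n) * d\<^sup>2) * d"
        by (simp add: power2_eq_square power3_eq_cube)
      also have "\<dots> = W * t * sqrt (t / Suc n)"
        unfolding nd by (simp add: d_def)
      finally show ?thesis .
    qed
    have "(\<lambda>n. t / real (Suc n)) \<longlonglongrightarrow> 0"
      by (rule LIMSEQ_Suc[OF lim_const_over_n])
    then have "(\<lambda>n. f 0 + A / 2 * t + W * t * sqrt (t / Suc n)) \<longlonglongrightarrow> f 0 + A / 2 * t + W * t * sqrt 0"
      by (intro tendsto_intros)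
    from LIMSEQ_le_const[OF this] step show ?thesis by auto
  qed
qed

text \<open>\<open>sgn (Y (tm k))\<close> is a subgradient of the absolute value, so the absolute
  value rises by at least this sign times the increment of \<open>Y\<close>. The maximum times the
  sign is known at \<open>tm k\<close>, and orthogonality removes the sum from the pathwise
  inequality.\<close>

lemma running_max_moments:
  assumes tm: "\<And>j. tm j \<in> {0..T}" "\<And>j. tm j \<le> tm (Suc j)"
  defines "m \<equiv> \<lambda>n \<omega>. running_max (\<lambda>k. \<bar>Y (tm k) \<omega>\<bar>) n"
  shows "m n \<in> borel_measurable (F (tm n))" and "integrable M (\<lambda>\<omega>. m n \<omega> ^ 2)"
    and "expectation (\<lambda>\<omega>. m n \<omega> ^ 2) \<le> 4 * expectation (\<lambda>\<omega>. Y (tm n) \<omega> ^ 2)"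
proof -
  have mY: "(\<lambda>\<omega>. \<bar>Y (tm k) \<omega>\<bar>) \<in> borel_measurable (F (tm k))" for k
    using Y_adapted[OF tm(1)[of k]] by (rule borel_measurable_abs)
  have mm: "m n \<in> borel_measurable (F (tm n))" for n
  proof (induction n)
    case (Suc n)
    have "(\<lambda>\<omega>. max (m n \<omega>) \<bar>Y (tm (Suc n)) \<omega>\<bar>) \<in> borel_measurable (F (tm (Suc n)))"
      by (intro borel_measurable_max mY measurable_F_mono[OF tm(2) Suc])
    then show ?case by (simp add: m_def)
  qed (use mY[of 0] in \<open>simp add: m_def\<close>)
  then show "m n \<in> borel_measurable (F (tm n))" .
  have iY: "integrable M (\<lambda>\<omega>. Y (tm k) \<omega> ^ 2)" for k
    by (rule Y_power_integrable[OF tm(1)]) simp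
  have im: "integrable M (\<lambda>\<omega>. m n \<omega> ^ 2)" for n
  proof (induction n)
    case (Suc n)
    show ?case
    proof (rule Bochner_Integration.integrable_bound)
      show "integrable M (\<lambda>\<omega>. m n \<omega> ^ 2 + Y (tm (Suc n)) \<omega> ^ 2)"
        using Suc iY by simp
      show "(\<lambda>\<omega>. m (Suc n) \<omega> ^ 2) \<in> borel_measurable M"
        by (intro borel_measurable_power measurable_F_M[OF mm])
      show "AE \<omega> in M. norm (m (Suc n) \<omega> ^ 2) \<le> norm (m n \<omega> ^ 2 + Y (tm (Suc n)) \<omega> ^ 2)"
        by (intro AE_I2) (simp add: m_def max_def)
    qed
  qed (use iY in \<open>simp add: m_def\<close>)
  then show "integrable M (\<lambda>\<omega>. m n \<omega> ^ 2)" .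
  define Z where "Z k \<omega> = m k \<omega> * sgn (Y (tm k) \<omega>)" for k \<omega>
  have mZ: "Z k \<in> borel_measurable (F (tm k))" for k
    unfolding Z_def[abs_def]
    by (intro borel_measurable_times mm measurable_compose[OF Y_adapted[OF tm(1)] borel_measurable_sgn])
  have iZ: "integrable M (\<lambda>\<omega>. Z k \<omega> ^ 2)" for k
  proof (rule Bochner_Integration.integrable_bound[OF im[of k]])
    show "(\<lambda>\<omega>. Z k \<omega> ^ 2) \<in> borel_measurable M"
      by (intro borel_measurable_power measurable_F_M[OF mZ])
    show "AE \<omega> in M. norm (Z k \<omega> ^ 2) \<le> norm (m k \<omega> ^ 2)"
      by (intro AE_I2) (simp add: Z_def power_mult_distrib sgn_if)
  qed
  have st: "0 \<le> tm k" "tm k \<le> tm (Suc k)" "tm (Suc k) \<le> T" for k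
    using tm(1)[of k] tm(1)[of "Suc k"] tm(2)[of k] by auto
  note orth = increment_orthogonal[OF st mZ iZ]
  have m0: "0 \<le> m k \<omega>" for k \<omega>
    using running_max_ge[of 0 k "\<lambda>k. \<bar>Y (tm k) \<omega>\<bar>"] unfolding m_def by (meson abs_ge_zero order_trans zero_le)
  have "m n \<omega> ^ 2 \<le> 4 * Y (tm n) \<omega> ^ 2 - 4 * (\<Sum>k<n. Z k \<omega> * (Y (tm (Suc k)) \<omega> - Y (tm k) \<omega>))" for \<omega>
  proof -
    have "Z k \<omega> * (Y (tm (Suc k)) \<omega> - Y (tm k) \<omega>) \<le> m k \<omega> * (\<bar>Y (tm (Suc k)) \<omega>\<bar> - \<bar>Y (tm k) \<omega>\<bar>)" for k
      unfolding Z_def mult.assoc using m0 by (intro mult_left_mono) (auto simp: sgn_if)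
    then have "(\<Sum>k<n. Z k \<omega> * (Y (tm (Suc k)) \<omega> - Y (tm k) \<omega>)) \<le>
      (\<Sum>k<n. m k \<omega> * (\<bar>Y (tm (Suc k)) \<omega>\<bar> - \<bar>Y (tm k) \<omega>\<bar>))"
      by (intro sum_mono)
    moreover have "m n \<omega> ^ 2 \<le> 4 * Y (tm n) \<omega> ^ 2 - 4 * (\<Sum>k<n. m k \<omega> * (\<bar>Y (tm (Suc k)) \<omega>\<bar> - \<bar>Y (tm k) \<omega>\<bar>))"
      using running_max_square_le[of "\<lambda>k. \<bar>Y (tm k) \<omega>\<bar>" n] by (simp add: m_def)
    ultimately show ?thesis by linarith
  qed
  then have "expectation (\<lambda>\<omega>. m n \<omega> ^ 2) \<le>
    expectation (\<lambda>\<omega>. 4 * Y (tm n) \<omega> ^ 2 - 4 * (\<Sum>k<n. Z k \<omega> * (Y (tm (Suc k)) \<omega> - Y (tm k) \<omega>)))"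
    using im iY orth(1) by (intro integral_mono Bochner_Integration.integrable_diff integrable_mult_right
      Bochner_Integration.integrable_sum) auto
  also have "\<dots> = 4 * expectation (\<lambda>\<omega>. Y (tm n) \<omega> ^ 2) -
    4 * (\<Sum>k<n. expectation (\<lambda>\<omega>. Z k \<omega> * (Y (tm (Suc k)) \<omega> - Y (tm k) \<omega>)))"
  proof -
    have isum: "integrable M (\<lambda>\<omega>. \<Sum>k<n. Z k \<omega> * (Y (tm (Suc k)) \<omega> - Y (tm k) \<omega>))"
      by (intro Bochner_Integration.integrable_sum orth(1))
    show ?thesis
      using Bochner_Integration.integral_diff[OF integrable_mult_right[OF iY[of n], of 4] integrable_mult_right[OF isum, of 4]]
        Bochner_Integration.integral_sum[of "{..<n}" M "\<lambda>k \<omega>. Z k \<omega> * (Y (tm (Suc k)) \<omega> - Y (tm k) \<omega>)", OF orth(1)]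
      by simp
  qed
  also have "\<dots> = 4 * expectation (\<lambda>\<omega>. Y (tm n) \<omega> ^ 2)"
    by (simp add: orth(2))
  finally show "expectation (\<lambda>\<omega>. m n \<omega> ^ 2) \<le> 4 * expectation (\<lambda>\<omega>. Y (tm n) \<omega> ^ 2)" .
qed

text \<open>By continuity of paths the supremum is at most a limit inferior of maxima over
  equidistant grids, and Fatou's lemma takes the limit out. The uncountable supremum is only
  compared from above, so its measurability is never at issue. The \<open>5\<close> comes from
  \<open>x <= sqrt v + x^2 / sqrt v\<close> and Doob's bound \<open>4 * v\<close>.\<close>

lemma sup_expectation_le:
  assumes cont: "AE \<omega> in M. continuous_on {0..T} (\<lambda>t. Y t \<omega>)"
    and v: "expectation (\<lambda>\<omega>. Y T \<omega> ^ 2) \<le> v" "0 < v"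
  shows "(\<integral>\<^sup>+\<omega>. (SUP t\<in>{0..T}. ennreal \<bar>Y t \<omega>\<bar>) \<partial>M) \<le> ennreal (5 * sqrt v)"
proof -
  \<comment> \<open>The index is capped so that the grid rests at \<open>T\<close> beyond
    \<open>Suc N\<close>, because \<open>running_max_moments\<close> expects times in
    \<open>{0..T}\<close> for every index.\<close>
  define tm where "tm N j = T * real (min j (Suc N)) / real (Suc N)" for N j :: nat
  define m where "m N \<omega> = running_max (\<lambda>k. \<bar>Y (tm N k) \<omega>\<bar>) (Suc N)" for N \<omega>
  have tm: "tm N j \<in> {0..T}" "tm N j \<le> tm N (Suc j)" for N j
  proof -
    have "T * real (min j (Suc N)) \<le> T * real (Suc N)"
      using T_pos by (intro mult_left_mono) auto
    then show "tm N j \<in> {0..T}"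
      using T_pos by (simp add: tm_def divide_le_eq)
    show "tm N j \<le> tm N (Suc j)"
      unfolding tm_def using T_pos by (intro divide_right_mono mult_left_mono) auto
  qed
  have end_time: "tm N (Suc N) = T" for N by (simp add: tm_def)
  have m0: "0 \<le> m N \<omega>" for N \<omega>
    using running_max_ge[of 0 "Suc N" "\<lambda>k. \<bar>Y (tm N k) \<omega>\<bar>"] unfolding m_def
    by (meson abs_ge_zero order_trans zero_le)
  have mm: "m N \<in> borel_measurable M" for N
    using running_max_moments(1)[of "tm N" "Suc N", OF tm] unfolding m_def[abs_def] by (rule measurable_F_M)
  have i2: "integrable M (\<lambda>\<omega>. m N \<omega> ^ 2)" for N
    using running_max_moments(2)[of "tm N" "Suc N", OF tm] unfolding m_def .
  have E2: "expectation (\<lambda>\<omega>. m N \<omega> ^ 2) \<le> 4 * v" for N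
    using running_max_moments(3)[of "tm N" "Suc N", OF tm] v(1) unfolding m_def end_time by linarith
  have i1: "integrable M (m N)" for N
    using integrable_mult_squares[OF mm _ i2, of "\<lambda>_. 1" N] by simp
  have E1: "expectation (m N) \<le> 5 * sqrt v" for N
  proof -
    have "x \<le> sqrt v + x\<^sup>2 / sqrt v" for x :: real
      using abs_mult_le_weighted_squares[of "sqrt v" 1 x] v(2) by simp
    then have "expectation (m N) \<le> expectation (\<lambda>\<omega>. sqrt v + m N \<omega> ^ 2 / sqrt v)"
      using i1 i2[of N] by (intro integral_mono) auto
    also have "\<dots> = sqrt v + expectation (\<lambda>\<omega>. m N \<omega> ^ 2) / sqrt v"
      using i2[of N] by (simp add: prob_space)
    also have "\<dots> \<le> sqrt v + (4 * v) / sqrt v"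
      using E2[of N] v(2) by (intro add_left_mono divide_right_mono) auto
    also have "\<dots> = 5 * sqrt v"
      using v(2) by (simp add: real_div_sqrt flip: times_divide_eq_right)
    finally show ?thesis .
  qed
  have "(\<integral>\<^sup>+\<omega>. (SUP t\<in>{0..T}. ennreal \<bar>Y t \<omega>\<bar>) \<partial>M) \<le> (\<integral>\<^sup>+\<omega>. liminf (\<lambda>N. ennreal (m N \<omega>)) \<partial>M)"
  proof (rule nn_integral_mono_AE, use cont in eventually_elim)
    case (elim \<omega>)
    show ?case
    proof (rule SUP_least)
      fix t assume t: "t \<in> {0..T}"
      \<comment> \<open>The last grid index not after \<open>t\<close>; its grid point is within one
        mesh of \<open>t\<close>.\<close>
      define j where "j N = nat \<lfloor>t * real (Suc N) / T\<rfloor>" for N :: nat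
      have x: "0 \<le> t * real (Suc N) / T" "t * real (Suc N) / T \<le> real (Suc N)" for N
        using t T_pos by (auto simp: divide_le_eq mult.commute intro!: mult_left_mono mult_right_mono)
      have jx: "real (j N) \<le> t * real (Suc N) / T" "t * real (Suc N) / T < real (j N) + 1" for N
        using x(1)[of N] unfolding j_def by (simp, linarith)
      have jN: "j N \<le> Suc N" for N
        using jx(1)[of N] x(2)[of N] by linarith
      have tj: "tm N (j N) = T / real (Suc N) * real (j N)" for N
        using jN[of N] by (simp add: tm_def min_def)
      have dist: "\<bar>tm N (j N) - t\<bar> \<le> T / real (Suc N)" for N
      proof -
        have t': "T / real (Suc N) * (t * real (Suc N) / T) = t" using T_pos by simp
        have p: "0 \<le> T / real (Suc N)" using T_pos by simp
        have "T / real (Suc N) * real (j N) \<le> t"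
          using mult_left_mono[OF jx(1)[of N] p] unfolding t' .
        moreover have "t \<le> T / real (Suc N) * (real (j N) + 1)"
          using mult_left_mono[OF less_imp_le[OF jx(2)[of N]] p] unfolding t' .
        ultimately show ?thesis unfolding tj by (simp add: distrib_left)
      qed
      have "(\<lambda>N. T / real (Suc N)) \<longlonglongrightarrow> 0"
        by (rule LIMSEQ_Suc[OF lim_const_over_n])
      then have "(\<lambda>N. tm N (j N) - t) \<longlonglongrightarrow> 0"
        by (rule Lim_null_comparison[rotated]) (use dist in auto)
      then have "(\<lambda>N. tm N (j N)) \<longlonglongrightarrow> t" by (simp add: LIM_zero_iff)
      then have "(\<lambda>N. Y (tm N (j N)) \<omega>) \<longlonglongrightarrow> Y t \<omega>"
        by (rule continuous_on_tendsto_compose[OF elim]) (use t tm in auto)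
      then have "(\<lambda>N. ennreal \<bar>Y (tm N (j N)) \<omega>\<bar>) \<longlonglongrightarrow> ennreal \<bar>Y t \<omega>\<bar>"
        by (intro tendsto_ennrealI tendsto_rabs)
      then have "ennreal \<bar>Y t \<omega>\<bar> = liminf (\<lambda>N. ennreal \<bar>Y (tm N (j N)) \<omega>\<bar>)"
        by (rule lim_imp_Liminf[OF sequentially_bot, symmetric])
      also have "\<dots> \<le> liminf (\<lambda>N. ennreal (m N \<omega>))"
        using running_max_ge[OF jN] by (intro Liminf_mono always_eventually allI ennreal_leI) (simp add: m_def)
      finally show "ennreal \<bar>Y t \<omega>\<bar> \<le> liminf (\<lambda>N. ennreal (m N \<omega>))" .
    qed
  qed
  also have "\<dots> \<le> liminf (\<lambda>N. \<integral>\<^sup>+\<omega>. ennreal (m N \<omega>) \<partial>M)"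
    using mm by (intro nn_integral_liminf measurable_compose[OF _ measurable_ennreal])
  also have "\<dots> \<le> limsup (\<lambda>N. \<integral>\<^sup>+\<omega>. ennreal (m N \<omega>) \<partial>M)"
    by (rule Liminf_le_Limsup) simp
  also have "\<dots> \<le> ennreal (5 * sqrt v)"
    by (intro Limsup_bounded always_eventually allI)
      (simp add: nn_integral_eq_integral[OF i1] m0 ennreal_leI[OF E1])
  finally show ?thesis .
qed

end

section \<open>Linearity of the Ito integral\<close>

context brownian_setting
begin

text \<open>On a common partition the coefficients are subtracted, and squared errors at most double
  their sum; the doubling is written as addition to use the closure of
  \<open>vanishes_in_prob\<close> under sums.\<close>

lemma has_ito_integral_diff:
  assumes t: "0 \<le> t" and J1: "has_ito_integral M F B H1 t J1" and J2: "has_ito_integral M F B H2 t J2"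
  shows "has_ito_integral M F B (\<lambda>s \<omega>. H1 s \<omega> - H2 s \<omega>) t (\<lambda>\<omega>. J1 \<omega> - J2 \<omega>)"
proof (rule has_ito_integral_approx2[OF J1 t J2 t])
  fix m \<tau> \<xi> \<eta> assume s: "\<And>k. simple_integrand M F (m k) (\<tau> k) (\<xi> k)" "\<And>k. simple_integrand M F (m k) (\<tau> k) (\<eta> k)"
    and E1: "vanishes_in_prob (\<lambda>k \<omega>. sq_err 0 t H1 (m k) (\<tau> k) (\<xi> k) \<omega>)"
    and E2: "vanishes_in_prob (\<lambda>k \<omega>. sq_err 0 t H2 (m k) (\<tau> k) (\<eta> k) \<omega>)"
    and I1: "vanishes_in_prob (\<lambda>k \<omega>. ennreal \<bar>step_integral B (m k) (\<tau> k) (\<xi> k) t \<omega> - J1 \<omega>\<bar>)"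
    and I2: "vanishes_in_prob (\<lambda>k \<omega>. ennreal \<bar>step_integral B (m k) (\<tau> k) (\<eta> k) t \<omega> - J2 \<omega>\<bar>)"
  have prog: "progressive_on F t H1" "progressive_on F t H2"
    and mJ: "J1 \<in> borel_measurable M" "J2 \<in> borel_measurable M"
    and fin: "AE \<omega> in M. (\<integral>\<^sup>+s\<in>{0..t}. ennreal ((H1 s \<omega>)\<^sup>2) \<partial>lborel) < \<infinity>"
      "AE \<omega> in M. (\<integral>\<^sup>+s\<in>{0..t}. ennreal ((H2 s \<omega>)\<^sup>2) \<partial>lborel) < \<infinity>"
    using J1 J2 unfolding has_ito_integral_def by auto
  let ?L = "lebesgue_on_ivl 0 t"
  define G where "G k i \<omega> = \<xi> k i \<omega> - \<eta> k i \<omega>" for k i \<omega>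
  have mH: "(\<lambda>(\<omega>, u). H1 u \<omega>) \<in> borel_measurable (M \<Otimes>\<^sub>M ?L)" "(\<lambda>(\<omega>, u). H2 u \<omega>) \<in> borel_measurable (M \<Otimes>\<^sub>M ?L)"
    using progressive_joint_measurable[OF prog(1) order_refl t] progressive_joint_measurable[OF prog(2) order_refl t] .
  have mD: "(\<lambda>(\<omega>, u). H1 u \<omega> - step_process (m k) (\<tau> k) (\<xi> k) u \<omega>) \<in> borel_measurable (M \<Otimes>\<^sub>M ?L)"
    "(\<lambda>(\<omega>, u). H2 u \<omega> - step_process (m k) (\<tau> k) (\<eta> k) u \<omega>) \<in> borel_measurable (M \<Otimes>\<^sub>M ?L)" for k
    using borel_measurable_diff[OF mH(1) step_process_joint_measurable[OF s(1), of k 0 t]]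
      borel_measurable_diff[OF mH(2) step_process_joint_measurable[OF s(2), of k 0 t]]
    unfolding split_beta' .
  have mL: "(\<lambda>u. f u \<omega>) \<in> borel_measurable ?L"
    if "(\<lambda>(\<omega>, u). f u \<omega>) \<in> borel_measurable (M \<Otimes>\<^sub>M ?L)" "\<omega> \<in> space M" for f :: "real \<Rightarrow> 'a \<Rightarrow> real" and \<omega>
    using measurable_compose_Pair1[OF that(2,1)] unfolding prod.case .
  have sq: "(x - y)\<^sup>2 \<le> (x\<^sup>2 + x\<^sup>2) + (y\<^sup>2 + y\<^sup>2)" for x y :: real
    using zero_le_power2[of "x + y"] by (simp add: power2_eq_square algebra_simps)
  have le: "(\<integral>\<^sup>+u. ennreal ((f u - g u)\<^sup>2) \<partial>?L) \<le>
    ((\<integral>\<^sup>+u. ennreal ((f u)\<^sup>2) \<partial>?L) + (\<integral>\<^sup>+u. ennreal ((f u)\<^sup>2) \<partial>?L)) +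
    ((\<integral>\<^sup>+u. ennreal ((g u)\<^sup>2) \<partial>?L) + (\<integral>\<^sup>+u. ennreal ((g u)\<^sup>2) \<partial>?L))"
    if [measurable]: "f \<in> borel_measurable ?L" "g \<in> borel_measurable ?L" for f g :: "real \<Rightarrow> real"
  proof -
    have "(\<integral>\<^sup>+u. ennreal ((f u - g u)\<^sup>2) \<partial>?L) \<le>
      (\<integral>\<^sup>+u. (ennreal ((f u)\<^sup>2) + ennreal ((f u)\<^sup>2)) + (ennreal ((g u)\<^sup>2) + ennreal ((g u)\<^sup>2)) \<partial>?L)"
      using sq by (intro nn_integral_mono) (simp flip: ennreal_plus)
    also have "\<dots> = ((\<integral>\<^sup>+u. ennreal ((f u)\<^sup>2) \<partial>?L) + (\<integral>\<^sup>+u. ennreal ((f u)\<^sup>2) \<partial>?L)) +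
      ((\<integral>\<^sup>+u. ennreal ((g u)\<^sup>2) \<partial>?L) + (\<integral>\<^sup>+u. ennreal ((g u)\<^sup>2) \<partial>?L))"
      by (simp add: nn_integral_add)
    finally show ?thesis .
  qed
  have "progressive_on F t (\<lambda>s \<omega>. H1 s \<omega> - H2 s \<omega>)"
    unfolding progressive_on_def
  proof
    fix u assume u: "u \<in> {0..t}"
    show "(\<lambda>(s, \<omega>). H1 s \<omega> - H2 s \<omega>) \<in> borel_measurable (restrict_space borel {0..u} \<Otimes>\<^sub>M F u)"
      using borel_measurable_diff[OF bspec[OF prog(1)[unfolded progressive_on_def] u]
        bspec[OF prog(2)[unfolded progressive_on_def] u]]
      unfolding split_beta' .
  qed
  moreover have "AE \<omega> in M. (\<integral>\<^sup>+s\<in>{0..t}. ennreal ((H1 s \<omega> - H2 s \<omega>)\<^sup>2) \<partial>lborel) < \<infinity>"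
    using fin AE_space
  proof eventually_elim
    case (elim \<omega>)
    have "(\<integral>\<^sup>+s. ennreal ((H1 s \<omega> - H2 s \<omega>)\<^sup>2) \<partial>?L) < \<infinity>"
      using elim by (intro le_less_trans[OF le[OF mL[OF mH(1) elim(3)] mL[OF mH(2) elim(3)]]])
        (simp add: nn_integral_restrict_space ennreal_add_less_top)
    then show ?case by (simp add: nn_integral_restrict_space)
  qed
  moreover have "(\<lambda>\<omega>. J1 \<omega> - J2 \<omega>) \<in> borel_measurable M"
    using mJ by (rule borel_measurable_diff)
  moreover have "simple_integrand M F (m k) (\<tau> k) (G k)" for k
    unfolding G_def[abs_def] by (rule simple_integrand_diff[OF s])
  moreover have "vanishes_in_prob (\<lambda>k \<omega>. \<integral>\<^sup>+u. ennreal ((H1 u \<omega> - H2 u \<omega> - step_process (m k) (\<tau> k) (G k) u \<omega>)\<^sup>2) \<partial>?L)"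
  proof (rule vanishes_in_prob_mono)
    let ?A = "\<lambda>k \<omega>. \<integral>\<^sup>+u. ennreal ((H1 u \<omega> - step_process (m k) (\<tau> k) (\<xi> k) u \<omega>)\<^sup>2) \<partial>?L"
    let ?B = "\<lambda>k \<omega>. \<integral>\<^sup>+u. ennreal ((H2 u \<omega> - step_process (m k) (\<tau> k) (\<eta> k) u \<omega>)\<^sup>2) \<partial>?L"
    note mE = measurable_square_integral[OF mD(1)] measurable_square_integral[OF mD(2)]
    show "vanishes_in_prob (\<lambda>k \<omega>. (?A k \<omega> + ?A k \<omega>) + (?B k \<omega> + ?B k \<omega>))"
      by (intro vanishes_in_prob_add E1 E2 borel_measurable_add mE)
    show "(\<lambda>\<omega>. (?A k \<omega> + ?A k \<omega>) + (?B k \<omega> + ?B k \<omega>)) \<in> borel_measurable M" for k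
      by (intro borel_measurable_add mE)
    fix k \<omega> assume \<omega>: "\<omega> \<in> space M"
    have "(\<integral>\<^sup>+u. ennreal ((H1 u \<omega> - H2 u \<omega> - step_process (m k) (\<tau> k) (G k) u \<omega>)\<^sup>2) \<partial>?L) =
      (\<integral>\<^sup>+u. ennreal (((H1 u \<omega> - step_process (m k) (\<tau> k) (\<xi> k) u \<omega>) - (H2 u \<omega> - step_process (m k) (\<tau> k) (\<eta> k) u \<omega>))\<^sup>2) \<partial>?L)"
      unfolding G_def[abs_def] step_process_diff by (simp add: algebra_simps)
    also have "\<dots> \<le> (?A k \<omega> + ?A k \<omega>) + (?B k \<omega> + ?B k \<omega>)"
      by (rule le[OF mL[OF mD(1) \<omega>] mL[OF mD(2) \<omega>]])
    finally show "(\<integral>\<^sup>+u. ennreal ((H1 u \<omega> - H2 u \<omega> - step_process (m k) (\<tau> k) (G k) u \<omega>)\<^sup>2) \<partial>?L) \<le>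
      (?A k \<omega> + ?A k \<omega>) + (?B k \<omega> + ?B k \<omega>)" .
  qed
  moreover have "vanishes_in_prob (\<lambda>k \<omega>. ennreal \<bar>step_integral B (m k) (\<tau> k) (G k) t \<omega> - (J1 \<omega> - J2 \<omega>)\<bar>)"
  proof (rule vanishes_in_prob_mono[OF vanishes_in_prob_add[OF I1 _ I2]])
    note mi = step_integral_measurable[OF s(1) t] step_integral_measurable[OF s(2) t]
    show "(\<lambda>\<omega>. ennreal \<bar>step_integral B (m k) (\<tau> k) (\<xi> k) t \<omega> - J1 \<omega>\<bar>) \<in> borel_measurable M"
      "(\<lambda>\<omega>. ennreal \<bar>step_integral B (m k) (\<tau> k) (\<eta> k) t \<omega> - J2 \<omega>\<bar>) \<in> borel_measurable M"
      "(\<lambda>\<omega>. ennreal \<bar>step_integral B (m k) (\<tau> k) (\<xi> k) t \<omega> - J1 \<omega>\<bar> +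
        ennreal \<bar>step_integral B (m k) (\<tau> k) (\<eta> k) t \<omega> - J2 \<omega>\<bar>) \<in> borel_measurable M" for k
      by (intro borel_measurable_add measurable_compose[OF borel_measurable_abs measurable_ennreal] borel_measurable_diff mi mJ)+
    fix k \<omega>
    have "\<bar>step_integral B (m k) (\<tau> k) (G k) t \<omega> - (J1 \<omega> - J2 \<omega>)\<bar> \<le>
      \<bar>step_integral B (m k) (\<tau> k) (\<xi> k) t \<omega> - J1 \<omega>\<bar> + \<bar>step_integral B (m k) (\<tau> k) (\<eta> k) t \<omega> - J2 \<omega>\<bar>"
      unfolding G_def[abs_def] step_integral_diff by linarith
    from ennreal_leI[OF this]
    show "ennreal \<bar>step_integral B (m k) (\<tau> k) (G k) t \<omega> - (J1 \<omega> - J2 \<omega>)\<bar> \<le>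
      ennreal \<bar>step_integral B (m k) (\<tau> k) (\<xi> k) t \<omega> - J1 \<omega>\<bar> + ennreal \<bar>step_integral B (m k) (\<tau> k) (\<eta> k) t \<omega> - J2 \<omega>\<bar>"
      by simp
  qed
  ultimately show ?thesis
    unfolding has_ito_integral_def vanishes_in_prob_def
    by (intro conjI exI[of _ m] exI[of _ \<tau>] exI[of _ G]) (auto simp: nn_integral_restrict_space ennreal_less_iff)
qed

end

section \<open>Test functions\<close>

lemma sqrt_square_sum_bounds:
  fixes d x :: real
  assumes "0 < d"
  shows "\<bar>x\<bar> \<le> sqrt (d\<^sup>2 + x\<^sup>2)" "d \<le> sqrt (d\<^sup>2 + x\<^sup>2)" "0 < sqrt (d\<^sup>2 + x\<^sup>2)"
    "sqrt (d\<^sup>2 + x\<^sup>2) \<le> d + \<bar>x\<bar>"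
proof -
  show "\<bar>x\<bar> \<le> sqrt (d\<^sup>2 + x\<^sup>2)" by (rule real_le_rsqrt) simp
  show d: "d \<le> sqrt (d\<^sup>2 + x\<^sup>2)" by (rule real_le_rsqrt) simp
  then show "0 < sqrt (d\<^sup>2 + x\<^sup>2)" using assms by linarith
  show "sqrt (d\<^sup>2 + x\<^sup>2) \<le> d + \<bar>x\<bar>"
    using assms by (intro real_le_lsqrt) (auto simp: power2_sum)
qed

lemma has_derivative_sqrt_square_sum:
  fixes d x :: real
  assumes "0 < d"
  shows "((\<lambda>x. sqrt (d\<^sup>2 + x\<^sup>2)) has_real_derivative x / sqrt (d\<^sup>2 + x\<^sup>2)) (at x)"
proof -
  have "0 < d\<^sup>2 + x\<^sup>2" using assms by (simp add: add_pos_nonneg)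
  then show ?thesis by (auto intro!: derivative_eq_intros simp: field_simps)
qed

lemma lipschitz_of_derivative_bound:
  fixes f f' :: "real \<Rightarrow> real"
  assumes "\<And>x. (f has_real_derivative f' x) (at x)" "\<And>x. \<bar>f' x\<bar> \<le> L"
  shows "\<bar>f x - f y\<bar> \<le> L * \<bar>x - y\<bar>"
  using field_differentiable_bound[of UNIV f f' L x y] assms
  by (auto intro: has_field_derivative_at_within)

context bounded_ito_process
begin

text \<open>The test function is \<open>\<phi>(x) = sqrt (d\<^sup>2 + x\<^sup>2)\<close>: then
  \<open>\<phi>''(x) \<bar>x\<bar>\<^bsup>b\<^esup> \<le> d\<^bsup>b-1\<^esup>\<close>, which for \<open>b > 1\<close> tends to \<open>0\<close> with \<open>d\<close>.\<close>

lemma abs_expectation_le_powr: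
  assumes d: "0 < d" and b: "1 \<le> b" "b \<le> 3" and e: "0 \<le> e" and k: "0 \<le> k"
    and H: "\<And>u \<omega>. u \<in> {0..T} \<Longrightarrow> \<omega> \<in> space M \<Longrightarrow> H u \<omega> ^ 2 \<le> 2 * e + 2 * k * \<bar>Y u \<omega>\<bar> powr b"
    and t: "t \<in> {0..T}"
  shows "expectation (\<lambda>\<omega>. \<bar>Y t \<omega>\<bar>) \<le> d + t * (e / d + k * d powr (b - 1))"
proof -
  define w where "w x = sqrt (d\<^sup>2 + x\<^sup>2)" for x
  note w = sqrt_square_sum_bounds[OF d, folded w_def]
  have w2: "w x ^ 2 = d\<^sup>2 + x\<^sup>2" for x by (simp add: w_def)
  have Dw: "(w has_real_derivative x / w x) (at x)" for x
    unfolding w_def[abs_def] by (rule has_derivative_sqrt_square_sum[OF d])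
  have D1: "((\<lambda>x. x / w x) has_real_derivative d\<^sup>2 / w x ^ 3) (at x)" for x
  proof -
    have "((\<lambda>x. x / w x) has_real_derivative (1 * w x - x * (x / w x)) / (w x * w x)) (at x)"
      using w(3)[of x] by (intro DERIV_divide DERIV_ident Dw) auto
    moreover have "(1 * w x - x * (x / w x)) / (w x * w x) = d\<^sup>2 / w x ^ 3"
    proof -
      have "1 * w x - x * (x / w x) = (w x ^ 2 - x\<^sup>2) / w x"
        using w(3)[of x] by (simp add: power2_eq_square field_simps)
      then show ?thesis by (simp add: w2 power3_eq_cube)
    qed
    ultimately show ?thesis by simp
  qed
  have D2: "((\<lambda>x. d\<^sup>2 / w x ^ 3) has_real_derivative (- 3 * d\<^sup>2 * x / w x ^ 5)) (at x)" for x
  proof -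
    have "((\<lambda>x. d\<^sup>2 / w x ^ 3) has_real_derivative
      (0 * w x ^ 3 - d\<^sup>2 * (of_nat 3 * (x / w x * w x ^ (3 - Suc 0)))) / (w x ^ 3 * w x ^ 3)) (at x)"
      using w(3)[of x] by (intro DERIV_divide DERIV_const DERIV_power Dw) auto
    moreover have "(0 * w x ^ 3 - d\<^sup>2 * (of_nat 3 * (x / w x * w x ^ (3 - Suc 0)))) / (w x ^ 3 * w x ^ 3) =
      - 3 * d\<^sup>2 * x / w x ^ 5"
      using w(3)[of x] by (simp add: field_simps eval_nat_numeral)
    ultimately show ?thesis by simp
  qed
  have pw: "d ^ n \<le> w x ^ n" for n x
    using w(2)[of x] d by (intro power_mono) auto
  have Q: "\<bar>d\<^sup>2 / w x ^ 3\<bar> \<le> 1 / d" for x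
  proof -
    have "d\<^sup>2 / w x ^ 3 \<le> d\<^sup>2 / d ^ 3"
      using pw[of 3 x] d w(3)[of x] by (intro divide_left_mono) auto
    then show ?thesis using w(3)[of x] d by (simp add: power3_eq_cube power2_eq_square)
  qed
  have L: "\<bar>- 3 * d\<^sup>2 * x / w x ^ 5\<bar> \<le> 3 / d\<^sup>2" for x
  proof -
    have "\<bar>- 3 * d\<^sup>2 * x / w x ^ 5\<bar> = 3 * d\<^sup>2 * \<bar>x\<bar> / w x ^ 5"
      using w(3)[of x] by (simp add: abs_mult)
    also have "\<dots> \<le> 3 * d\<^sup>2 * w x / w x ^ 5"
      using w(1)[of x] w(3)[of x] by (intro divide_right_mono mult_left_mono) auto
    also have "\<dots> = 3 * d\<^sup>2 / w x ^ 4"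
      using w(3)[of x] by (simp add: eval_nat_numeral)
    also have "\<dots> \<le> 3 * d\<^sup>2 / d ^ 4"
      using pw[of 4 x] d w(3)[of x] by (intro divide_left_mono) auto
    also have "\<dots> = 3 / d\<^sup>2"
      using d by (simp add: eval_nat_numeral)
    finally show ?thesis .
  qed
  \<comment> \<open>The factor \<open>2\<close> cancels against the \<open>A / 2\<close> in the
    generator bound.\<close>
  have A: "d\<^sup>2 / w (Y u \<omega>) ^ 3 * H u \<omega> ^ 2 \<le> 2 * (e / d + k * d powr (b - 1))"
    if "u \<in> {0..T}" "\<omega> \<in> space M" for u \<omega>
  proof -
    define y where "y = Y u \<omega>"
    have q0: "0 \<le> d\<^sup>2 / w y ^ 3" using w(3)[of y] by simp
    have "d\<^sup>2 / w y ^ 3 * \<bar>y\<bar> powr b \<le> d\<^sup>2 / w y ^ 3 * w y powr b"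
      using q0 w(1)[of y] b by (intro mult_left_mono powr_mono2) auto
    also have "\<dots> = d\<^sup>2 * w y powr (b - 3)"
      using w(3)[of y] by (simp add: powr_diff)
    \<comment> \<open>By \<open>b <= 3\<close> the exponent is nonpositive, so
      \<open>w y >= d\<close> gives an upper bound.\<close>
    also have "\<dots> \<le> d\<^sup>2 * d powr (b - 3)"
      using w(2)[of y] d b by (intro mult_left_mono powr_mono2') auto
    also have "\<dots> = d powr (b - 1)"
      using d by (simp add: powr_diff field_simps eval_nat_numeral)
    finally have 1: "d\<^sup>2 / w y ^ 3 * \<bar>y\<bar> powr b \<le> d powr (b - 1)" .
    have "d\<^sup>2 / w y ^ 3 * H u \<omega> ^ 2 \<le> d\<^sup>2 / w y ^ 3 * (2 * e + 2 * k * \<bar>y\<bar> powr b)"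
      using H[OF that] q0 unfolding y_def by (intro mult_left_mono)
    also have "\<dots> = 2 * (e * (d\<^sup>2 / w y ^ 3) + k * (d\<^sup>2 / w y ^ 3 * \<bar>y\<bar> powr b))"
      by (simp add: algebra_simps)
    also have "\<dots> \<le> 2 * (e * (1 / d) + k * d powr (b - 1))"
      using abs_le_D1[OF Q[of y]] 1 e k by (intro mult_left_mono add_mono) auto
    finally show ?thesis by (simp add: y_def)
  qed
  note g = expectation_le_of_generator_bound[OF Dw D1 Q lipschitz_of_derivative_bound[OF D2 L] A t]
  have "expectation (\<lambda>\<omega>. \<bar>Y t \<omega>\<bar>) \<le> expectation (\<lambda>\<omega>. w (Y t \<omega>))"
    using integrable_abs[OF Y_power_integrable[OF t, of 1]] g(1) w(1) by (intro integral_mono) auto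
  also have "\<dots> \<le> w 0 + 2 * (e / d + k * d powr (b - 1)) / 2 * t"
    by (rule g(2))
  also have "w 0 = d" using d by (simp add: w_def)
  also have "2 * z / 2 * t = t * z" for z :: real by simp
  finally show ?thesis .
qed

text \<open>The test function has \<open>\<phi>'(x) = arsinh (x / d) / l\<close>: a smooth variant of the Yamada--Watanabe
  function, which compensates the factor \<open>\<bar>x\<bar>\<close> in the diffusion coefficient.\<close>

lemma abs_expectation_le_log:
  assumes d: "0 < d" "d < 1" and e: "0 \<le> e" and k: "0 \<le> k"
    and H: "\<And>u \<omega>. u \<in> {0..T} \<Longrightarrow> \<omega> \<in> space M \<Longrightarrow> H u \<omega> ^ 2 \<le> 2 * e + 2 * k * \<bar>Y u \<omega>\<bar>"
    and t: "t \<in> {0..T}"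
  shows "expectation (\<lambda>\<omega>. \<bar>Y t \<omega>\<bar>) \<le> (1 + t * (e / d + k)) / ln (1 / d)"
proof -
  define l where "l = ln (1 / d)"
  have l: "0 < l" using d by (simp add: l_def)
  define w where "w x = sqrt (d\<^sup>2 + x\<^sup>2)" for x
  note w = sqrt_square_sum_bounds[OF d(1), folded w_def]
  have Dw: "(w has_real_derivative x / w x) (at x)" for x
    unfolding w_def[abs_def] by (rule has_derivative_sqrt_square_sum[OF d(1)])
  have wd: "w x = d * sqrt ((x / d)\<^sup>2 + 1)" for x
  proof -
    have "d\<^sup>2 + x\<^sup>2 = d\<^sup>2 * ((x / d)\<^sup>2 + 1)" using d by (simp add: field_simps)
    then show ?thesis using d by (simp add: w_def real_sqrt_mult)
  qed
  have Da: "((\<lambda>x. arsinh (x / d)) has_real_derivative 1 / w x) (at x)" for x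
  proof -
    have "((\<lambda>x. arsinh (x / d)) has_real_derivative 1 / sqrt ((x / d)\<^sup>2 + 1) * (1 / d)) (at x)"
      by (intro DERIV_chain2[OF arsinh_real_has_field_derivative] DERIV_cdivide DERIV_ident)
    then show ?thesis by (simp add: wd mult.commute)
  qed
  \<comment> \<open>The antiderivative of \<open>arsinh (x / d) / l\<close> that vanishes at
    \<open>0\<close>, as \<open>w 0 = d\<close>; its second derivative is
    \<open>1 / (w x * l)\<close>.\<close>
  define f where "f x = (x * arsinh (x / d) - w x + d) / l" for x
  have D0: "(f has_real_derivative arsinh (x / d) / l) (at x)" for x
  proof -
    have "(f has_real_derivative (1 * arsinh (x / d) + 1 / w x * x - x / w x + 0) / l) (at x)"
      unfolding f_def[abs_def]
      by (intro DERIV_cdivide DERIV_add DERIV_diff DERIV_mult DERIV_ident Dw Da DERIV_const)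
    then show ?thesis by simp
  qed
  have D1: "((\<lambda>x. arsinh (x / d) / l) has_real_derivative 1 / w x / l) (at x)" for x
    by (intro DERIV_cdivide Da)
  have D2: "((\<lambda>x. 1 / w x / l) has_real_derivative (- (x / w x) / (w x)\<^sup>2 / l)) (at x)" for x
  proof -
    have "((\<lambda>x. 1 / w x) has_real_derivative (0 * w x - 1 * (x / w x)) / (w x * w x)) (at x)"
      using w(3)[of x] by (intro DERIV_divide DERIV_const Dw) auto
    then have "((\<lambda>x. 1 / w x / l) has_real_derivative (0 * w x - 1 * (x / w x)) / (w x * w x) / l) (at x)"
      by (rule DERIV_cdivide)
    then show ?thesis by (simp add: power2_eq_square)
  qed
  have Q: "\<bar>1 / w x / l\<bar> \<le> 1 / d / l" for x
    using w(2,3)[of x] d l by (simp add: divide_simps)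
  have L: "\<bar>- (x / w x) / (w x)\<^sup>2 / l\<bar> \<le> 1 / d\<^sup>2 / l" for x
  proof -
    have "\<bar>x / w x\<bar> \<le> 1" using w(1,3)[of x] by (simp add: divide_le_eq)
    moreover have "d\<^sup>2 \<le> (w x)\<^sup>2" using w(2)[of x] d by (intro power_mono) auto
    ultimately have "\<bar>x / w x\<bar> / (w x)\<^sup>2 \<le> 1 / d\<^sup>2"
      using d w(3)[of x] by (intro frac_le) auto
    then have "\<bar>x / w x\<bar> / (w x)\<^sup>2 / l \<le> 1 / d\<^sup>2 / l"
      using l by (intro divide_right_mono) auto
    then show ?thesis using l by (simp add: abs_mult)
  qed
  \<comment> \<open>The second derivative is at most \<open>1 / (\<bar>y\<bar> * l)\<close>, which
    cancels the linear growth of the squared integrand, and at most \<open>1 / (d * l)\<close>,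
    which handles \<open>e\<close>; the gain is the factor \<open>1 / l\<close>.\<close>
  have A: "1 / w (Y u \<omega>) / l * H u \<omega> ^ 2 \<le> 2 * (e / d + k) / l"
    if "u \<in> {0..T}" "\<omega> \<in> space M" for u \<omega>
  proof -
    define y where "y = Y u \<omega>"
    have "H u \<omega> ^ 2 / w y \<le> (2 * e + 2 * k * \<bar>y\<bar>) / w y"
      using H[OF that] w(3)[of y] unfolding y_def by (intro divide_right_mono) auto
    also have "\<dots> = 2 * (e / w y + k * (\<bar>y\<bar> / w y))"
      by (simp add: add_divide_distrib)
    also have "\<dots> \<le> 2 * (e / d + k * 1)"
      using w(1,2,3)[of y] d e k by (intro mult_left_mono add_mono divide_left_mono) auto
    finally have "H u \<omega> ^ 2 / w y / l \<le> 2 * (e / d + k) / l"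
      using l by (intro divide_right_mono) auto
    then show ?thesis by (simp add: y_def)
  qed
  note g = expectation_le_of_generator_bound[OF D0 D1 Q lipschitz_of_derivative_bound[OF D2 L] A t]
  \<comment> \<open>With \<open>a = \<bar>x\<bar>\<close>: \<open>arsinh z >= ln z\<close> gives
    \<open>x * arsinh (x / d) >= a * (ln a + l)\<close>, and \<open>a * ln a >= a - 1\<close>
    together with \<open>w x <= d + a\<close> leaves \<open>a * l - 1\<close>.\<close>
  have f_ge: "\<bar>x\<bar> \<le> f x + 1 / l" for x
  proof -
    have "\<bar>x\<bar> * l - 1 \<le> x * arsinh (x / d) - w x + d"
    proof (cases "x = 0")
      case True
      then show ?thesis using d by (simp add: w_def)
    next
      case False
      define a where "a = \<bar>x\<bar>"
      have a: "0 < a" using False by (simp add: a_def)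
      have "x * arsinh (x / d) = a * arsinh (a / d)"
        using arsinh_minus_real[of "x / d"] by (simp add: a_def abs_if)
      moreover have "ln (a / d) \<le> arsinh (a / d)"
        unfolding arsinh_real_def using a d by (subst ln_le_cancel_iff) (auto simp: add_pos_pos add_nonneg_pos)
      then have "ln a + l \<le> arsinh (a / d)"
        using a d by (simp add: l_def ln_div)
      then have "a * (ln a + l) \<le> a * arsinh (a / d)"
        using a by (intro mult_left_mono) auto
      moreover have "a - 1 \<le> a * ln a"
      proof -
        have "ln (1 / a) \<le> 1 / a - 1" using a by (intro ln_le_minus_one) auto
        then have "1 - 1 / a \<le> ln a" using a by (simp add: ln_div)
        then have "a * (1 - 1 / a) \<le> a * ln a" using a by (intro mult_left_mono) auto
        then show ?thesis using a by (simp add: right_diff_distrib)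
      qed
      moreover have "w x \<le> d + a" using w(4)[of x] by (simp add: a_def)
      ultimately show ?thesis by (simp add: distrib_left flip: a_def)
    qed
    then have "(\<bar>x\<bar> * l - 1) / l \<le> f x"
      unfolding f_def using l by (intro divide_right_mono) auto
    then show ?thesis using l by (simp add: diff_divide_distrib)
  qed
  have "expectation (\<lambda>\<omega>. \<bar>Y t \<omega>\<bar>) \<le> expectation (\<lambda>\<omega>. f (Y t \<omega>) + 1 / l)"
    using integrable_abs[OF Y_power_integrable[OF t, of 1]] g(1) f_ge by (intro integral_mono) auto
  also have "\<dots> = expectation (\<lambda>\<omega>. f (Y t \<omega>)) + 1 / l"
    using g(1) by (simp add: prob_space)
  also have "\<dots> \<le> (f 0 + 2 * (e / d + k) / l / 2 * t) + 1 / l"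
    using g(2) by simp
  also have "f 0 = 0" using d by (simp add: f_def w_def)
  also have "(0 + 2 * z / l / 2 * t) + 1 / l = (1 + t * z) / l" for z
    using l by (simp add: field_simps)
  finally show ?thesis by (simp add: l_def)
qed

text \<open>The linear bound on the squared integrand turns control of the mean of
  \<open>\<bar>Y u\<bar>\<close> into control of its second moment, to which the isometry and the
  maximal inequality apply. This step is common to both rates.\<close>

lemma sup_expectation_le_of_abs:
  assumes cont: "AE \<omega> in M. continuous_on {0..T} (\<lambda>t. Y t \<omega>)"
    and e: "0 < e" and k: "0 \<le> k" and r: "\<And>t. t \<in> {0..T} \<Longrightarrow> expectation (\<lambda>\<omega>. \<bar>Y t \<omega>\<bar>) \<le> r"
    and H: "\<And>u \<omega>. u \<in> {0..T} \<Longrightarrow> \<omega> \<in> space M \<Longrightarrow> H u \<omega> ^ 2 \<le> 2 * e + 2 * k * \<bar>Y u \<omega>\<bar>"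
  shows "(\<integral>\<^sup>+\<omega>. (SUP t\<in>{0..T}. ennreal \<bar>Y t \<omega>\<bar>) \<partial>M) \<le> ennreal (5 * sqrt ((2 * e + 2 * k * r) * T))"
proof (rule sup_expectation_le[OF cont])
  have iY: "integrable M (\<lambda>\<omega>. \<bar>Y u \<omega>\<bar>)" if "u \<in> {0..T}" for u
    using integrable_abs[OF Y_power_integrable[OF that, of 1]] by simp
  have "0 \<le> expectation (\<lambda>\<omega>. \<bar>Y 0 \<omega>\<bar>)" by simp
  also have "\<dots> \<le> r" using r[of 0] T_pos by simp
  finally have r0: "0 \<le> r" .
  show "expectation (\<lambda>\<omega>. Y T \<omega> ^ 2) \<le> (2 * e + 2 * k * r) * T"
  proof (rule Y_square_le)
    show "T \<in> {0..T}" using T_pos by simp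
    fix u assume "u \<in> {0..T}"
    then have "expectation (\<lambda>\<omega>. H u \<omega> ^ 2) \<le> expectation (\<lambda>\<omega>. 2 * e + 2 * k * \<bar>Y u \<omega>\<bar>)"
      using H H_power_integrable iY by (intro integral_mono) auto
    also have "\<dots> = 2 * e + 2 * k * expectation (\<lambda>\<omega>. \<bar>Y u \<omega>\<bar>)"
      using iY[OF \<open>u \<in> {0..T}\<close>] by (simp add: prob_space)
    also have "\<dots> \<le> 2 * e + 2 * k * r"
      using r[OF \<open>u \<in> {0..T}\<close>] k by (intro add_left_mono mult_left_mono) auto
    finally show "expectation (\<lambda>\<omega>. H u \<omega> ^ 2) \<le> 2 * e + 2 * k * r" .
  qed
  show "0 < (2 * e + 2 * k * r) * T"
    using e k r0 T_pos by (intro mult_pos_pos add_pos_nonneg) auto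
qed

end

section \<open>The convergence rate\<close>

text \<open>Since the increments of the Cantor function are bounded by \<open>1\<close>, the exponent \<open>2 * H \<ge> 1\<close> can be
  lowered to \<open>1\<close>.\<close>

lemma cantor_coefficient_diff_square:
  fixes lam e x y :: real
  assumes lam: "0 < lam" "lam \<le> 1 / 2"
    and e: "\<And>x. \<bar>ext01 (cantor_fun lam) x - g x\<bar> \<le> e"
  defines "h \<equiv> ext01 (cantor_fun lam) x - g y"
    and "Hexp \<equiv> hoelder_exponent lam" and "k \<equiv> (lam powr - hoelder_exponent lam)\<^sup>2"
  shows "\<bar>h\<bar> \<le> 1 + e" and "h\<^sup>2 \<le> 2 * e\<^sup>2 + 2 * k * \<bar>x - y\<bar> powr (2 * Hexp)"
    and "h\<^sup>2 \<le> 2 * e\<^sup>2 + 2 * k * \<bar>x - y\<bar>"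
proof -
  define c where "c = ext01 (cantor_fun lam)"
  note c = ext01_cantor_fun_hoelder[OF lam, folded c_def]
  have Hexp: "1 / 2 \<le> Hexp" "Hexp < 1"
    using hoelder_exponent_bounds[OF lam] by (auto simp: Hexp_def)
  \<comment> \<open>In this splitting the Hoelder estimate falls on the Cantor function and the
    iterate enters through its uniform distance \<open>e\<close>, so \<open>k\<close> does not
    depend on the iterate.\<close>
  have h: "h = (c x - c y) + (c y - g y)" by (simp add: h_def c_def)
  have e0: "\<bar>c y - g y\<bar> \<le> e" using e by (simp add: c_def)
  have c1: "\<bar>c x - c y\<bar> \<le> 1" using c(1,2)[of x] c(1,2)[of y] by linarith
  show "\<bar>h\<bar> \<le> 1 + e" using c1 e0 h by linarith
  have "(c y - g y)\<^sup>2 \<le> e\<^sup>2" using e0 by (simp flip: abs_le_square_iff)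
  moreover have "h\<^sup>2 \<le> 2 * (c x - c y)\<^sup>2 + 2 * (c y - g y)\<^sup>2"
  proof -
    have "(a + b)\<^sup>2 \<le> 2 * a\<^sup>2 + 2 * b\<^sup>2" for a b :: real
      using zero_le_power2[of "a - b"] by (simp add: power2_eq_square algebra_simps)
    then show ?thesis unfolding h .
  qed
  ultimately have *: "h\<^sup>2 \<le> 2 * e\<^sup>2 + 2 * (c x - c y)\<^sup>2" by linarith
  have sq: "(c x - c y)\<^sup>2 \<le> (lam powr - Hexp * \<bar>x - y\<bar> powr Hexp)\<^sup>2"
    using c(3)[of x y] unfolding Hexp_def by (intro iffD1[OF abs_le_square_iff]) simp
  have cH: "(c x - c y)\<^sup>2 \<le> k * \<bar>x - y\<bar> powr (2 * Hexp)"
  proof -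
    have "(\<bar>x - y\<bar> powr Hexp)\<^sup>2 = \<bar>x - y\<bar> powr (2 * Hexp)"
      by (simp add: power2_eq_square flip: powr_add)
    then show ?thesis
      using sq by (simp add: k_def Hexp_def power_mult_distrib)
  qed
  with * show "h\<^sup>2 \<le> 2 * e\<^sup>2 + 2 * k * \<bar>x - y\<bar> powr (2 * Hexp)" by simp
  have "lam powr Hexp \<le> 1 powr Hexp" using lam Hexp by (intro powr_mono2) auto
  then have "1 \<le> lam powr - Hexp"
    using lam by (simp add: powr_minus one_le_inverse_iff)
  then have "1 * 1 \<le> lam powr - Hexp * lam powr - Hexp" by (intro mult_mono) auto
  then have k: "1 \<le> k"
    by (simp add: k_def Hexp_def power2_eq_square)
  have "(c x - c y)\<^sup>2 \<le> k * \<bar>x - y\<bar>"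
  proof (cases "\<bar>x - y\<bar> \<le> 1")
    case True
    have "\<bar>x - y\<bar> powr (2 * Hexp) \<le> \<bar>x - y\<bar> powr 1"
      using True Hexp by (intro powr_mono') auto
    then have "k * \<bar>x - y\<bar> powr (2 * Hexp) \<le> k * \<bar>x - y\<bar>"
      using k by (intro mult_left_mono) auto
    with cH show ?thesis by simp
  next
    case False
    have "(c x - c y)\<^sup>2 \<le> 1\<^sup>2" using c1 by (simp add: abs_square_le_1)
    also have "\<dots> \<le> k * \<bar>x - y\<bar>" using mult_mono[of 1 k 1 "\<bar>x - y\<bar>"] k False by simp
    finally show ?thesis .
  qed
  with * show "h\<^sup>2 \<le> 2 * e\<^sup>2 + 2 * k * \<bar>x - y\<bar>" by simp
qed

lemma half_power_square: "((1 / 2) ^ n)\<^sup>2 = 2 powr (- 2 * real n)"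
proof -
  have "(1 / 2) ^ n = 2 powr (- real n)"
    by (simp add: powr_minus powr_realpow power_one_over inverse_eq_divide)
  then show ?thesis
    by (simp add: power2_eq_square flip: powr_add)
qed

text \<open>\<open>C\<close> precedes the probability space, the Brownian motion, \<open>x0\<close>
  and the solutions in the order of quantifiers, so it depends on \<open>T\<close>,
  \<open>lam\<close> and \<open>c0\<close> alone. The expectation is an integral of extended
  nonnegative values, meaningful before the supremum is known to be integrable.\<close>

theorem corollary1p1:
  fixes T lam :: real and c0 :: "real \<Rightarrow> real"
  assumes "T > 0" and "0 < lam" and "lam \<le> 1 / 2"
    and "bounded (c0 ` {0..1})"
    and "\<exists>cH>0. \<forall>x y. \<bar>x - y\<bar> \<le> 1 \<longrightarrow>
           \<bar>ext01 c0 x - ext01 c0 y\<bar> \<le> cH * \<bar>x - y\<bar> powr hoelder_exponent lam"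
  shows "\<exists>C>0. \<forall>(M :: 'a measure) F B x0 X Xn.
    filtered_prob_space M F \<longrightarrow> brownian_motion M F B \<longrightarrow> 0 < x0 \<longrightarrow> x0 < 1 \<longrightarrow>
    sde_solution M F B T (ext01 (cantor_fun lam)) x0 X \<longrightarrow>
    (\<forall>n\<ge>1. sde_solution M F B T (ext01 (cantor_iter lam c0 n)) x0 (Xn n)) \<longrightarrow>
    (\<forall>n\<ge>1. (\<integral>\<^sup>+\<omega>. (SUP t\<in>{0..T}. ennreal \<bar>X t \<omega> - Xn n t \<omega>\<bar>) \<partial>M)
      \<le> ennreal (C * (if lam = 1 / 2 then real n powr (- 1 / 2)
                      else 2 powr (- real n * (1 - 1 / (2 * hoelder_exponent lam))))))"
proof -
  note lam = assms(2,3)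
  have lam1: "lam < 1" using lam by simp
  define Hexp where "Hexp = hoelder_exponent lam"
  have Hexp: "1 / 2 \<le> Hexp" "Hexp < 1"
    using hoelder_exponent_bounds[OF lam] by (auto simp: Hexp_def)
  define k where "k = (lam powr - hoelder_exponent lam)\<^sup>2"
  have k0: "0 \<le> k" by (simp add: k_def)
  obtain K0 where K0: "1 \<le> K0" and
    close: "\<And>n x. \<bar>ext01 (cantor_fun lam) x - ext01 (cantor_iter lam c0 n) x\<bar> \<le> K0 * (1 / 2) ^ n"
    using ext01_cantor_iter_close[OF lam(1) lam1 assms(4)] by metis
  \<comment> \<open>\<open>W\<close> is the constant in the bound \<open>W * rho n\<close> on the
    mean of \<open>\<bar>Y t\<bar>\<close>: the \<open>1\<close> covers the value of the test
    function at \<open>0\<close>, or its offset from the absolute value in the logarithmic case, and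
    the rest is the generator bound over time \<open>T\<close>. \<open>V\<close> arises by inserting
    this into the second moment of \<open>Y T\<close>.\<close>
  define W where "W = 1 + T * (K0\<^sup>2 + k)"
  define V where "V = (2 * K0\<^sup>2 + 2 * k * W) * T"
  have W0: "0 < W" using assms(1) k0 by (simp add: W_def add_pos_nonneg)
  have V0: "0 < V" unfolding V_def
    using K0 k0 W0 assms(1) by (intro mult_pos_pos add_pos_nonneg) auto
  \<comment> \<open>The square of the claimed rate, and the order of both the mean of
    \<open>\<bar>Y t\<bar>\<close> and the second moment.\<close>
  define rho where "rho n = (if lam = 1 / 2 then 1 / real n else 2 powr (- real n * (2 - 1 / Hexp)))" for n
  have rate: "sqrt (rho n) = (if lam = 1 / 2 then real n powr (- 1 / 2)
                      else 2 powr (- real n * (1 - 1 / (2 * Hexp))))" if "1 \<le> n" for n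
  proof -
    have "sqrt (2 powr (- real n * (2 - 1 / Hexp))) = (2 powr (- real n * (2 - 1 / Hexp))) powr (1 / 2)"
      by (rule powr_half_sqrt[symmetric]) simp
    also have "\<dots> = 2 powr (- real n * (1 - 1 / (2 * Hexp)))"
      unfolding powr_powr by (intro arg_cong[of _ _ "(powr) 2"]) (simp add: algebra_simps)
    finally show ?thesis
      using that by (simp add: rho_def real_sqrt_divide powr_minus_divide powr_half_sqrt)
  qed
  have bound: "(\<integral>\<^sup>+\<omega>. (SUP t\<in>{0..T}. ennreal \<bar>X t \<omega> - Xn n t \<omega>\<bar>) \<partial>M) \<le> ennreal (5 * sqrt V * sqrt (rho n))"
    if "filtered_prob_space M F" "brownian_motion M F B" "1 \<le> n"
      and X: "sde_solution M F B T (ext01 (cantor_fun lam)) x0 X"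
      and Xn: "sde_solution M F B T (ext01 (cantor_iter lam c0 n)) x0 (Xn n)"
    for M :: "'a measure" and F B x0 X Xn and n :: nat
  proof -
    interpret filtered_prob_space M F by fact
    interpret brownian_setting M F B by unfold_locales fact
    define e where "e = K0 * (1 / 2) ^ n"
    have e0: "0 < e" using K0 by (simp add: e_def)
    have e2: "e\<^sup>2 = K0\<^sup>2 * 2 powr (- 2 * real n)"
      unfolding e_def power_mult_distrib half_power_square ..
    define h where "h s \<omega> = ext01 (cantor_fun lam) (X s \<omega>) - ext01 (cantor_iter lam c0 n) (Xn n s \<omega>)" for s \<omega>
    \<comment> \<open>Written with \<open>x0\<close> twice so that the integrals supplied by the two
      equations are subtracted literally.\<close>
    define Y where "Y s \<omega> = (X s \<omega> - x0) - (Xn n s \<omega> - x0)" for s \<omega>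
    have Y: "Y s \<omega> = X s \<omega> - Xn n s \<omega>" for s \<omega> by (simp add: Y_def)
    note h_bounds = cantor_coefficient_diff_square[OF lam close, of _ n, folded e_def Hexp_def k_def]
    interpret bounded_ito_process M F B T "1 + e" h Y
    proof
      show "0 < T" by fact
      fix t assume t: "t \<in> {0..T}"
      show "Y t \<in> borel_measurable (F t)"
        using X Xn t unfolding sde_solution_def Y[abs_def] by (intro borel_measurable_diff) auto
      show "has_ito_integral M F B h t (Y t)"
        using X Xn t unfolding sde_solution_def h_def[abs_def] Y_def[abs_def]
        by (intro has_ito_integral_diff) auto
    next
      show "\<bar>h u \<omega>\<bar> \<le> 1 + e" for u \<omega>
        unfolding h_def by (rule h_bounds(1))
    qed
    have "AE \<omega> in M. continuous_on {0..T} (\<lambda>t. X t \<omega>)" "AE \<omega> in M. continuous_on {0..T} (\<lambda>t. Xn n t \<omega>)"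
      using X Xn by (auto simp: sde_solution_def)
    then have cont: "AE \<omega> in M. continuous_on {0..T} (\<lambda>t. Y t \<omega>)"
      unfolding Y by eventually_elim (rule continuous_on_diff)
    have h2: "h u \<omega> ^ 2 \<le> 2 * e\<^sup>2 + 2 * k * \<bar>Y u \<omega>\<bar> powr (2 * Hexp)"
      "h u \<omega> ^ 2 \<le> 2 * e\<^sup>2 + 2 * k * \<bar>Y u \<omega>\<bar>" for u \<omega>
      unfolding h_def Y by (rule h_bounds)+
    have r0: "0 < rho n" using that(3) by (simp add: rho_def)
    have r: "expectation (\<lambda>\<omega>. \<bar>Y t \<omega>\<bar>) \<le> W * rho n" if t: "t \<in> {0..T}" for t
    proof (cases "lam = 1 / 2")
      case True
      \<comment> \<open>This is of order \<open>e^2\<close>: the quotient \<open>e^2 / d\<close> is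
        the constant \<open>K0^2\<close>, while \<open>ln (1 / d) = 2 * ln 2 * n\<close> is at least
        \<open>n\<close>.\<close>
      define d where "d = 2 powr (- 2 * real n)"
      have d: "0 < d" "d < 1" using \<open>1 \<le> n\<close> by (auto simp: d_def powr_less_one)
      have l: "ln (1 / d) = 2 * ln 2 * real n" by (simp add: d_def ln_div)
      have "ln 2 \<ge> (1 / 2 :: real)"
        using ln_le_minus_one[of "1 / 2 :: real"] by (simp add: ln_div)
      have "expectation (\<lambda>\<omega>. \<bar>Y t \<omega>\<bar>) \<le> (1 + t * (e\<^sup>2 / d + k)) / ln (1 / d)"
        using k0 h2(2) by (intro abs_expectation_le_log[OF d _ _ _ t]) auto
      also have "\<dots> \<le> W / real n"
      proof (rule frac_le)
        show "1 + t * (e\<^sup>2 / d + k) \<le> W"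
          unfolding W_def e2 d_def using t k0 by (simp add: mult_right_mono)
        show "real n \<le> ln (1 / d)"
          unfolding l using \<open>1 / 2 \<le> ln 2\<close> mult_right_mono[of 1 "2 * ln 2" "real n"] by simp
      qed (use W0 \<open>1 \<le> n\<close> in auto)
      finally show ?thesis using True by (simp add: rho_def)
    next
      case False
      \<comment> \<open>The balancing scale: \<open>e^2 / d\<close> becomes
        \<open>K0^2 * rho n\<close> and \<open>d powr (2 * Hexp - 1)\<close> becomes
        \<open>rho n\<close>, while \<open>d\<close> itself is no larger than \<open>rho n\<close>
        because \<open>Hexp < 1\<close>.\<close>
      define d where "d = 2 powr (- real n / Hexp)"
      have d: "0 < d" by (simp add: d_def)
      have rho: "rho n = 2 powr (- real n * (2 - 1 / Hexp))" using False by (simp add: rho_def)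
      have 1: "e\<^sup>2 / d = K0\<^sup>2 * rho n"
      proof -
        have "e\<^sup>2 / d = K0\<^sup>2 * (2 powr (- 2 * real n) / 2 powr (- real n / Hexp))"
          unfolding e2 d_def by simp
        also have "\<dots> = K0\<^sup>2 * 2 powr (- 2 * real n - - real n / Hexp)"
          by (simp only: powr_diff)
        also have "- 2 * real n - - real n / Hexp = - real n * (2 - 1 / Hexp)"
          by (simp add: algebra_simps)
        finally show ?thesis unfolding rho .
      qed
      have 2: "d powr (2 * Hexp - 1) = rho n"
        unfolding d_def rho powr_powr using Hexp
        by (intro arg_cong[of _ _ "(powr) 2"]) (simp add: field_simps)
      have 3: "d \<le> rho n"
      proof -
        have "2 - 1 / Hexp \<le> 1 / Hexp" using Hexp by (simp add: field_simps)
        then have "real n * (2 - 1 / Hexp) \<le> real n * (1 / Hexp)" by (intro mult_left_mono) auto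
        then show ?thesis unfolding d_def rho by (intro powr_mono) auto
      qed
      have "expectation (\<lambda>\<omega>. \<bar>Y t \<omega>\<bar>) \<le> d + t * (e\<^sup>2 / d + k * d powr (2 * Hexp - 1))"
        using k0 h2(1) Hexp by (intro abs_expectation_le_powr[OF d _ _ _ _ _ t]) auto
      also have "\<dots> \<le> rho n + T * (K0\<^sup>2 * rho n + k * rho n)"
        unfolding 1 2 using 3 t k0 r0 by (intro add_mono mult_right_mono) auto
      also have "\<dots> = W * rho n" by (simp add: W_def algebra_simps)
      finally show ?thesis .
    qed
    \<comment> \<open>The uniform error also enters the second moment directly. It is absorbed
      because \<open>4 ^ n >= n\<close> in the critical case and \<open>2 - 1 / Hexp <= 2\<close> in
      the other.\<close>
    have e_rho: "e\<^sup>2 \<le> K0\<^sup>2 * rho n"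
    proof (cases "lam = 1 / 2")
      case True
      have "2 powr (- 2 * real n) = ((1 / 2) ^ n)\<^sup>2" by (rule half_power_square[symmetric])
      also have "\<dots> \<le> (1 / 2) ^ n * 1" unfolding power2_eq_square
        by (intro mult_left_mono) (auto simp: power_le_one)
      also have "\<dots> \<le> 1 / real n"
        using \<open>1 \<le> n\<close> of_nat_less_two_power[of n, where 'a = real]
        by (simp add: power_one_over divide_simps)
      also have "\<dots> = rho n" using True by (simp add: rho_def)
      finally show ?thesis unfolding e2 by (intro mult_left_mono) auto
    next
      case False
      have "- 2 * real n \<le> - real n * (2 - 1 / Hexp)" using Hexp by (simp add: algebra_simps)
      then have "2 powr (- 2 * real n) \<le> rho n" using False by (simp add: rho_def)
      then show ?thesis unfolding e2 by (intro mult_left_mono) auto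
    qed
    have "(\<integral>\<^sup>+\<omega>. (SUP t\<in>{0..T}. ennreal \<bar>Y t \<omega>\<bar>) \<partial>M) \<le> ennreal (5 * sqrt ((2 * e\<^sup>2 + 2 * k * (W * rho n)) * T))"
      using e0 k0 h2(2) by (intro sup_expectation_le_of_abs[OF cont _ _ r]) auto
    also have "\<dots> \<le> ennreal (5 * sqrt (V * rho n))"
    proof (intro ennreal_leI mult_left_mono real_sqrt_le_mono)
      have "(2 * e\<^sup>2 + 2 * k * (W * rho n)) * T \<le> (2 * (K0\<^sup>2 * rho n) + 2 * k * (W * rho n)) * T"
        using e_rho assms(1) by (intro mult_right_mono add_right_mono mult_left_mono) auto
      also have "\<dots> = V * rho n" by (simp add: V_def algebra_simps)
      finally show "(2 * e\<^sup>2 + 2 * k * (W * rho n)) * T \<le> V * rho n" .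
    qed simp
    finally show ?thesis
      unfolding Y by (simp add: real_sqrt_mult mult.assoc)
  qed
  show ?thesis
  proof (intro exI[of _ "5 * sqrt V"] conjI allI impI)
    show "0 < 5 * sqrt V" using V0 by simp
    fix M :: "'a measure" and F B x0 X Xn and n :: nat
    assume "filtered_prob_space M F" "brownian_motion M F B" "1 \<le> n"
      "sde_solution M F B T (ext01 (cantor_fun lam)) x0 X"
      "\<forall>n\<ge>1. sde_solution M F B T (ext01 (cantor_iter lam c0 n)) x0 (Xn n)"
    then show "(\<integral>\<^sup>+\<omega>. (SUP t\<in>{0..T}. ennreal \<bar>X t \<omega> - Xn n t \<omega>\<bar>) \<partial>M)
      \<le> ennreal (5 * sqrt V * (if lam = 1 / 2 then real n powr (- 1 / 2)
                      else 2 powr (- real n * (1 - 1 / (2 * hoelder_exponent lam)))))"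
      using bound[of M F B n x0 X Xn] unfolding rate[OF \<open>1 \<le> n\<close>] Hexp_def by blast
  qed
qed

end
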